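(* Let $I$ be a homogeneous ideal of $R=k[x_1,\ldots,x_n]$ such that $A=R/I$ is a (nonzero) standard graded Artinian $k$-algebra. The following statements are equivalent: (1) $A=R/I$ has the weak Lefschetz property. (2) If $T$ is a minimal generator of $\mathrm{gin}(I)$ of degree $d$ with $\max(T)=n$, then $d\ge r_1(R/I)+1$; i.e. $|\alpha|+f_n(\alpha_1,\ldots,\alpha_{n-1})\ge r_1(A)+1$ for any $(\alpha_1,\ldots,\alpha_{n-1})\in J_{n-1}$, where $|\alpha|=\sum_{i=1}^{n-1}\alpha_i$. (3) $\beta_{n-1,n-1+j}(\mathrm{gin}(I))=0$ for all $j\le r_1(A)$.
   Context: $k$ is a field of characteristic $0$, $R=k[x_1,\ldots,x_n]$ with the standard grading, $n\ge 2$. $\mathrm{gin}(I)$ denotes the generic initial ideal of $I$ with respect to the reverse lexicographic order (with $x_1>\cdots>x_n$): $\mathrm{gin}(I)=\mathrm{in}(gI)$ for $g$ in a nonempty Zariski open subset of $GL_n(k)$. The minimal generators of a monomial ideal are its minimal monomial generators. For a monomial $T\in R$, $\max(T)=\max\{i \mid x_i \text{ divides } T\}$. For a homogeneous ideal $K$, $\beta_{q,i}(K)=\dim_k\mathrm{Tor}^R_q(K,k)_i$. Weak Lefschetz property of $A=R/I$: there is a linear form $L\in R$ such that $\times L:A_d\to A_{d+1}$ has maximal rank (is injective or surjective) for each $d\ge 0$. First reduction number: $r_1(A)=\min\{t \mid (R/(I+(L)))_{t+1}=0\}$, where $L$ is a general linear form of $R$. Functions $f_i$: $f_1=\min\{t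 \mid x_1^t\in\mathrm{gin}(I)\}$, and for $2\le i\le n$ and $(\alpha_1,\ldots,\alpha_{i-1})\in\mathbb{Z}_{\ge 0}^{i-1}$, $f_i(\alpha_1,\ldots,\alpha_{i-1})=\min\{t\ge 0 \mid x_1^{\alpha_1}\cdots x_{i-1}^{\alpha_{i-1}}x_i^t\in\mathrm{gin}(I)\}$. For $1\le i\le n-1$, $J_i$ is the set of $(\alpha_1,\ldots,\alpha_i)\in\mathbb{Z}_{\ge 0}^i$ such that $0\le\alpha_1<f_1$ and $0\le\alpha_j<f_j(\alpha_1,\ldots,\alpha_{j-1})$ for each $2\le j\le i$. *)

theory Defs
  imports
    "Jordan_Normal_Form.Matrix"
    "HOL-Algebra.QuotRing"
    "HOL-Library.Function_Algebras"
    "HOL-Library.Poly_Mapping"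
begin

section \<open>The polynomial ring\<close>

text \<open>A monomial is its exponent vector, a finitely supported function; the variable \<open>x\<^sub>i\<close> has
  index \<open>i\<close>, and \<open>k[x\<^sub>1, \<dots>, x\<^sub>n]\<close> consists of the polynomials in which only the indices \<open>1, \<dots>, n\<close>
  occur.\<close>

type_synonym 'k mpoly = "(nat \<Rightarrow>\<^sub>0 nat) \<Rightarrow>\<^sub>0 'k"

definition polys :: "'x set \<Rightarrow> (('x \<Rightarrow>\<^sub>0 nat) \<Rightarrow>\<^sub>0 'k::zero) set" where
  "polys X = {p. \<forall>m\<in>Poly_Mapping.keys p. Poly_Mapping.keys m \<subseteq> X}"

definition poly_ring :: "nat \<Rightarrow> ('k::field mpoly) ring" where
  "poly_ring n = \<lparr>carrier = polys {1..n}, mult = (*), one = 1, zero = 0, add = (+)\<rparr>"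

definition const :: "'k::zero \<Rightarrow> 'k mpoly" where
  "const c = Poly_Mapping.single 0 c"

definition xmonom :: "(nat \<Rightarrow>\<^sub>0 nat) \<Rightarrow> 'k::field mpoly" where
  "xmonom m = Poly_Mapping.single m 1"

definition xvar :: "nat \<Rightarrow> 'k::field mpoly" where
  "xvar i = xmonom (Poly_Mapping.single i 1)"

definition mdeg :: "(nat \<Rightarrow>\<^sub>0 nat) \<Rightarrow> nat" where
  "mdeg m = (\<Sum>i\<in>Poly_Mapping.keys m. Poly_Mapping.lookup m i)"

text \<open>The graded component \<open>R\<^sub>e\<close>; it is \<open>{0}\<close> for \<open>e < 0\<close>.\<close>

definition homog :: "nat \<Rightarrow> int \<Rightarrow> 'k::field mpoly set" where
  "homog n e = {p \<in> carrier (poly_ring n). \<forall>m\<in>Poly_Mapping.keys p. int (mdeg m) = e}"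

definition homogeneous_ideal :: "nat \<Rightarrow> 'k::field mpoly set \<Rightarrow> bool" where
  "homogeneous_ideal n I \<longleftrightarrow> (\<exists>S \<subseteq> (\<Union>e. homog n e). I = Idl\<^bsub>poly_ring n\<^esub> S)"

text \<open>Evaluation of a polynomial at a family \<open>\<theta>\<close> of values for the variables, the coefficients
  being mapped by \<open>c\<close>.\<close>

definition subst_poly ::
  "('k \<Rightarrow> 'b::comm_ring_1) \<Rightarrow> ('x \<Rightarrow> 'b) \<Rightarrow> (('x \<Rightarrow>\<^sub>0 nat) \<Rightarrow>\<^sub>0 'k::zero) \<Rightarrow> 'b" where
  "subst_poly c \<theta> p = (\<Sum>m\<in>Poly_Mapping.keys p.
     c (Poly_Mapping.lookup p m) * (\<Prod>v\<in>Poly_Mapping.keys m. \<theta> v ^ Poly_Mapping.lookup m v))"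


section \<open>Quotients, the weak Lefschetz property and the first reduction number\<close>

definition artinian_ring :: "('a, 'b) ring_scheme \<Rightarrow> bool" where
  "artinian_ring A \<longleftrightarrow>
     (\<forall>C :: nat \<Rightarrow> 'a set. (\<forall>i. ideal (C i) A \<and> C (Suc i) \<subseteq> C i) \<longrightarrow> (\<exists>m. \<forall>i\<ge>m. C i = C m))"

text \<open>The component of degree \<open>d\<close> of \<open>R/I\<close>, a set of cosets.\<close>

definition quot_comp :: "nat \<Rightarrow> 'k::field mpoly set \<Rightarrow> nat \<Rightarrow> 'k mpoly set set" where
  "quot_comp n I d = (\<lambda>p. I +>\<^bsub>poly_ring n\<^esub> p) ` homog n (int d)"

definition weak_lefschetz :: "nat \<Rightarrow> 'k::field mpoly set \<Rightarrow> bool" where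
  "weak_lefschetz n I \<longleftrightarrow>
     (\<exists>L \<in> homog n 1. \<forall>d.
        let mul = (\<lambda>a. (I +>\<^bsub>poly_ring n\<^esub> L) \<otimes>\<^bsub>poly_ring n Quot I\<^esub> a)
        in inj_on mul (quot_comp n I d) \<or> mul ` quot_comp n I d = quot_comp n I (Suc d))"

text \<open>Zariski open subsets of a set \<open>Y\<close> whose points have affine coordinates indexed by \<open>X\<close>.\<close>

definition zariski_open_in :: "'y set \<Rightarrow> 'x set \<Rightarrow> ('y \<Rightarrow> 'x \<Rightarrow> 'k::field) \<Rightarrow> 'y set \<Rightarrow> bool" where
  "zariski_open_in Y X coord U \<longleftrightarrow>
     (\<exists>S \<subseteq> polys X. U = {y \<in> Y. \<exists>p\<in>S. subst_poly id (coord y) p \<noteq> 0})"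

definition coeff_coord :: "'k::field mpoly \<Rightarrow> nat \<Rightarrow> 'k" where
  "coeff_coord L i = Poly_Mapping.lookup L (Poly_Mapping.single i 1)"

text \<open>The value attained on a nonempty Zariski open set of linear forms \<open>L\<close>.\<close>

definition reduction_number :: "nat \<Rightarrow> 'k::field mpoly set \<Rightarrow> nat" where
  "reduction_number n I = (THE r. \<exists>U. U \<noteq> {} \<and> zariski_open_in (homog n 1) {1..n} coeff_coord U \<and>
     (\<forall>L\<in>U. let J = I <+>\<^bsub>poly_ring n\<^esub> (PIdl\<^bsub>poly_ring n\<^esub> L)
             in (LEAST t. quot_comp n J (t + 1) = {\<zero>\<^bsub>poly_ring n Quot J\<^esub>}) = r))"


section \<open>Generic initial ideals\<close>

text \<open>The (degree) reverse lexicographic order with \<open>x\<^sub>1 > \<dots> > x\<^sub>n\<close>.\<close>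

definition revlex_less :: "(nat \<Rightarrow>\<^sub>0 nat) \<Rightarrow> (nat \<Rightarrow>\<^sub>0 nat) \<Rightarrow> bool" where
  "revlex_less s t \<longleftrightarrow> mdeg s < mdeg t \<or>
     (mdeg s = mdeg t \<and> (\<exists>i. Poly_Mapping.lookup t i < Poly_Mapping.lookup s i \<and>
        (\<forall>j>i. Poly_Mapping.lookup s j = Poly_Mapping.lookup t j)))"

definition is_leading :: "'k::field mpoly \<Rightarrow> (nat \<Rightarrow>\<^sub>0 nat) \<Rightarrow> bool" where
  "is_leading p m \<longleftrightarrow> m \<in> Poly_Mapping.keys p \<and>
     (\<forall>m'\<in>Poly_Mapping.keys p. m' \<noteq> m \<longrightarrow> revlex_less m' m)"

definition initial_ideal :: "nat \<Rightarrow> 'k::field mpoly set \<Rightarrow> 'k mpoly set" where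
  "initial_ideal n I = Idl\<^bsub>poly_ring n\<^esub> {xmonom m | m. \<exists>p\<in>I. is_leading p m}"

definition general_linear :: "nat \<Rightarrow> 'k::field mat set" where
  "general_linear n = {g \<in> carrier_mat n n. invertible_mat g}"

text \<open>\<open>g\<close> acts by \<open>x\<^sub>j \<mapsto> \<Sum>\<^sub>i g\<^sub>i\<^sub>j x\<^sub>i\<close>; the entries of a matrix are numbered from \<open>0\<close>.\<close>

definition gl_act :: "nat \<Rightarrow> 'k::field mat \<Rightarrow> 'k mpoly \<Rightarrow> 'k mpoly" where
  "gl_act n g = subst_poly const (\<lambda>j. \<Sum>i=1..n. const (g $$ (i - 1, j - 1)) * xvar i)"

definition gin :: "nat \<Rightarrow> 'k::field mpoly set \<Rightarrow> 'k mpoly set" where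
  "gin n I = (THE J. \<exists>U. U \<noteq> {} \<and>
     zariski_open_in (general_linear n) ({0..<n} \<times> {0..<n}) (\<lambda>g ij. g $$ ij) U \<and>
     (\<forall>g\<in>U. initial_ideal n (gl_act n g ` I) = J))"

definition min_gens :: "'k::field mpoly set \<Rightarrow> (nat \<Rightarrow>\<^sub>0 nat) set" where
  "min_gens J = {T. xmonom T \<in> J \<and>
     (\<forall>T'. xmonom T' \<in> J \<and> (xmonom T' :: 'k mpoly) dvd xmonom T \<longrightarrow> T' = T)}"

text \<open>Only meaningful for monomials other than \<open>1\<close>.\<close>

definition max_var :: "(nat \<Rightarrow>\<^sub>0 nat) \<Rightarrow> nat" where
  "max_var T = Max (Poly_Mapping.keys T)"

text \<open>The monomial \<open>x\<^sub>1\<^bsup>\<alpha>\<^sub>1\<^esup> \<cdots> x\<^sub>i\<^bsup>\<alpha>\<^sub>i\<^esup>\<close> of a tuple, represented as the list \<open>\<alpha> = [\<alpha>\<^sub>1, \<dots>, \<alpha>\<^sub>i]\<close>.\<close>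

definition tuple_monom :: "nat list \<Rightarrow> (nat \<Rightarrow>\<^sub>0 nat)" where
  "tuple_monom \<alpha> = (\<Sum>j<length \<alpha>. Poly_Mapping.single (Suc j) (\<alpha> ! j))"

text \<open>\<open>f\<^sub>i(\<alpha>\<^sub>1, \<dots>, \<alpha>\<^sub>i\<^sub>-\<^sub>1)\<close>; the index \<open>i\<close> is determined by the length \<open>i - 1\<close> of the tuple, and
  \<open>f\<^sub>1\<close> is the value at the empty tuple.\<close>

definition gin_f :: "nat \<Rightarrow> 'k::field mpoly set \<Rightarrow> nat list \<Rightarrow> nat" where
  "gin_f n I \<alpha> = (LEAST t. xmonom (tuple_monom (\<alpha> @ [t])) \<in> gin n I)"

definition gin_J :: "nat \<Rightarrow> 'k::field mpoly set \<Rightarrow> nat \<Rightarrow> nat list set" where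
  "gin_J n I i = {\<alpha>. length \<alpha> = i \<and> (\<forall>j<i. \<alpha> ! j < gin_f n I (take j \<alpha>))}"


section \<open>Graded Betti numbers\<close>

text \<open>\<open>apply_mat r s M v\<close> is the product of the \<open>r \<times> s\<close> matrix \<open>M\<close> and the column vector \<open>v\<close>;
  vectors are functions on \<open>nat\<close>, extended by \<open>0\<close>.\<close>

definition apply_mat ::
  "nat \<Rightarrow> nat \<Rightarrow> (nat \<Rightarrow> nat \<Rightarrow> 'b::comm_ring_1) \<Rightarrow> (nat \<Rightarrow> 'b) \<Rightarrow> nat \<Rightarrow> 'b" where
  "apply_mat r s M v = (\<lambda>a. if a < r then \<Sum>b<s. M a b * v b else 0)"

definition free_mod :: "nat \<Rightarrow> nat \<Rightarrow> (nat \<Rightarrow> 'k::field mpoly) set" where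
  "free_mod n r = {v. (\<forall>b<r. v b \<in> carrier (poly_ring n)) \<and> (\<forall>b\<ge>r. v b = 0)}"

text \<open>A graded free resolution
  \<open>\<cdots> \<rightarrow> F\<^sub>2 \<rightarrow> F\<^sub>1 \<rightarrow> F\<^sub>0 \<rightarrow> K \<rightarrow> 0\<close> of a homogeneous ideal \<open>K\<close> by free modules of finite rank:
  \<open>F\<^sub>q = \<Oplus>\<^sub>b R(-e\<^sub>b)\<close> where \<open>ds q\<close> is the list of the shifts \<open>e\<^sub>b\<close>, the augmentation sends the
  \<open>b\<close>-th basis element of \<open>F\<^sub>0\<close> to \<open>aug b\<close>, and \<open>D q\<close> is the matrix of \<open>F\<^sub>q\<^sub>+\<^sub>1 \<rightarrow> F\<^sub>q\<close>.  All maps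
  are homogeneous of degree \<open>0\<close>.\<close>

definition graded_free_resolution :: "nat \<Rightarrow> 'k::field mpoly set \<Rightarrow> (nat \<Rightarrow> int list) \<Rightarrow>
    (nat \<Rightarrow> 'k mpoly) \<Rightarrow> (nat \<Rightarrow> nat \<Rightarrow> nat \<Rightarrow> 'k mpoly) \<Rightarrow> bool" where
  "graded_free_resolution n K ds aug D \<longleftrightarrow>
     (let rk = (\<lambda>q. length (ds q));
          F = (\<lambda>q. free_mod n (rk q));
          \<epsilon> = (\<lambda>v. \<Sum>b<rk 0. aug b * v b);
          \<delta> = (\<lambda>q. apply_mat (rk q) (rk (Suc q)) (D q))
      in (\<forall>b<rk 0. aug b \<in> homog n (ds 0 ! b)) \<and>
         (\<forall>q. \<forall>a<rk q. \<forall>b<rk (Suc q). D q a b \<in> homog n (ds (Suc q) ! b - ds q ! a)) \<and>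
         \<epsilon> ` F 0 = K \<and>
         {v \<in> F 0. \<epsilon> v = 0} = \<delta> 0 ` F 1 \<and>
         (\<forall>q. {v \<in> F (Suc q). \<delta> q v = 0} = \<delta> (Suc q) ` F (Suc (Suc q))))"

text \<open>The complex \<open>F \<otimes>\<^sub>R k\<close>: \<open>F\<^sub>q \<otimes> k\<close> has a \<open>k\<close>-basis of elements of degrees \<open>ds q\<close>, and its
  differential is given by the constant terms of the entries of \<open>D\<close>.\<close>

definition tensor_comp :: "(nat \<Rightarrow> int list) \<Rightarrow> nat \<Rightarrow> int \<Rightarrow> (nat \<Rightarrow> 'k::field) set" where
  "tensor_comp ds q i = {v. \<forall>b. v b \<noteq> 0 \<longrightarrow> b < length (ds q) \<and> ds q ! b = i}"

definition tensor_diff ::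
  "(nat \<Rightarrow> int list) \<Rightarrow> (nat \<Rightarrow> nat \<Rightarrow> nat \<Rightarrow> 'k::field mpoly) \<Rightarrow> nat \<Rightarrow> (nat \<Rightarrow> 'k) \<Rightarrow> nat \<Rightarrow> 'k" where
  "tensor_diff ds D q =
     apply_mat (length (ds q)) (length (ds (Suc q))) (\<lambda>a b. Poly_Mapping.lookup (D q a b) 0)"

definition tensor_cycles ::
  "(nat \<Rightarrow> int list) \<Rightarrow> (nat \<Rightarrow> nat \<Rightarrow> nat \<Rightarrow> 'k::field mpoly) \<Rightarrow> nat \<Rightarrow> int \<Rightarrow> (nat \<Rightarrow> 'k) set" where
  "tensor_cycles ds D q i =
     {v \<in> tensor_comp ds q i. \<forall>p. q = Suc p \<longrightarrow> tensor_diff ds D p v = 0}"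

definition tensor_boundaries ::
  "(nat \<Rightarrow> int list) \<Rightarrow> (nat \<Rightarrow> nat \<Rightarrow> nat \<Rightarrow> 'k::field mpoly) \<Rightarrow> nat \<Rightarrow> int \<Rightarrow> (nat \<Rightarrow> 'k) set" where
  "tensor_boundaries ds D q i = tensor_diff ds D q ` tensor_comp ds (Suc q) i"

abbreviation kdim :: "(nat \<Rightarrow> 'k::field) set \<Rightarrow> nat" where
  "kdim \<equiv> vector_space.dim (\<lambda>c v b. c * v b)"

text \<open>\<open>\<beta>\<^sub>q\<^sub>,\<^sub>i(K)\<close> is the dimension of the component of degree \<open>i\<close> of \<open>Tor\<^sub>q(K, k)\<close>, the homology
  of \<open>F \<otimes> k\<close> for a graded free resolution \<open>F\<close> of \<open>K\<close>, which does not depend on \<open>F\<close>.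
  The boundaries are a subspace of the finite-dimensional space of cycles.\<close>

definition graded_betti :: "nat \<Rightarrow> 'k::field mpoly set \<Rightarrow> nat \<Rightarrow> int \<Rightarrow> nat" where
  "graded_betti n K q i = (SOME \<beta>. \<exists>ds aug D. graded_free_resolution n K ds aug D \<and>
     \<beta> = kdim (tensor_cycles ds D q i) - kdim (tensor_boundaries ds D q i))"

end

theory Submission
  imports Defs "HOL-Computational_Algebra.Polynomial" "Jordan_Normal_Form.Determinant"
begin

text \<open>For homogeneous \<open>I\<close> with \<open>R/I\<close> Artinian, everything is expressed by the finite sets of
  leading monomials of \<open>g I\<close> in each degree. For a set \<open>F\<close> of monomials of degree \<open>d\<close> that is
  closed upwards in the order, the number of leading monomials of \<open>(g I)\<^sub>d\<close> in \<open>F\<close> is the rank of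
  the projection of \<open>(g I)\<^sub>d\<close> to the coordinates in \<open>F\<close>. Ranks are bounded below by nonvanishing
  determinants, so the \<open>g\<close> at which all these numbers are maximal form a nonempty Zariski open set
  (\<open>general_coords_exist\<close>); finitely many conditions suffice because \<open>I\<close> contains all monomials of
  high degree. The numbers determine the leading monomials, which gives the generic initial ideal
  (\<open>gin_eq_initial\<close>). From then on one such \<open>g\<close> is fixed, \<open>K = g I\<close>, and \<open>M\<close> is the set of
  monomials of \<open>gin I\<close>; what the proof uses of \<open>g\<close> is maximality against every other coordinate
  system (\<open>dominates\<close>).

  The monomials that are not divisible by a given power of \<open>x\<^sub>n\<close> form an upward closed set in
  the reverse lexicographic order. Every nonzero linear form becomes \<open>x\<^sub>n\<close> in suitable coordinates,
  so maximality says that \<open>g\<^sup>-\<^sup>1 x\<^sub>n\<close> behaves at least as well as any linear form. Hence the first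
  reduction number is the largest degree \<open>s\<close> of a monomial in \<open>x\<^sub>1, \<dots>, x\<^sub>n\<^sub>-\<^sub>1\<close> outside \<open>M\<close>
  (\<open>reduction_number_eq\<close>). Multiplication by a linear form is surjective on \<open>(R/I)\<^sub>d\<close> at most for
  \<open>d \<ge> s\<close>, and \<open>g\<^sup>-\<^sup>1 x\<^sub>n\<close> achieves this; so the weak Lefschetz property amounts to injectivity in
  degrees below \<open>s\<close>, that is, to \<open>injective_below\<close>: if \<open>m\<close> is a monomial of degree less than \<open>s\<close>
  and \<open>x\<^sub>n m \<in> M\<close>, then \<open>m \<in> M\<close> (\<open>weak_lefschetz_iff_injective_below\<close>). Both forms of the condition
  on generators are this condition on \<open>M\<close>, read off from the shape of a monomial ideal
  (\<open>injective_below_iff_generators\<close>, \<open>injective_below_iff_gin_f\<close>).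

  For the Betti numbers of \<open>J = gin I\<close>, the homology of any graded free resolution tensored
  with \<open>k\<close> is computed by killing the variables one after the other. Each step is a snake argument
  for a nonzerodivisor on free modules, and in the top position it leads from \<open>Tor\<^sub>n(R/J, k)\<close> to
  the elements of \<open>R/J\<close> that all variables annihilate (\<open>cycles_boundaries_iff_socle\<close>). So the
  condition on Betti numbers says that \<open>R/gin I\<close> has no socle in degrees below \<open>s\<close>. A monomial
  outside \<open>M\<close> that \<open>x\<^sub>n\<close> multiplies into \<open>M\<close> is in the socle by strong stability of \<open>gin I\<close>
  (\<open>stable\<close>); this is where characteristic zero enters. Stability comes from maximality again:
  replacing \<open>x\<^sub>n\<close> by \<open>x\<^sub>n + t x\<^sub>i\<close> must not produce a new leading monomial, and to first order in \<open>t\<close>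
  it would. A graded free resolution exists by Dickson's lemma (\<open>graded_free_resolution_exists\<close>).\<close>

section \<open>Polynomials and their monomials\<close>

abbreviation "lookup \<equiv> Poly_Mapping.lookup"
abbreviation "keys \<equiv> Poly_Mapping.keys"
abbreviation "single \<equiv> Poly_Mapping.single"

lemma mdeg_sum: "finite A \<Longrightarrow> keys m \<subseteq> A \<Longrightarrow> mdeg m = (\<Sum>i\<in>A. lookup m i)"
  unfolding mdeg_def by (rule sum.mono_neutral_left) (auto simp: in_keys_iff)

lemma mdeg_zero [simp]: "mdeg 0 = 0"
  by (simp add: mdeg_def)

lemma keys_plus_nat: "keys (a + b) = keys a \<union> keys (b :: 'a \<Rightarrow>\<^sub>0 nat)"
  by (auto simp: in_keys_iff lookup_add)

lemma mdeg_add [simp]: "mdeg (a + b) = mdeg a + mdeg b"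
proof -
  have "mdeg (a + b) = (\<Sum>i\<in>keys a \<union> keys b. lookup (a + b) i)"
    by (rule mdeg_sum) (auto simp: keys_plus_nat)
  also have "\<dots> = mdeg a + mdeg b"
    by (simp add: lookup_add sum.distrib mdeg_sum[of "keys a \<union> keys b"])
  finally show ?thesis .
qed

lemma mdeg_single [simp]: "mdeg (single i k) = k"
  by (auto simp: mdeg_def)

lemma mdeg_eq_0_iff: "mdeg m = 0 \<longleftrightarrow> m = 0"
  by (auto simp: mdeg_def in_keys_iff intro!: poly_mapping_eqI)

definition mons :: "nat \<Rightarrow> nat \<Rightarrow> (nat \<Rightarrow>\<^sub>0 nat) set" where
  "mons n d = {m. keys m \<subseteq> {1..n} \<and> mdeg m = d}"

lemma lookup_le_mdeg: "lookup m i \<le> mdeg m"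
proof (cases "i \<in> keys m")
  case True
  then show ?thesis unfolding mdeg_def by (intro member_le_sum) auto
qed (simp add: in_keys_iff)

lemma finite_mons [simp]: "finite (mons n d)"
proof -
  let ?r = "\<lambda>m. restrict (lookup m) {1..n}"
  have "?r ` mons n d \<subseteq> PiE {1..n} (\<lambda>_. {..d})"
    by (auto simp: mons_def lookup_le_mdeg)
  then have "finite (?r ` mons n d)"
    using finite_subset finite_PiE by (metis finite_atLeastAtMost finite_atMost)
  moreover have "inj_on ?r (mons n d)"
  proof (intro inj_onI poly_mapping_eqI)
    fix a b i assume a: "a \<in> mons n d" and b: "b \<in> mons n d" and eq: "?r a = ?r b"
    show "lookup a i = lookup b i"
    proof (cases "i \<in> {1..n}")
      case True
      then show ?thesis using fun_cong[OF eq, of i] by simp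
    next
      case False
      then have "i \<notin> keys a" "i \<notin> keys b" using a b by (auto simp: mons_def)
      then show ?thesis by (simp add: in_keys_iff)
    qed
  qed
  ultimately show ?thesis by (rule finite_imageD)
qed

lemma finite_splits: "finite {ab. fst ab + snd ab = (m :: 'a \<Rightarrow>\<^sub>0 nat)}"
proof -
  define A where "A = {a :: 'a \<Rightarrow>\<^sub>0 nat. \<forall>i. lookup a i \<le> lookup m i}"
  let ?r = "\<lambda>a. restrict (lookup a) (keys m)"
  have "?r ` A \<subseteq> PiE (keys m) (\<lambda>i. {..lookup m i})"
    by (auto simp: A_def)
  then have "finite (?r ` A)"
    using finite_subset finite_PiE by (metis finite_atMost finite_keys)
  moreover have "inj_on ?r A"
  proof (intro inj_onI poly_mapping_eqI)
    fix a b i assume a: "a \<in> A" and b: "b \<in> A" and eq: "?r a = ?r b"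
    show "lookup a i = lookup b i"
    proof (cases "i \<in> keys m")
      case True
      then show ?thesis using fun_cong[OF eq, of i] by simp
    next
      case False
      then have "lookup m i = 0" by (simp add: in_keys_iff)
      then show ?thesis using a b unfolding A_def
        by (metis (mono_tags, lifting) le_zero_eq mem_Collect_eq)
    qed
  qed
  ultimately have fA: "finite A" by (rule finite_imageD)
  have "{ab. fst ab + snd ab = m} \<subseteq> A \<times> A"
    by (auto simp: A_def lookup_add)
  then show ?thesis using fA finite_subset by blast
qed

text \<open>A form of the product over the finite set of factorisations of \<open>m\<close>, which is the same for
  all factors \<open>p\<close> and \<open>q\<close>. Families of polynomials depending on a parameter need this.\<close>

lemma lookup_times:
  fixes p q :: "('a \<Rightarrow>\<^sub>0 nat) \<Rightarrow>\<^sub>0 'k::semiring_0"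
  shows "lookup (p * q) m = (\<Sum>ab | fst ab + snd ab = m. lookup p (fst ab) * lookup q (snd ab))"
proof -
  have fin: "finite {(a, b). lookup p a * lookup q b \<noteq> 0}"
    by (rule finite_subset[of _ "keys p \<times> keys q"]) (auto simp: in_keys_iff)
  have "lookup (p * q) m = (\<Sum>(a, b). lookup p a * lookup q b when m = a + b)"
    unfolding times_poly_mapping.rep_eq
    by (rule prod_fun_unfold_prod) (auto simp: finite_lookup)
  also have "\<dots> = (\<Sum>ab | fst ab + snd ab = m. case ab of (a, b) \<Rightarrow> (lookup p a * lookup q b when m = a + b))"
    by (rule Sum_any.expand_superset[OF finite_splits]) (auto simp: when_def split: if_splits)
  also have "\<dots> = (\<Sum>ab | fst ab + snd ab = m. lookup p (fst ab) * lookup q (snd ab))"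
    by (rule sum.cong) (auto simp: when_def)
  finally show ?thesis .
qed

lemma lookup_single_times:
  fixes p :: "('a \<Rightarrow>\<^sub>0 nat) \<Rightarrow>\<^sub>0 'k::semiring_0"
  shows "lookup (single u c * p) (u + m) = c * lookup p m"
proof -
  have "lookup (single u c * p) (u + m) =
      (\<Sum>ab\<in>{(u, m)}. lookup (single u c) (fst ab) * lookup p (snd ab))"
    unfolding lookup_times
    by (rule sum.mono_neutral_right[OF finite_splits]) (auto simp: lookup_single when_def)
  then show ?thesis by simp
qed

lemma lookup_single_times_other:
  fixes p :: "('a \<Rightarrow>\<^sub>0 nat) \<Rightarrow>\<^sub>0 'k::semiring_0"
  assumes "\<And>w. m \<noteq> u + w"
  shows "lookup (single u c * p) m = 0"
  unfolding lookup_times using assms by (intro sum.neutral) (auto simp: lookup_single when_def)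

lemma keys_xmonom_times: "keys (xmonom u * p) = (+) u ` keys p"
proof -
  have "m \<in> keys (xmonom u * p) \<longleftrightarrow> m \<in> (+) u ` keys p" for m
  proof (cases "\<exists>w. m = u + w")
    case True
    then obtain w where "m = u + w" by blast
    then show ?thesis by (auto simp: in_keys_iff xmonom_def lookup_single_times)
  next
    case False
    then show ?thesis by (auto simp: in_keys_iff xmonom_def lookup_single_times_other)
  qed
  then show ?thesis by blast
qed

lemma lookup_const_times: "lookup (const c * p) m = c * lookup p m"
  using lookup_single_times[of 0 c p m] by (simp add: const_def)

lemma xmonom_add: "xmonom (a + b) = xmonom a * xmonom b"
  by (simp add: xmonom_def mult_single)

lemma xmonom_0 [simp]: "xmonom 0 = 1"
  by (simp add: xmonom_def)

lemma keys_xmonom [simp]: "keys (xmonom m) = {m}"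
  by (simp add: xmonom_def)

lemma xmonom_nonzero [simp]: "xmonom m \<noteq> 0"
  using keys_xmonom[of m] by (metis empty_not_insert keys_zero)

lemma xmonom_inj [simp]: "(xmonom a :: 'k::field mpoly) = xmonom b \<longleftrightarrow> a = b"
  using keys_xmonom by (metis singleton_inject)

lemma keys_uminus [simp]: "keys (- p) = keys (p :: 'a \<Rightarrow>\<^sub>0 'b::ab_group_add)"
  by (auto simp: in_keys_iff)

lemma keys_minus_subset: "keys (p - q) \<subseteq> keys p \<union> keys (q :: 'a \<Rightarrow>\<^sub>0 'b::ab_group_add)"
  by (auto simp: in_keys_iff lookup_minus)

lemma keys_mult_nat: 
  fixes p q :: "('a \<Rightarrow>\<^sub>0 nat) \<Rightarrow>\<^sub>0 'k::semiring_0"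
  shows "m \<in> keys (p * q) \<Longrightarrow> \<exists>a\<in>keys p. \<exists>b\<in>keys q. m = a + b"
  using keys_mult[of p q] by blast

lemma keys_sum_subset: "keys (\<Sum>x\<in>A. f x) \<subseteq> (\<Union>x\<in>A. keys (f x :: 'a \<Rightarrow>\<^sub>0 'b::comm_monoid_add))"
proof
  fix m assume "m \<in> keys (\<Sum>x\<in>A. f x)"
  then have "(\<Sum>x\<in>A. lookup (f x) m) \<noteq> 0" by (simp add: in_keys_iff lookup_sum)
  then obtain x where "x \<in> A" "lookup (f x) m \<noteq> 0" by (meson sum.not_neutral_contains_not_neutral)
  then show "m \<in> (\<Union>x\<in>A. keys (f x))" by (auto simp: in_keys_iff)
qed

subsection \<open>Restriction to a set of monomials\<close>

definition pick :: "('a \<Rightarrow> bool) \<Rightarrow> ('a \<Rightarrow>\<^sub>0 'b::comm_monoid_add) \<Rightarrow> ('a \<Rightarrow>\<^sub>0 'b)" where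
  "pick P p = (\<Sum>m\<in>{m \<in> keys p. P m}. single m (lookup p m))"

lemma lookup_pick: "lookup (pick P p) m = (if P m then lookup p m else 0)"
proof -
  have "lookup (pick P p) m = (\<Sum>k\<in>{k \<in> keys p. P k}. lookup p k when k = m)"
    by (simp add: pick_def lookup_sum lookup_single)
  also have "\<dots> = (if m \<in> {k \<in> keys p. P k} then lookup p m else 0)"
    by (simp add: when_def sum.delta)
  finally show ?thesis by (auto simp: in_keys_iff)
qed

lemma keys_pick: "keys (pick P p) = {m \<in> keys p. P m}"
  by (auto simp: in_keys_iff lookup_pick split: if_splits)

lemma pick_eq_self: "(\<And>m. m \<in> keys p \<Longrightarrow> P m) \<Longrightarrow> pick P p = p"
  by (rule poly_mapping_eqI) (auto simp: lookup_pick in_keys_iff)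

lemma pick_add: "pick P (p + q) = pick P p + pick P q"
  by (rule poly_mapping_eqI) (simp add: lookup_pick lookup_add)

lemma pick_minus: "pick P (p - q) = pick P p - pick P (q :: 'a \<Rightarrow>\<^sub>0 'b::ab_group_add)"
  by (rule poly_mapping_eqI) (simp add: lookup_pick lookup_minus)

lemma pick_sum: "pick P (\<Sum>x\<in>A. f x) = (\<Sum>x\<in>A. pick P (f x))"
  by (rule poly_mapping_eqI) (simp add: lookup_pick lookup_sum)

lemma poly_monomial_sum: "p = (\<Sum>m\<in>keys p. single m (lookup p m))"
  using pick_eq_self[of p "\<lambda>_. True"] by (simp add: pick_def)

lemma poly_xmonom_sum: "p = (\<Sum>m\<in>keys p. const (lookup p m) * xmonom m)"
  by (subst poly_monomial_sum) (simp add: const_def xmonom_def mult_single)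

subsection \<open>The ring and its graded components\<close>

lemma carrier_poly_ring [simp]: "carrier (poly_ring n) = polys {1..n}"
  and mult_poly_ring [simp]: "mult (poly_ring n) = (*)"
  and one_poly_ring [simp]: "one (poly_ring n) = 1"
  and zero_poly_ring [simp]: "zero (poly_ring n) = 0"
  and add_poly_ring [simp]: "add (poly_ring n) = (+)"
  by (simp_all add: poly_ring_def)

lemma polys_zero [simp, intro]: "0 \<in> polys X"
  by (simp add: polys_def)

lemma polys_one [simp, intro]: "(1 :: ('x \<Rightarrow>\<^sub>0 nat) \<Rightarrow>\<^sub>0 'k::zero_neq_one) \<in> polys X"
  by (simp add: polys_def)

lemma polys_single: "keys m \<subseteq> X \<Longrightarrow> single m c \<in> polys X"
  by (auto simp: polys_def)

lemma polys_const [simp, intro]: "const c \<in> polys X"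
  by (auto simp: const_def intro: polys_single)

lemma polys_xmonom: "xmonom m \<in> polys X \<longleftrightarrow> keys m \<subseteq> X"
  by (auto simp: polys_def)

lemma polys_xvar: "xvar i \<in> polys X \<longleftrightarrow> i \<in> X"
  by (auto simp: xvar_def polys_xmonom)

lemma polys_add [intro]: "p \<in> polys X \<Longrightarrow> q \<in> polys X \<Longrightarrow> p + q \<in> polys X"
  using keys_add[of p q] by (fastforce simp: polys_def)

lemma polys_uminus [intro]: 
  "p \<in> polys X \<Longrightarrow> - (p :: ('x \<Rightarrow>\<^sub>0 nat) \<Rightarrow>\<^sub>0 'k::ab_group_add) \<in> polys X"
  by (simp add: polys_def)

lemma polys_minus [intro]:
  "p \<in> polys X \<Longrightarrow> q \<in> polys X \<Longrightarrow> p - (q :: ('x \<Rightarrow>\<^sub>0 nat) \<Rightarrow>\<^sub>0 'k::ab_group_add) \<in> polys X"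
  using keys_minus_subset[of p q] by (fastforce simp: polys_def)

lemma polys_mult [intro]:
  "p \<in> polys X \<Longrightarrow> q \<in> polys X \<Longrightarrow> p * (q :: ('x \<Rightarrow>\<^sub>0 nat) \<Rightarrow>\<^sub>0 'k::semiring_0) \<in> polys X"
  unfolding polys_def by (fastforce dest!: keys_mult_nat simp: keys_plus_nat)

lemma polys_sum [intro]:
  "(\<And>i. i \<in> A \<Longrightarrow> f i \<in> polys X) \<Longrightarrow> (\<Sum>i\<in>A. f i) \<in> polys X"
  by (induction A rule: infinite_finite_induct) auto

lemma polys_pick [intro]: "p \<in> polys X \<Longrightarrow> pick P p \<in> polys X"
  by (auto simp: polys_def keys_pick)

definition hpart :: "nat \<Rightarrow> 'k::field mpoly \<Rightarrow> 'k mpoly" where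
  "hpart d = pick (\<lambda>m. mdeg m = d)"

lemma homog_iff: "p \<in> homog n (int d) \<longleftrightarrow> keys p \<subseteq> mons n d"
  by (auto simp: homog_def polys_def mons_def)

lemma homog_polys: "p \<in> homog n e \<Longrightarrow> p \<in> polys {1..n}"
  by (simp add: homog_def)

lemma homog_zero [simp, intro]: "0 \<in> homog n e"
  by (simp add: homog_def)

lemma homog_add [intro]: "p \<in> homog n e \<Longrightarrow> q \<in> homog n e \<Longrightarrow> p + q \<in> homog n e"
  using keys_add[of p q] by (auto simp: homog_def)

lemma homog_minus [intro]: "p \<in> homog n e \<Longrightarrow> q \<in> homog n e \<Longrightarrow> p - q \<in> homog n e"
  using keys_minus_subset[of p q] by (auto simp: homog_def)

lemma homog_sum [intro]: "(\<And>i. i \<in> A \<Longrightarrow> f i \<in> homog n e) \<Longrightarrow> (\<Sum>i\<in>A. f i) \<in> homog n e"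
  by (induction A rule: infinite_finite_induct) auto

lemma homog_mult: "p \<in> homog n e \<Longrightarrow> q \<in> homog n e' \<Longrightarrow> p * q \<in> homog n (e + e')"
  by (auto simp: homog_def dest!: keys_mult_nat)

lemma homog_const [intro]: "const c \<in> homog n 0"
  by (auto simp: homog_def const_def intro: polys_single)

lemma homog_const_mult [intro]: "p \<in> homog n e \<Longrightarrow> const c * p \<in> homog n e"
  using homog_mult[OF homog_const] by fastforce

lemma homog_xmonom: "xmonom m \<in> homog n e \<longleftrightarrow> keys m \<subseteq> {1..n} \<and> int (mdeg m) = e"
  by (auto simp: homog_def polys_xmonom)

lemma homog_xvar: "i \<in> {1..n} \<Longrightarrow> xvar i \<in> homog n 1"
  by (auto simp: xvar_def homog_xmonom)

lemma hpart_homog [intro]: "p \<in> polys {1..n} \<Longrightarrow> hpart d p \<in> homog n (int d)"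
  by (auto simp: homog_def hpart_def keys_pick)

lemma hpart_add: "hpart d (p + q) = hpart d p + hpart d q"
  and hpart_minus: "hpart d (p - q) = hpart d p - hpart d q"
  and hpart_sum: "hpart d (\<Sum>x\<in>A. f x) = (\<Sum>x\<in>A. hpart d (f x))"
  by (simp_all add: hpart_def pick_add pick_minus pick_sum)

lemma hpart_self: "p \<in> homog n (int d) \<Longrightarrow> hpart d p = p"
  by (auto simp: hpart_def homog_def intro: pick_eq_self)

lemma hpart_other: "p \<in> homog n e \<Longrightarrow> e \<noteq> int d \<Longrightarrow> hpart d p = 0"
  by (rule poly_mapping_eqI) (auto simp: hpart_def homog_def lookup_pick in_keys_iff)

lemma hpart_zero [simp]: "hpart d 0 = 0"
  by (rule poly_mapping_eqI) (auto simp: hpart_def lookup_pick)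

lemma sum_hparts:
  assumes "mdeg ` keys p \<subseteq> D" "finite D"
  shows "p = (\<Sum>d\<in>D. hpart d p)"
proof (rule poly_mapping_eqI)
  fix m
  have "(\<Sum>d\<in>D. lookup (hpart d p) m) = (if mdeg m \<in> D then lookup p m else 0)"
    using assms(2) by (simp add: hpart_def lookup_pick)
  also have "\<dots> = lookup p m" using assms(1) by (auto simp: not_in_keys_iff_lookup_eq_zero[symmetric])
  finally show "lookup p m = lookup (\<Sum>d\<in>D. hpart d p) m" by (simp add: lookup_sum)
qed

lemma hpart_homog_mult:
  assumes q: "q \<in> homog n (int d)"
  shows "hpart (d + e) (q * p) = q * hpart e p" and "c < d \<Longrightarrow> hpart c (q * p) = 0"
proof -
  define D where "D = mdeg ` keys p"
  have p: "p = (\<Sum>j\<in>D. hpart j p)" by (rule sum_hparts) (auto simp: D_def)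
  have *: "mdeg m = d + j" if "m \<in> keys (q * hpart j p)" for m j
    using keys_mult_nat[OF that] q by (force simp: hpart_def keys_pick homog_def)
  have **: "hpart c (q * hpart j p) = (if c = d + j then q * hpart j p else 0)" for c j
    by (rule poly_mapping_eqI) (use * in \<open>auto simp: hpart_def lookup_pick in_keys_iff\<close>)
  have "hpart c (q * p) = (\<Sum>j\<in>D. hpart c (q * hpart j p))" for c
    by (subst p) (simp add: sum_distrib_left hpart_sum)
  then have eq: "hpart c (q * p) = (\<Sum>j\<in>D. if c = d + j then q * hpart j p else 0)" for c
    by (simp add: **)
  have "hpart e p = 0" if "e \<notin> D"
    by (rule poly_mapping_eqI) (use that in \<open>force simp: hpart_def lookup_pick D_def in_keys_iff\<close>)
  then show "hpart (d + e) (q * p) = q * hpart e p"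
    by (auto simp: eq D_def)
  show "hpart c (q * p) = 0" if "c < d" using that by (simp add: eq)
qed

section \<open>Substitution homomorphisms and the action of the general linear group\<close>

definition mval :: "('x \<Rightarrow> 'b::comm_ring_1) \<Rightarrow> ('x \<Rightarrow>\<^sub>0 nat) \<Rightarrow> 'b" where
  "mval \<theta> m = (\<Prod>v\<in>keys m. \<theta> v ^ lookup m v)"

lemma mval_superset: "finite A \<Longrightarrow> keys m \<subseteq> A \<Longrightarrow> mval \<theta> m = (\<Prod>v\<in>A. \<theta> v ^ lookup m v)"
  unfolding mval_def by (rule prod.mono_neutral_left) (auto simp: in_keys_iff)

lemma mval_0 [simp]: "mval \<theta> 0 = 1"
  by (simp add: mval_def)

lemma mval_add: "mval \<theta> (a + b) = mval \<theta> a * mval \<theta> b"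
proof -
  have "mval \<theta> (a + b) = (\<Prod>v\<in>keys a \<union> keys b. \<theta> v ^ lookup (a + b) v)"
    by (rule mval_superset) (auto simp: keys_plus_nat)
  also have "\<dots> = mval \<theta> a * mval \<theta> b"
    by (simp add: lookup_add power_add prod.distrib mval_superset[of "keys a \<union> keys b"])
  finally show ?thesis .
qed

lemma mval_single: "mval \<theta> (single i k) = \<theta> i ^ k"
  by (auto simp: mval_def)

context comm_ring_hom
begin

lemma subst_superset:
  assumes "finite A" "keys p \<subseteq> A"
  shows "subst_poly hom \<theta> p = (\<Sum>m\<in>A. hom (lookup p m) * mval \<theta> m)"
  unfolding subst_poly_def mval_def[symmetric] using assms
  by (intro sum.mono_neutral_left) (auto simp: in_keys_iff)

lemma subst_zero [simp]: "subst_poly hom \<theta> 0 = 0"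
  by (simp add: subst_poly_def)

lemma subst_single: "subst_poly hom \<theta> (single m c) = hom c * mval \<theta> m"
  by (subst subst_superset[of "{m}"]) auto

lemma subst_add: "subst_poly hom \<theta> (p + q) = subst_poly hom \<theta> p + subst_poly hom \<theta> q"
proof -
  let ?A = "keys p \<union> keys q"
  have "subst_poly hom \<theta> (p + q) = (\<Sum>m\<in>?A. hom (lookup (p + q) m) * mval \<theta> m)"
    by (rule subst_superset) (use keys_add[of p q] in auto)
  also have "\<dots> = subst_poly hom \<theta> p + subst_poly hom \<theta> q"
    by (simp add: subst_superset[of ?A] lookup_add hom_add distrib_right sum.distrib)
  finally show ?thesis .
qed

lemma subst_sum: "subst_poly hom \<theta> (\<Sum>x\<in>A. f x) = (\<Sum>x\<in>A. subst_poly hom \<theta> (f x))"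
  by (induction A rule: infinite_finite_induct) (auto simp: subst_add)

lemma subst_mult: "subst_poly hom \<theta> (p * q) = subst_poly hom \<theta> p * subst_poly hom \<theta> q"
proof -
  let ?s = "\<lambda>p m. single m (lookup p m)"
  have "p * q = (\<Sum>a\<in>keys p. ?s p a) * (\<Sum>b\<in>keys q. ?s q b)"
    by (simp add: poly_monomial_sum[symmetric])
  also have "\<dots> = (\<Sum>a\<in>keys p. \<Sum>b\<in>keys q. single (a + b) (lookup p a * lookup q b))"
    by (simp add: sum_product mult_single)
  finally have "subst_poly hom \<theta> (p * q) =
      (\<Sum>a\<in>keys p. \<Sum>b\<in>keys q. hom (lookup p a) * mval \<theta> a * (hom (lookup q b) * mval \<theta> b))"
    by (simp add: subst_sum subst_single hom_mult mval_add algebra_simps)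
  also have "\<dots> = subst_poly hom \<theta> p * subst_poly hom \<theta> q"
    by (simp add: sum_product subst_poly_def mval_def)
  finally show ?thesis .
qed

lemma subst_uminus: "subst_poly hom \<theta> (- p) = - subst_poly hom \<theta> p"
  using subst_add[of \<theta> p "- p"] by (simp add: eq_neg_iff_add_eq_0 add.commute)

lemma subst_minus: "subst_poly hom \<theta> (p - q) = subst_poly hom \<theta> p - subst_poly hom \<theta> q"
  using subst_add[of \<theta> p "- q"] by (simp add: subst_uminus)

end

interpretation id_hom: comm_ring_hom "id :: 'k \<Rightarrow> 'k::comm_ring_1"
  by unfold_locales auto

lemma const_add: "const (a + b) = const a + const b"
  and const_mult: "const (a * b) = const a * const b"
  and const_0 [simp]: "const 0 = 0"
  and const_1 [simp]: "const 1 = 1"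
  and const_uminus: "const (- c) = - const (c :: 'c::field)"
  by (auto simp: const_def single_add mult_single single_uminus)

interpretation const_hom: comm_ring_hom "const :: 'k::field \<Rightarrow> 'k mpoly"
  by unfold_locales (auto simp: const_add const_mult)

lemma xvar_power: "xvar i ^ k = xmonom (single i k)"
  by (induction k) (auto simp: xvar_def xmonom_add[symmetric] single_add[symmetric])

lemma xmonom_mval: "xmonom m = mval xvar m"
proof -
  have m: "m = (\<Sum>v\<in>keys m. single v (lookup m v))"
    by (rule poly_monomial_sum)
  have *: "xmonom (\<Sum>v\<in>A. single v (lookup m v)) = (\<Prod>v\<in>A. (xvar v :: 'k::field mpoly) ^ lookup m v)" for A
    by (induction A rule: infinite_finite_induct) (auto simp: xmonom_add xvar_power)
  show ?thesis unfolding mval_def using *[of "keys m"] m by simp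
qed

text \<open>Two algebra endomorphisms are compared on the variables only; this gives the composition law
  of the action of matrices.\<close>

lemma algebra_hom_eq_subst:
  fixes \<phi> :: "'k::field mpoly \<Rightarrow> 'k mpoly"
  assumes add: "\<And>p q. \<phi> (p + q) = \<phi> p + \<phi> q" and mult: "\<And>p q. \<phi> (p * q) = \<phi> p * \<phi> q"
    and const: "\<And>c. \<phi> (const c) = const c"
    and var: "\<And>i. i \<in> X \<Longrightarrow> \<phi> (xvar i) = \<theta> i" and p: "p \<in> polys X"
  shows "\<phi> p = subst_poly const \<theta> p"
proof -
  have 0: "\<phi> 0 = 0" and 1: "\<phi> 1 = 1" using const[of 0] const[of 1] by auto
  have sum: "\<phi> (\<Sum>x\<in>A. f x) = (\<Sum>x\<in>A. \<phi> (f x))" for A and f :: "(nat \<Rightarrow>\<^sub>0 nat) \<Rightarrow> 'k mpoly"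
    by (induction A rule: infinite_finite_induct) (auto simp: add 0)
  have prod: "\<phi> (\<Prod>x\<in>A. f x) = (\<Prod>x\<in>A. \<phi> (f x))" for A and f :: "nat \<Rightarrow> 'k mpoly"
    by (induction A rule: infinite_finite_induct) (auto simp: mult 1)
  have pow: "\<phi> (q ^ k) = \<phi> q ^ k" for q k
    by (induction k) (auto simp: mult 1)
  have m: "\<phi> (xmonom m) = mval \<theta> m" if "keys m \<subseteq> X" for m
    using that by (auto simp: xmonom_mval mval_def prod pow var intro!: prod.cong)
  have "\<phi> p = \<phi> (\<Sum>m\<in>keys p. const (lookup p m) * xmonom m)"
    by (simp add: poly_xmonom_sum[symmetric])
  also have "\<dots> = (\<Sum>m\<in>keys p. const (lookup p m) * \<phi> (xmonom m))"
    by (simp add: sum mult const)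
  also have "\<dots> = (\<Sum>m\<in>keys p. const (lookup p m) * mval \<theta> m)"
    using p m by (intro sum.cong) (auto simp: polys_def)
  finally show ?thesis by (simp add: subst_poly_def mval_def)
qed

lemma subst_const: "subst_poly const \<theta> (const c) = (const c :: 'k::field mpoly)"
  using const_hom.subst_single[of \<theta> 0 c] by (simp add: const_def)

lemma subst_xmonom: "subst_poly const \<theta> (xmonom m) = mval \<theta> m"
  using const_hom.subst_single[of \<theta> m 1] by (simp add: xmonom_def)

lemma subst_xvar: "subst_poly const \<theta> (xvar i) = \<theta> i"
  by (simp add: xvar_def subst_xmonom mval_single)

lemma homog_power: "p \<in> homog n e \<Longrightarrow> p ^ k \<in> homog n (int k * e)"
proof (induction k)
  case 0
  then show ?case using homog_const[of 1] by simp
next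
  case (Suc k)
  then show ?case using homog_mult[of p n e "p ^ k" "int k * e"] by (simp add: algebra_simps)
qed

lemma homog_prod:
  assumes "finite A" "\<And>i. i \<in> A \<Longrightarrow> f i \<in> homog n (e i)"
  shows "(\<Prod>i\<in>A. f i) \<in> homog n (\<Sum>i\<in>A. e i)"
  using assms
proof (induction A)
  case empty
  then show ?case using homog_const[of 1] by simp
qed (auto intro: homog_mult)

lemma subst_homog:
  assumes \<theta>: "\<And>i. i \<in> {1..n} \<Longrightarrow> \<theta> i \<in> homog n 1" and p: "p \<in> homog n e"
  shows "subst_poly const \<theta> p \<in> homog n e"
  unfolding subst_poly_def mval_def[symmetric]
proof (intro homog_sum homog_const_mult)
  fix m assume m: "m \<in> keys p"
  have "mval \<theta> m \<in> homog n (\<Sum>v\<in>keys m. int (lookup m v) * 1)"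
    unfolding mval_def using p m
    by (intro homog_prod homog_power \<theta>) (auto simp: homog_def polys_def subset_iff)
  moreover have "(\<Sum>v\<in>keys m. int (lookup m v) * 1) = e"
    using p m by (auto simp: homog_def mdeg_def)
  ultimately show "mval \<theta> m \<in> homog n e" by simp
qed

lemma gl_act_add: "gl_act n g (p + q) = gl_act n g p + gl_act n g q"
  and gl_act_minus: "gl_act n g (p - q) = gl_act n g p - gl_act n g q"
  and gl_act_mult: "gl_act n g (p * q) = gl_act n g p * gl_act n g q"
  and gl_act_sum: "gl_act n g (\<Sum>x\<in>A. f x) = (\<Sum>x\<in>A. gl_act n g (f x))"
  and gl_act_const: "gl_act n g (const c) = const c"
  and gl_act_0 [simp]: "gl_act n g 0 = 0"
  by (simp_all add: gl_act_def const_hom.subst_add const_hom.subst_minus const_hom.subst_mult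
      const_hom.subst_sum subst_const)

lemma gl_act_xvar: "gl_act n g (xvar j) = (\<Sum>i=1..n. const (g $$ (i - 1, j - 1)) * xvar i)"
  by (simp add: gl_act_def subst_xvar)

lemma gl_act_homog: "p \<in> homog n e \<Longrightarrow> gl_act n g p \<in> homog n e"
  unfolding gl_act_def by (rule subst_homog) (intro homog_sum homog_const_mult homog_xvar)

lemma polys_hparts: "p \<in> polys {1..n} \<Longrightarrow> \<exists>D. finite D \<and> p = (\<Sum>d\<in>D. hpart d p)"
  by (rule exI[of _ "mdeg ` keys p"]) (use sum_hparts[of p "mdeg ` keys p"] in simp)

lemma gl_act_polys: assumes "p \<in> polys {1..n}" shows "gl_act n g p \<in> polys {1..n}"
proof -
  obtain D where "p = (\<Sum>d\<in>D. hpart d p)" using polys_hparts[OF assms] by (elim exE conjE)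
  then have "gl_act n g p = (\<Sum>d\<in>D. gl_act n g (hpart d p))"
    using gl_act_sum[of n g "\<lambda>d. hpart d p" D] by simp
  moreover have "gl_act n g (hpart d p) \<in> polys {1..n}" for d
    by (rule homog_polys[OF gl_act_homog[OF hpart_homog[OF assms]]])
  ultimately show ?thesis by (simp add: polys_sum)
qed

lemma gl_act_hpart: assumes "p \<in> polys {1..n}" shows "gl_act n g (hpart d p) = hpart d (gl_act n g p)"
proof -
  obtain D where D: "finite D" "p = (\<Sum>d\<in>D. hpart d p)" using polys_hparts[OF assms] by (elim exE conjE)
  have *: "hpart d (gl_act n g (hpart e p)) = (if d = e then gl_act n g (hpart e p) else 0)" for e
    using gl_act_homog[OF hpart_homog[OF assms, of e], of g]
    by (auto intro: hpart_self hpart_other)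
  have "gl_act n g p = (\<Sum>d\<in>D. gl_act n g (hpart d p))"
    using D(2) gl_act_sum[of n g "\<lambda>d. hpart d p" D] by simp
  then have 1: "hpart d (gl_act n g p) = (if d \<in> D then gl_act n g (hpart d p) else 0)"
    using D(1) by (simp add: hpart_sum *)
  have "hpart d p = (\<Sum>e\<in>D. hpart d (hpart e p))"
    using arg_cong[OF D(2), of "hpart d"] by (simp add: hpart_sum)
  moreover have "hpart d (hpart e p) = (if d = e then hpart e p else 0)" for e
    by (rule poly_mapping_eqI) (auto simp: hpart_def lookup_pick)
  ultimately have "d \<notin> D \<Longrightarrow> hpart d p = 0" using D(1) by simp
  then show ?thesis using 1 by (cases "d \<in> D") auto
qed

lemma sum_index_shift: "(\<Sum>i=1..n. f (i - 1)) = (\<Sum>i<n. f (i::nat))"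
  by (rule sum.reindex_bij_witness[of _ Suc "\<lambda>i. i - 1"]) auto

lemma gl_act_times:
  assumes g: "g \<in> carrier_mat n n" and h: "h \<in> carrier_mat n n" and p: "p \<in> polys {1..n}"
  shows "gl_act n g (gl_act n h p) = gl_act n (g * h) p"
proof -
  have "gl_act n g (gl_act n h p) = subst_poly const (\<lambda>j. gl_act n g (gl_act n h (xvar j))) p"
    by (rule algebra_hom_eq_subst[OF _ _ _ _ p])
      (simp_all add: gl_act_add gl_act_mult gl_act_const)
  moreover have "gl_act n (g * h) p = subst_poly const (\<lambda>j. gl_act n g (gl_act n h (xvar j))) p"
  proof (rule algebra_hom_eq_subst[OF _ _ _ _ p])
    fix j assume j: "j \<in> {1..n}"
    have "gl_act n g (gl_act n h (xvar j)) =
        (\<Sum>l=1..n. \<Sum>i=1..n. const (g $$ (i - 1, l - 1) * h $$ (l - 1, j - 1)) * xvar i)"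
      by (simp add: gl_act_xvar gl_act_sum gl_act_mult gl_act_const sum_distrib_left const_mult algebra_simps)
    also have "\<dots> = (\<Sum>i=1..n. const (\<Sum>l=1..n. g $$ (i - 1, l - 1) * h $$ (l - 1, j - 1)) * xvar i)"
      by (subst sum.swap) (simp add: const_hom.hom_sum sum_distrib_right)
    also have "\<dots> = (\<Sum>i=1..n. const ((g * h) $$ (i - 1, j - 1)) * xvar i)"
    proof (rule sum.cong[OF refl])
      fix i assume i: "i \<in> {1..n}"
      have "(g * h) $$ (i - 1, j - 1) = (\<Sum>l<n. g $$ (i - 1, l) * h $$ (l, j - 1))"
        using i j g h by (auto simp: times_mat_def scalar_prod_def atLeast0LessThan intro!: sum.cong)
      then show "const (\<Sum>l=1..n. g $$ (i - 1, l - 1) * h $$ (l - 1, j - 1)) * xvar i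
          = const ((g * h) $$ (i - 1, j - 1)) * xvar i"
        using sum_index_shift[of "\<lambda>l. g $$ (i - 1, l) * h $$ (l, j - 1)" n] by simp
    qed
    finally show "gl_act n (g * h) (xvar j) = gl_act n g (gl_act n h (xvar j))"
      by (simp add: gl_act_xvar)
  qed (simp_all add: gl_act_add gl_act_mult gl_act_const)
  ultimately show ?thesis by simp
qed

lemma gl_act_one: assumes "p \<in> polys {1..n}" shows "gl_act n (1\<^sub>m n) p = p"
proof -
  have "gl_act n (1\<^sub>m n) p = subst_poly const xvar p"
  proof (rule algebra_hom_eq_subst[OF _ _ _ _ assms])
    fix j assume "j \<in> {1..n}"
    then have "(\<Sum>i=1..n. const ((1\<^sub>m n :: 'a mat) $$ (i - 1, j - 1)) * xvar i) = (\<Sum>i=1..n. if i = j then xvar i else 0)"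
      by (intro sum.cong) auto
    then show "gl_act n (1\<^sub>m n :: 'a mat) (xvar j) = xvar j" using \<open>j \<in> {1..n}\<close> by (simp add: gl_act_xvar)
  qed (simp_all add: gl_act_add gl_act_mult gl_act_const)
  also have "\<dots> = p"
    by (rule algebra_hom_eq_subst[OF _ _ _ _ assms, of "\<lambda>x. x", symmetric]) auto
  finally show ?thesis .
qed

lemma general_linear_iff: "g \<in> general_linear n \<longleftrightarrow> g \<in> carrier_mat n n \<and> det g \<noteq> 0"
proof
  assume "g \<in> general_linear n"
  then obtain h where g: "g \<in> carrier_mat n n" and h: "g * h = 1\<^sub>m n" "h * g = 1\<^sub>m (dim_row h)"
    by (auto simp: general_linear_def invertible_mat_def inverts_mat_def)
  have "h \<in> carrier_mat n n"
    using arg_cong[OF h(1), of dim_col] arg_cong[OF h(2), of dim_col] g by auto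
  then have "det g * det h = 1" using det_mult[OF g, of h] h(1) by simp
  then show "g \<in> carrier_mat n n \<and> det g \<noteq> 0" using g by auto
next
  assume g: "g \<in> carrier_mat n n \<and> det g \<noteq> 0"
  then have "g \<in> Units (ring_mat TYPE('a) n undefined)" by (intro det_non_zero_imp_unit) auto
  then obtain h where "h \<in> carrier_mat n n" "h * g = 1\<^sub>m n" "g * h = 1\<^sub>m n"
    by (auto simp: Units_def ring_mat_def)
  then show "g \<in> general_linear n" using g
    by (auto simp: general_linear_def invertible_mat_def inverts_mat_def)
qed

lemma general_linear_inverse:
  assumes "g \<in> general_linear n"
  obtains h where "h \<in> general_linear n" "h * g = 1\<^sub>m n" "g * h = 1\<^sub>m n"
proof -
  have g: "g \<in> carrier_mat n n" "det g \<noteq> 0" using assms by (auto simp: general_linear_iff)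
  then have "g \<in> Units (ring_mat TYPE('a) n undefined)" by (intro det_non_zero_imp_unit) auto
  then obtain h where h: "h \<in> carrier_mat n n" "h * g = 1\<^sub>m n" "g * h = 1\<^sub>m n"
    by (auto simp: Units_def ring_mat_def)
  then have "det g * det h = 1" using det_mult[OF g(1) h(1)] by simp
  then have "det h \<noteq> 0" by auto
  then show thesis using h that by (simp add: general_linear_iff)
qed

lemma general_linear_times: "g \<in> general_linear n \<Longrightarrow> h \<in> general_linear n \<Longrightarrow> g * h \<in> general_linear n"
  by (auto simp: general_linear_iff det_mult)

lemma general_linear_one [simp]: "1\<^sub>m n \<in> general_linear n"
  by (simp add: general_linear_iff)

lemma gl_act_inverse:
  assumes "g \<in> general_linear n" "h \<in> general_linear n" "h * g = 1\<^sub>m n" "p \<in> polys {1..n}"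
  shows "gl_act n h (gl_act n g p) = p"
  using assms by (simp add: gl_act_times general_linear_iff gl_act_one)

section \<open>Polynomial families and Zariski open sets\<close>

locale function_algebra =
  fixes A :: "('y \<Rightarrow> 'k::field) set"
  assumes const_mem: "(\<lambda>_. c) \<in> A"
    and add_mem: "f \<in> A \<Longrightarrow> g \<in> A \<Longrightarrow> (\<lambda>y. f y + g y) \<in> A"
    and mult_mem: "f \<in> A \<Longrightarrow> g \<in> A \<Longrightarrow> (\<lambda>y. f y * g y) \<in> A"
begin

lemma sum_mem: "(\<And>i. i \<in> I \<Longrightarrow> f i \<in> A) \<Longrightarrow> (\<lambda>y. \<Sum>i\<in>I. f i y) \<in> A"
  by (induction I rule: infinite_finite_induct) (auto intro: const_mem add_mem)

lemma prod_mem: "(\<And>i. i \<in> I \<Longrightarrow> f i \<in> A) \<Longrightarrow> (\<lambda>y. \<Prod>i\<in>I. f i y) \<in> A"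
  by (induction I rule: infinite_finite_induct) (auto intro: const_mem mult_mem)

lemma power_mem: "f \<in> A \<Longrightarrow> (\<lambda>y. f y ^ k) \<in> A"
  by (induction k) (auto intro: const_mem mult_mem)

text \<open>The Leibniz formula writes the determinant as a polynomial in the entries.\<close>

lemma det_mem:
  assumes "\<And>i j. i < r \<Longrightarrow> j < r \<Longrightarrow> (\<lambda>y. M y i j) \<in> A"
  shows "(\<lambda>y. det (mat r r (\<lambda>(i, j). M y i j))) \<in> A"
proof -
  have perm: "p i < r" if "p permutes {0..<r}" "i < r" for p i
    using permutes_in_image[OF that(1), of i] that(2) by simp
  have *: "det (mat r r (\<lambda>(i, j). M y i j)) =
      (\<Sum>p\<in>{p. p permutes {0..<r}}. signof p * (\<Prod>i\<in>{0..<r}. M y i (p i)))" for y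
    unfolding det_def by (auto intro!: sum.cong arg_cong2[of _ _ _ _ "(*)"] prod.cong simp: perm)
  show ?thesis unfolding *
    by (intro sum_mem mult_mem const_mem prod_mem assms) (auto simp: perm)
qed

definition family :: "('y \<Rightarrow> 'k mpoly) \<Rightarrow> bool" where
  "family F \<longleftrightarrow> (\<forall>m. (\<lambda>y. lookup (F y) m) \<in> A)"

lemma family_coeff: "family F \<Longrightarrow> (\<lambda>y. lookup (F y) m) \<in> A"
  by (simp add: family_def)

lemma family_fixed: "family (\<lambda>_. p)"
  by (simp add: family_def const_mem)

lemma family_const: "f \<in> A \<Longrightarrow> family (\<lambda>y. const (f y))"
  unfolding family_def
proof
  fix m assume "f \<in> A"
  then show "(\<lambda>y. lookup (const (f y)) m) \<in> A"
    by (cases "m = 0") (simp_all add: const_def lookup_single const_mem)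
qed

lemma family_add: "family F \<Longrightarrow> family G \<Longrightarrow> family (\<lambda>y. F y + G y)"
  by (simp add: family_def lookup_add add_mem)

text \<open>The coefficient of a product at a fixed monomial is a finite sum over its factorisations,
  and these do not depend on the parameter.\<close>

lemma family_mult: "family F \<Longrightarrow> family G \<Longrightarrow> family (\<lambda>y. F y * G y)"
  by (simp add: family_def lookup_times sum_mem mult_mem)

lemma family_sum: "(\<And>i. i \<in> I \<Longrightarrow> family (F i)) \<Longrightarrow> family (\<lambda>y. \<Sum>i\<in>I. F i y)"
  by (simp add: family_def lookup_sum sum_mem)

lemma family_power: "family F \<Longrightarrow> family (\<lambda>y. F y ^ k)"
  by (induction k) (auto intro: family_fixed family_mult)

lemma family_prod: "(\<And>i. i \<in> I \<Longrightarrow> family (F i)) \<Longrightarrow> family (\<lambda>y. \<Prod>i\<in>I. F i y)"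
  by (induction I rule: infinite_finite_induct) (auto intro: family_fixed family_mult)

lemma family_gl_act:
  assumes "\<And>i j. i < n \<Longrightarrow> j < n \<Longrightarrow> (\<lambda>y. g y $$ (i, j)) \<in> A" and p: "p \<in> polys {1..n}"
  shows "family (\<lambda>y. gl_act n (g y) p)"
  unfolding gl_act_def subst_poly_def using p
  by (intro family_sum family_mult family_fixed family_prod family_power family_const assms)
    (fastforce simp: polys_def subset_iff)+

end

definition regular :: "'x set \<Rightarrow> ('y \<Rightarrow> 'x \<Rightarrow> 'k::field) \<Rightarrow> ('y \<Rightarrow> 'k) set" where
  "regular X coord = {\<lambda>y. subst_poly id (coord y) P | P. P \<in> polys X}"

lemma regularI: "P \<in> polys X \<Longrightarrow> (\<And>y. f y = subst_poly id (coord y) P) \<Longrightarrow> f \<in> regular X coord"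
  unfolding regular_def by blast

lemma regular_algebra: "function_algebra (regular X coord)"
proof
  fix c
  have "subst_poly id (coord y) (single 0 c) = c" for y
    by (simp add: id_hom.subst_single)
  then show "(\<lambda>_. c) \<in> regular X coord"
    by (intro regularI[of "single 0 c"]) (simp_all add: polys_single)
next
  fix f g assume "f \<in> regular X coord" "g \<in> regular X coord"
  then obtain P Q where PQ: "P \<in> polys X" "Q \<in> polys X"
    "f = (\<lambda>y. subst_poly id (coord y) P)" "g = (\<lambda>y. subst_poly id (coord y) Q)"
    by (auto simp: regular_def)
  show "(\<lambda>y. f y + g y) \<in> regular X coord"
    by (rule regularI[of "P + Q"]) (auto simp: PQ id_hom.subst_add polys_add)
  show "(\<lambda>y. f y * g y) \<in> regular X coord"
    by (rule regularI[of "P * Q"]) (auto simp: PQ id_hom.subst_mult polys_mult)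
qed

lemma regular_coord: "x \<in> X \<Longrightarrow> (\<lambda>y. coord y x) \<in> regular X coord"
  by (rule regularI[of "single (single x 1) 1"]) (simp_all add: id_hom.subst_single mval_single polys_single)

lemma poly_function_algebra: "function_algebra (range (poly :: 'k::field poly \<Rightarrow> 'k \<Rightarrow> 'k))"
proof
  show "(\<lambda>_. c) \<in> range poly" for c :: 'k by (rule range_eqI[of _ _ "[:c:]"]) auto
next
  fix f g :: "'k \<Rightarrow> 'k" assume "f \<in> range poly" "g \<in> range poly"
  then obtain P Q where "f = poly P" "g = poly Q" by auto
  moreover have "(\<lambda>y. poly P y + poly Q y) = poly (P + Q)" "(\<lambda>y. poly P y * poly Q y) = poly (P * Q)"
    by (simp_all add: fun_eq_iff)
  ultimately show "(\<lambda>y. f y + g y) \<in> range poly" "(\<lambda>y. f y * g y) \<in> range poly"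
    by simp_all
qed

lemma regular_along_curve:
  assumes f: "f \<in> regular X coord" and A: "function_algebra A"
    and c: "\<And>x. x \<in> X \<Longrightarrow> (\<lambda>t. coord (l t) x) \<in> A"
  shows "(\<lambda>t. f (l t)) \<in> A"
proof -
  interpret function_algebra A by (rule A)
  obtain P where P: "P \<in> polys X" "f = (\<lambda>y. subst_poly id (coord y) P)" using f by (auto simp: regular_def)
  show ?thesis unfolding P(2) subst_poly_def using P(1)
    by (intro sum_mem mult_mem const_mem prod_mem power_mem c) (auto simp: polys_def)
qed

text \<open>A usable form of irreducibility over an infinite field: regular functions become polynomials
  in one variable along the curve, and nonzero polynomials have finitely many zeros.\<close>

definition curve_connected :: "'y set \<Rightarrow> 'x set \<Rightarrow> ('y \<Rightarrow> 'x \<Rightarrow> 'k::field) \<Rightarrow> bool" where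
  "curve_connected Y X coord \<longleftrightarrow> (\<forall>y0\<in>Y. \<forall>y1\<in>Y. \<exists>l q. l 0 = y0 \<and> l 1 = y1 \<and>
     (\<forall>x\<in>X. (\<lambda>t. coord (l t) x) \<in> range poly) \<and> q \<noteq> 0 \<and> (\<forall>t. poly q t \<noteq> 0 \<longrightarrow> l t \<in> Y))"

lemma poly_nonzero_point:
  fixes q :: "'k::field_char_0 poly"
  assumes "q \<noteq> 0" shows "\<exists>t. t \<noteq> c \<and> poly q t \<noteq> 0"
proof -
  have "finite (insert c {t. poly q t = 0})" using poly_roots_finite[OF assms] by simp
  then show ?thesis using ex_new_if_finite[OF infinite_UNIV_char_0] by blast
qed

lemma curve_connected_nonzero:
  fixes coord :: "'y \<Rightarrow> 'x \<Rightarrow> 'k::field_char_0"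
  assumes Y: "curve_connected Y X coord" and f: "f \<in> regular X coord" and g: "g \<in> regular X coord"
    and y0: "y0 \<in> Y" "f y0 \<noteq> 0" and y1: "y1 \<in> Y" "g y1 \<noteq> 0"
  obtains y where "y \<in> Y" "f y \<noteq> 0" "g y \<noteq> 0"
proof -
  obtain l q where l: "l 0 = y0" "l 1 = y1" "\<And>x. x \<in> X \<Longrightarrow> (\<lambda>t. coord (l t) x) \<in> range poly"
    and q: "q \<noteq> 0" "\<And>t. poly q t \<noteq> 0 \<Longrightarrow> l t \<in> Y"
    using bspec[OF bspec[OF Y[unfolded curve_connected_def] y0(1)] y1(1)] by (elim exE conjE) metis
  obtain F G where F: "(\<lambda>t. f (l t)) = poly F" and G: "(\<lambda>t. g (l t)) = poly G"
    using regular_along_curve[OF f poly_function_algebra l(3)] regular_along_curve[OF g poly_function_algebra l(3)]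
    by blast
  have "F \<noteq> 0" "G \<noteq> 0"
    using fun_cong[OF F, of 0] fun_cong[OF G, of 1] l(1,2) y0 y1 by auto
  then have "F * G * q \<noteq> 0" using q by simp
  then obtain t where "poly (F * G * q) t \<noteq> 0" using poly_nonzero_point by blast
  then have "poly F t \<noteq> 0" "poly G t \<noteq> 0" "poly q t \<noteq> 0" by simp_all
  then show thesis using that[of "l t"] q(2) fun_cong[OF F, of t] fun_cong[OF G, of t] by simp
qed

lemma zariski_open_nonzero:
  "f \<in> regular X coord \<Longrightarrow> zariski_open_in Y X coord {y \<in> Y. f y \<noteq> 0}"
proof -
  assume "f \<in> regular X coord"
  then obtain P where "P \<in> polys X" "f = (\<lambda>y. subst_poly id (coord y) P)" by (auto simp: regular_def)
  then show "zariski_open_in Y X coord {y \<in> Y. f y \<noteq> 0}"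
    unfolding zariski_open_in_def by (intro exI[of _ "{P}"]) auto
qed

lemma zariski_open_regular:
  assumes "zariski_open_in Y X coord U" "y \<in> U"
  obtains f where "f \<in> regular X coord" "f y \<noteq> 0" "\<And>z. z \<in> Y \<Longrightarrow> f z \<noteq> 0 \<Longrightarrow> z \<in> U" "y \<in> Y"
proof -
  obtain S where S: "S \<subseteq> polys X" "U = {y \<in> Y. \<exists>p\<in>S. subst_poly id (coord y) p \<noteq> 0}"
    using assms(1) unfolding zariski_open_in_def by blast
  then obtain P where P: "P \<in> S" "subst_poly id (coord y) P \<noteq> 0" "y \<in> Y" using assms(2) by blast
  show thesis
  proof (rule that)
    show "(\<lambda>y. subst_poly id (coord y) P) \<in> regular X coord"
      unfolding regular_def using P S by blast
  qed (use P S in auto)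
qed

lemma zariski_open_meet:
  fixes coord :: "'y \<Rightarrow> 'x \<Rightarrow> 'k::field_char_0"
  assumes "curve_connected Y X coord" "zariski_open_in Y X coord U" "zariski_open_in Y X coord V"
    "U \<noteq> {}" "V \<noteq> {}"
  obtains y where "y \<in> U" "y \<in> V"
proof -
  obtain u v where "u \<in> U" "v \<in> V" using assms by blast
  obtain f where f: "f \<in> regular X coord" "f u \<noteq> 0" "\<And>z. z \<in> Y \<Longrightarrow> f z \<noteq> 0 \<Longrightarrow> z \<in> U" "u \<in> Y"
    using zariski_open_regular[OF assms(2) \<open>u \<in> U\<close>] by metis
  obtain g where g: "g \<in> regular X coord" "g v \<noteq> 0" "\<And>z. z \<in> Y \<Longrightarrow> g z \<noteq> 0 \<Longrightarrow> z \<in> V" "v \<in> Y"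
    using zariski_open_regular[OF assms(3) \<open>v \<in> V\<close>] by metis
  obtain y where "y \<in> Y" "f y \<noteq> 0" "g y \<noteq> 0"
    by (rule curve_connected_nonzero[OF assms(1) f(1) g(1) f(4,2) g(4,2)])
  then show thesis using that f(3) g(3) by blast
qed

lemma finite_nonzero_point:
  fixes coord :: "'y \<Rightarrow> 'x \<Rightarrow> 'k::field_char_0"
  assumes Y: "curve_connected Y X coord" and "Y \<noteq> {}" and "finite C"
    and f: "\<And>c. c \<in> C \<Longrightarrow> f c \<in> regular X coord" "\<And>c. c \<in> C \<Longrightarrow> \<exists>y\<in>Y. f c y \<noteq> 0"
  shows "\<exists>y\<in>Y. (\<Prod>c\<in>C. f c y) \<noteq> 0"
  using \<open>finite C\<close> f
proof (induction C)
  case empty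
  then show ?case using \<open>Y \<noteq> {}\<close> by auto
next
  case (insert c C)
  interpret function_algebra "regular X coord" by (rule regular_algebra)
  have "(\<lambda>y. \<Prod>c\<in>C. f c y) \<in> regular X coord" using insert.prems by (intro prod_mem) auto
  moreover obtain y1 where "y1 \<in> Y" "(\<Prod>c\<in>C. f c y1) \<noteq> 0" using insert by blast
  moreover obtain y0 where "y0 \<in> Y" "f c y0 \<noteq> 0" using insert.prems by blast
  ultimately obtain y where "y \<in> Y" "f c y \<noteq> 0" "(\<Prod>c\<in>C. f c y) \<noteq> 0"
    using curve_connected_nonzero[OF Y, of "f c" "\<lambda>y. \<Prod>c\<in>C. f c y" y0 y1] insert.prems by auto
  then show ?case using insert.hyps by (intro bexI[of _ y]) auto
qed

abbreviation mat_coord :: "'k::field mat \<Rightarrow> nat \<times> nat \<Rightarrow> 'k" where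
  "mat_coord \<equiv> (\<lambda>g ij. g $$ ij)"

text \<open>The curve is the segment between two matrices; it leaves the group where the determinant, a
  polynomial in the parameter, vanishes.\<close>

lemma curve_connected_general_linear:
  "curve_connected (general_linear n :: 'k::field_char_0 mat set) ({0..<n} \<times> {0..<n}) mat_coord"
  unfolding curve_connected_def
proof (intro ballI)
  fix g h :: "'k mat" assume g: "g \<in> general_linear n" and h: "h \<in> general_linear n"
  define l where "l t = mat n n (\<lambda>(i, j). g $$ (i, j) + t * (h $$ (i, j) - g $$ (i, j)))" for t
  interpret function_algebra "range (poly :: 'k poly \<Rightarrow> 'k \<Rightarrow> 'k)" by (rule poly_function_algebra)
  have entry: "(\<lambda>t. g $$ (i, j) + t * (h $$ (i, j) - g $$ (i, j))) \<in> range poly" for i j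
    by (rule range_eqI[of _ _ "[:g $$ (i, j), h $$ (i, j) - g $$ (i, j):]"]) auto
  have "(\<lambda>t. det (l t)) \<in> range poly"
    unfolding l_def by (rule det_mem) (rule entry)
  then obtain q where q: "\<And>t. det (l t) = poly q t" by (metis (no_types) imageE)
  have l01: "l 0 = g" "l 1 = h" using g h by (auto simp: l_def general_linear_iff)
  then have "q \<noteq> 0" using q[of 0] g by (auto simp: general_linear_iff)
  moreover have "(\<lambda>t. l t $$ x) \<in> range poly" if "x \<in> {0..<n} \<times> {0..<n}" for x
    using that entry by (auto simp: l_def)
  moreover have "l t \<in> general_linear n" if "poly q t \<noteq> 0" for t
    using that q[of t] by (auto simp: l_def general_linear_iff)
  ultimately show "\<exists>l q. l 0 = g \<and> l 1 = h \<and> (\<forall>x\<in>{0..<n} \<times> {0..<n}. (\<lambda>t. l t $$ x) \<in> range poly) \<and>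
      q \<noteq> 0 \<and> (\<forall>t. poly q t \<noteq> 0 \<longrightarrow> l t \<in> general_linear n)"
    using l01 by blast
qed

lemma curve_connected_linear_forms:
  "curve_connected (homog n 1 :: 'k::field_char_0 mpoly set) {1..n} coeff_coord"
  unfolding curve_connected_def
proof (intro ballI)
  fix L M :: "'k mpoly" assume L: "L \<in> homog n 1" "M \<in> homog n 1"
  define l where "l t = L + const t * (M - L)" for t
  have "(\<lambda>t. coeff_coord (l t) x) \<in> range poly" for x
    unfolding coeff_coord_def l_def lookup_add lookup_const_times
    by (rule range_eqI[of _ _ "[:lookup L (single x 1), lookup (M - L) (single x 1):]"]) auto
  moreover have "l 0 = L" "l 1 = M" "\<And>t. l t \<in> homog n 1" using L by (auto simp: l_def)
  ultimately show "\<exists>l q. l 0 = L \<and> l 1 = M \<and> (\<forall>x\<in>{1..n}. (\<lambda>t. coeff_coord (l t) x) \<in> range poly) \<and>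
      q \<noteq> 0 \<and> (\<forall>t. poly q t \<noteq> 0 \<longrightarrow> l t \<in> homog n 1)"
    using one_neq_zero by blast
qed

section \<open>Homogeneous ideals\<close>

text \<open>Homogeneous ideals described elementwise: the last clause says that an ideal contains the
  homogeneous components of its elements.\<close>

definition graded_ideal :: "nat \<Rightarrow> 'k::field mpoly set \<Rightarrow> bool" where
  "graded_ideal n K \<longleftrightarrow> K \<subseteq> polys {1..n} \<and> 0 \<in> K \<and> (\<forall>p\<in>K. \<forall>q\<in>K. p + q \<in> K) \<and>
     (\<forall>r\<in>polys {1..n}. \<forall>p\<in>K. r * p \<in> K) \<and> (\<forall>p\<in>K. \<forall>d. hpart d p \<in> K)"

lemma graded_idealD:
  assumes "graded_ideal n K"
  shows "K \<subseteq> polys {1..n}" "0 \<in> K" "p \<in> K \<Longrightarrow> q \<in> K \<Longrightarrow> p + q \<in> K"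
    "r \<in> polys {1..n} \<Longrightarrow> p \<in> K \<Longrightarrow> r * p \<in> K" "p \<in> K \<Longrightarrow> hpart d p \<in> K"
    "p \<in> K \<Longrightarrow> const c * p \<in> K" "p \<in> K \<Longrightarrow> q \<in> K \<Longrightarrow> p - q \<in> K"
proof -
  show c: "p \<in> K \<Longrightarrow> const c * p \<in> K" for p c
    using assms by (simp add: graded_ideal_def)
  show "p \<in> K \<Longrightarrow> q \<in> K \<Longrightarrow> p - q \<in> K"
    using assms c[of q "- 1"] unfolding graded_ideal_def
    by (metis add_uminus_conv_diff const_1 const_uminus mult_minus1)
qed (use assms in \<open>auto simp: graded_ideal_def\<close>)

lemma cring_poly_ring: "cring (poly_ring n)"
proof (rule cringI)
  show "abelian_group (poly_ring n)"
    by (rule abelian_groupI) (auto simp: add.assoc add.commute intro: bexI[of _ "- x" for x])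
  show "comm_monoid (poly_ring n)"
    by (rule comm_monoidI) (auto simp: mult.assoc mult.commute)
qed (auto simp: distrib_right)

lemma a_inv_poly_ring: "p \<in> polys {1..n} \<Longrightarrow> \<ominus>\<^bsub>poly_ring n\<^esub> p = - p"
proof -
  assume p: "p \<in> polys {1..n}"
  interpret cring "poly_ring n :: 'a mpoly ring" by (rule cring_poly_ring)
  show ?thesis using p by (intro minus_equality) auto
qed

lemma idealD_poly:
  assumes "ideal K (poly_ring n)"
  shows "K \<subseteq> polys {1..n}" "0 \<in> K" "p \<in> K \<Longrightarrow> q \<in> K \<Longrightarrow> p + q \<in> K"
    "r \<in> polys {1..n} \<Longrightarrow> p \<in> K \<Longrightarrow> r * p \<in> K" "p \<in> K \<Longrightarrow> q \<in> K \<Longrightarrow> p - q \<in> K"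
proof -
  interpret ideal K "poly_ring n" by (rule assms)
  show 1: "K \<subseteq> polys {1..n}" using a_subset by simp
  show "0 \<in> K" using additive_subgroup.zero_closed[OF is_additive_subgroup] by simp
  show 2: "p \<in> K \<Longrightarrow> q \<in> K \<Longrightarrow> p + q \<in> K" for p q using additive_subgroup.a_closed[OF is_additive_subgroup, of p q] by simp
  show 3: "r \<in> polys {1..n} \<Longrightarrow> p \<in> K \<Longrightarrow> r * p \<in> K" for r p using I_l_closed[of p r] by simp
  show "p \<in> K \<Longrightarrow> q \<in> K \<Longrightarrow> p - q \<in> K"
    using 2[of p "- q"] 3[of "- 1" q] by (simp add: polys_uminus)
qed

lemma ideal_polyI:
  fixes K :: "'k::field mpoly set"
  assumes "K \<subseteq> polys {1..n}" "0 \<in> K" "\<And>p q. p \<in> K \<Longrightarrow> q \<in> K \<Longrightarrow> p + q \<in> K"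
    "\<And>r p. r \<in> polys {1..n} \<Longrightarrow> p \<in> K \<Longrightarrow> r * p \<in> K"
  shows "ideal K (poly_ring n)"
proof (rule idealI)
  interpret cring "poly_ring n :: 'k mpoly ring" by (rule cring_poly_ring)
  show "ring (poly_ring n :: 'k mpoly ring)" by unfold_locales
  show "subgroup K (add_monoid (poly_ring n))"
  proof (rule add.subgroupI)
    fix p assume p: "p \<in> K"
    then have "- p \<in> K" using assms(4)[of "- 1" p] by (simp add: polys_uminus)
    then show "\<ominus>\<^bsub>poly_ring n\<^esub> p \<in> K" using p assms(1) by (simp add: a_inv_poly_ring subset_iff)
  qed (use assms in auto)
  show "r \<otimes>\<^bsub>poly_ring n\<^esub> p \<in> K" if "p \<in> K" "r \<in> carrier (poly_ring n)" for r p
    using that assms(4) by simp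
  then show "p \<otimes>\<^bsub>poly_ring n\<^esub> r \<in> K" if "p \<in> K" "r \<in> carrier (poly_ring n)" for r p
    using that by (metis mult.commute mult_poly_ring)
qed

lemma graded_ideal_ideal: "graded_ideal n K \<Longrightarrow> ideal K (poly_ring n)"
  by (rule ideal_polyI) (auto simp: graded_ideal_def)

lemma hpart_mult_mem:
  fixes K :: "'k::field mpoly set"
  assumes K: "K \<subseteq> polys {1..n}" "0 \<in> K" "\<And>p q. p \<in> K \<Longrightarrow> q \<in> K \<Longrightarrow> p + q \<in> K"
    "\<And>r p. r \<in> polys {1..n} \<Longrightarrow> p \<in> K \<Longrightarrow> r * p \<in> K"
    and p: "\<And>d. hpart d p \<in> K" and r: "r \<in> polys {1..n}"
  shows "hpart d (r * p) \<in> K"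
proof -
  obtain D where D: "r = (\<Sum>e\<in>D. hpart e r)" using polys_hparts[OF r] by (elim exE conjE)
  have *: "hpart d (hpart e r * p) \<in> K" for e
  proof (cases "e \<le> d")
    case True
    have "hpart (e + (d - e)) (hpart e r * p) = hpart e r * hpart (d - e) p"
      by (rule hpart_homog_mult[OF hpart_homog[OF r]])
    moreover have "hpart e r \<in> polys {1..n}" using r by (simp add: hpart_def polys_pick)
    ultimately show ?thesis using True K(4) p by simp
  next
    case False
    then show ?thesis using hpart_homog_mult(2)[OF hpart_homog[OF r], of d e] K(2) by simp
  qed
  have s: "(\<Sum>e\<in>D. f e) \<in> K" if "\<And>e. f e \<in> K" for f using K(2,3) that
    by (induction D rule: infinite_finite_induct) auto
  have "hpart d (r * p) = (\<Sum>e\<in>D. hpart d (hpart e r * p))"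
    using arg_cong[OF D, of "\<lambda>r. hpart d (r * p)"] by (simp add: hpart_sum sum_distrib_right)
  then show ?thesis using s * by simp
qed

text \<open>The polynomials all of whose homogeneous components lie in \<open>K\<close> form an ideal that contains
  the homogeneous generators.\<close>

lemma homogeneous_ideal_graded:
  assumes "homogeneous_ideal n K" "ideal K (poly_ring n)"
  shows "graded_ideal n K"
proof -
  interpret cring "poly_ring n :: 'a mpoly ring" by (rule cring_poly_ring)
  obtain S where S: "S \<subseteq> (\<Union>e. homog n e)" "K = Idl\<^bsub>poly_ring n\<^esub> S"
    using assms(1) by (auto simp: homogeneous_ideal_def)
  define H where "H = {p \<in> polys {1..n}. \<forall>d. hpart d p \<in> K}"
  note K = idealD_poly[OF assms(2)]
  have SR: "S \<subseteq> polys {1..n}" using S(1) homog_polys by blast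
  then have SK: "S \<subseteq> K" unfolding S(2) using genideal_self by simp
  have "ideal H (poly_ring n)"
  proof (rule ideal_polyI)
    fix r p :: "'a mpoly" assume "r \<in> polys {1..n}" "p \<in> H"
    then show "r * p \<in> H" using hpart_mult_mem[OF K(1-4)] by (auto simp: H_def)
  qed (auto simp: H_def hpart_add K)
  moreover have "S \<subseteq> H"
  proof
    fix p assume p: "p \<in> S"
    then obtain e where e: "p \<in> homog n e" using S(1) by blast
    have "hpart d p \<in> K" for d
      using hpart_self[of p n d] hpart_other[OF e, of d] e p SK K(2) by (cases "e = int d") auto
    then show "p \<in> H" using p SR by (auto simp: H_def)
  qed
  ultimately have "K \<subseteq> H" unfolding S(2) by (rule genideal_minimal)
  then show ?thesis using K by (auto simp: graded_ideal_def H_def)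
qed

lemma coset_poly_ring: "K +>\<^bsub>poly_ring n\<^esub> p = (\<lambda>h. h + p) ` K"
  by (auto simp: a_r_coset_def r_coset_def)

lemma coset_eq_iff:
  assumes K: "ideal K (poly_ring n)"
  shows "K +>\<^bsub>poly_ring n\<^esub> p = K +>\<^bsub>poly_ring n\<^esub> q \<longleftrightarrow> p - q \<in> K"
proof
  note K' = idealD_poly[OF K]
  assume eq: "K +>\<^bsub>poly_ring n\<^esub> p = K +>\<^bsub>poly_ring n\<^esub> q"
  have "p \<in> K +>\<^bsub>poly_ring n\<^esub> p" using K'(2) by (force simp: coset_poly_ring)
  then obtain h where "h \<in> K" "p = h + q" unfolding eq by (auto simp: coset_poly_ring)
  then show "p - q \<in> K" by simp
next
  note K' = idealD_poly[OF K]
  assume pq: "p - q \<in> K"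
  have sub: "(\<lambda>h. h + a) ` K \<subseteq> (\<lambda>h. h + b) ` K" if "a - b \<in> K" for a b
  proof
    fix x assume "x \<in> (\<lambda>h. h + a) ` K"
    then obtain h where "h \<in> K" "x = h + a" by blast
    then show "x \<in> (\<lambda>h. h + b) ` K" using K'(3)[OF _ that, of h] by (intro image_eqI[of _ _ "h + (a - b)"]) auto
  qed
  have "q - p \<in> K" using K'(5)[OF K'(2) pq] by simp
  then show "K +>\<^bsub>poly_ring n\<^esub> p = K +>\<^bsub>poly_ring n\<^esub> q"
    using sub[OF pq] sub[of q p] unfolding coset_poly_ring by blast
qed

lemma quot_mult_coset:
  assumes K: "ideal K (poly_ring n)" and "p \<in> polys {1..n}" "q \<in> polys {1..n}"
  shows "(K +>\<^bsub>poly_ring n\<^esub> p) \<otimes>\<^bsub>poly_ring n Quot K\<^esub> (K +>\<^bsub>poly_ring n\<^esub> q) = K +>\<^bsub>poly_ring n\<^esub> (p * q)"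
  using ideal.rcoset_mult_add[OF K, of p q] assms by (simp add: FactRing_def)

lemma quot_comp_zero_iff:
  fixes K :: "'k::field mpoly set"
  assumes K: "ideal K (poly_ring n)"
  shows "quot_comp n K d = {\<zero>\<^bsub>poly_ring n Quot K\<^esub>} \<longleftrightarrow> homog n (int d) \<subseteq> K"
proof -
  have z: "\<zero>\<^bsub>poly_ring n Quot K\<^esub> = K +>\<^bsub>poly_ring n\<^esub> 0"
    by (simp add: FactRing_def coset_poly_ring)
  have "quot_comp n K d = {K +>\<^bsub>poly_ring n\<^esub> 0} \<longleftrightarrow> (\<forall>p\<in>homog n (int d). K +>\<^bsub>poly_ring n\<^esub> p = K +>\<^bsub>poly_ring n\<^esub> 0)"
    unfolding quot_comp_def using homog_zero by blast
  then show ?thesis unfolding z by (auto simp: coset_eq_iff[OF K])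
qed

definition mult_injective :: "nat \<Rightarrow> 'k::field mpoly set \<Rightarrow> 'k mpoly \<Rightarrow> nat \<Rightarrow> bool" where
  "mult_injective n K L d \<longleftrightarrow> (\<forall>p\<in>homog n (int d). L * p \<in> K \<longrightarrow> p \<in> K)"

definition ideal_plus :: "nat \<Rightarrow> 'k::field mpoly set \<Rightarrow> 'k mpoly \<Rightarrow> 'k mpoly set" where
  "ideal_plus n K L = {p + q * L | p q. p \<in> K \<and> q \<in> polys {1..n}}"

lemma ideal_plus_eq: "K <+>\<^bsub>poly_ring n\<^esub> (PIdl\<^bsub>poly_ring n\<^esub> L) = ideal_plus n K L"
  unfolding ideal_plus_def by (auto simp: set_add_def' cgenideal_def)

lemma ideal_plus_ideal:
  assumes K: "ideal K (poly_ring n)" and L: "L \<in> polys {1..n}"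
  shows "ideal (ideal_plus n K L) (poly_ring n)"
proof (rule ideal_polyI)
  note K' = idealD_poly[OF K]
  show "ideal_plus n K L \<subseteq> polys {1..n}" using K'(1) L by (auto simp: ideal_plus_def)
  show "0 \<in> ideal_plus n K L" unfolding ideal_plus_def using K'(2) by force
  fix p q assume "p \<in> ideal_plus n K L" "q \<in> ideal_plus n K L"
  then obtain a b c d where "p = a + b * L" "q = c + d * L" "a \<in> K" "c \<in> K" "b \<in> polys {1..n}" "d \<in> polys {1..n}"
    by (auto simp: ideal_plus_def)
  moreover from this have "p + q = (a + c) + (b + d) * L" by (simp add: algebra_simps)
  ultimately show "p + q \<in> ideal_plus n K L" unfolding ideal_plus_def using K'(3) polys_add by blast
next
  note K' = idealD_poly[OF K]
  fix r p :: "'a mpoly" assume r: "r \<in> polys {1..n}" "p \<in> ideal_plus n K L"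
  then obtain a b where "p = a + b * L" "a \<in> K" "b \<in> polys {1..n}" by (auto simp: ideal_plus_def)
  moreover from this have "r * p = r * a + (r * b) * L" by (simp add: algebra_simps)
  ultimately show "r * p \<in> ideal_plus n K L" unfolding ideal_plus_def using r K'(4) polys_mult by blast
qed

text \<open>Taking the components of degree \<open>d + 1\<close> of both summands is possible because \<open>K\<close> contains
  the homogeneous components of its elements.\<close>

lemma ideal_plus_homog:
  assumes K: "graded_ideal n K" and L: "L \<in> homog n 1" and p: "p \<in> homog n (int (Suc d))"
    and "p \<in> ideal_plus n K L"
  obtains a b where "a \<in> K \<inter> homog n (int (Suc d))" "b \<in> homog n (int d)" "p = a + L * b"
proof -
  obtain a b where ab: "p = a + b * L" "a \<in> K" "b \<in> polys {1..n}" using assms(4) by (auto simp: ideal_plus_def)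
  have "hpart (Suc d) p = hpart (Suc d) a + hpart (1 + d) (L * b)" by (simp add: ab(1) hpart_add mult.commute)
  also have "hpart (1 + d) (L * b) = L * hpart d b" by (rule hpart_homog_mult) (use L in simp)
  finally have "p = hpart (Suc d) a + L * hpart d b" using hpart_self[OF p] by simp
  then show thesis using that[of "hpart (Suc d) a" "hpart d b"] ab graded_idealD(1,5)[OF K] by blast
qed

lemma weak_lefschetz_iff:
  assumes K: "graded_ideal n K"
  shows "weak_lefschetz n K \<longleftrightarrow> (\<exists>L\<in>homog n 1. \<forall>d.
    mult_injective n K L d \<or> homog n (int (Suc d)) \<subseteq> ideal_plus n K L)"
proof -
  let ?R = "poly_ring n"
  note I = graded_ideal_ideal[OF K]
  note K' = idealD_poly[OF I]
  have "(let mul = (\<lambda>a. (K +>\<^bsub>?R\<^esub> L) \<otimes>\<^bsub>?R Quot K\<^esub> a)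
      in inj_on mul (quot_comp n K d) \<or> mul ` quot_comp n K d = quot_comp n K (Suc d)) \<longleftrightarrow>
      mult_injective n K L d \<or> homog n (int (Suc d)) \<subseteq> ideal_plus n K L" if L: "L \<in> homog n 1" for L d
  proof -
    let ?mul = "\<lambda>a. (K +>\<^bsub>?R\<^esub> L) \<otimes>\<^bsub>?R Quot K\<^esub> a"
    have mul: "?mul (K +>\<^bsub>?R\<^esub> p) = K +>\<^bsub>?R\<^esub> (L * p)" if "p \<in> homog n e" for p e
      using quot_mult_coset[OF I homog_polys[OF L] homog_polys[OF that]] .
    have Lp: "L * p \<in> homog n (int (Suc d))" if "p \<in> homog n (int d)" for p
      using homog_mult[OF L that] by simp
    have "inj_on ?mul (quot_comp n K d) \<longleftrightarrow>
        (\<forall>p\<in>homog n (int d). \<forall>q\<in>homog n (int d). L * p - L * q \<in> K \<longrightarrow> p - q \<in> K)"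
      unfolding inj_on_def quot_comp_def by (simp add: mul coset_eq_iff[OF I])
    also have "\<dots> \<longleftrightarrow> mult_injective n K L d"
    proof
      assume *: "\<forall>p\<in>homog n (int d). \<forall>q\<in>homog n (int d). L * p - L * q \<in> K \<longrightarrow> p - q \<in> K"
      show "mult_injective n K L d"
        unfolding mult_injective_def using *[rule_format, of _ 0] by auto
    next
      assume "mult_injective n K L d"
      then show "\<forall>p\<in>homog n (int d). \<forall>q\<in>homog n (int d). L * p - L * q \<in> K \<longrightarrow> p - q \<in> K"
        unfolding mult_injective_def using homog_minus by (auto simp: right_diff_distrib[symmetric])
    qed
    finally have 1: "inj_on ?mul (quot_comp n K d) \<longleftrightarrow> mult_injective n K L d" .
    have eq: "?mul ` quot_comp n K d = (\<lambda>p. K +>\<^bsub>?R\<^esub> (L * p)) ` homog n (int d)"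
      unfolding quot_comp_def image_image by (rule image_cong[OF refl mul])
    have sub: "(\<lambda>p. K +>\<^bsub>?R\<^esub> (L * p)) ` homog n (int d) \<subseteq> quot_comp n K (Suc d)"
      unfolding quot_comp_def using Lp by blast
    have "?mul ` quot_comp n K d = quot_comp n K (Suc d) \<longleftrightarrow>
        quot_comp n K (Suc d) \<subseteq> (\<lambda>p. K +>\<^bsub>?R\<^esub> (L * p)) ` homog n (int d)"
      unfolding eq set_eq_subset by (simp only: sub simp_thms)
    also have "\<dots> \<longleftrightarrow>
        (\<forall>q\<in>homog n (int (Suc d)). \<exists>p\<in>homog n (int d). K +>\<^bsub>?R\<^esub> q = K +>\<^bsub>?R\<^esub> (L * p))"
      unfolding quot_comp_def image_subset_iff image_iff by (rule refl)
    also have "\<dots> \<longleftrightarrow> (\<forall>q\<in>homog n (int (Suc d)). q \<in> ideal_plus n K L)"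
    proof (rule ball_cong[OF refl])
      fix q :: "'a mpoly" assume q: "q \<in> homog n (int (Suc d))"
      show "(\<exists>p\<in>homog n (int d). K +>\<^bsub>?R\<^esub> q = K +>\<^bsub>?R\<^esub> (L * p)) \<longleftrightarrow> q \<in> ideal_plus n K L"
      proof
        assume "\<exists>p\<in>homog n (int d). K +>\<^bsub>?R\<^esub> q = K +>\<^bsub>?R\<^esub> (L * p)"
        then obtain p where "p \<in> homog n (int d)" "q - L * p \<in> K" by (auto simp: coset_eq_iff[OF I])
        moreover have "q = (q - L * p) + p * L" by simp
        ultimately show "q \<in> ideal_plus n K L" unfolding ideal_plus_def using homog_polys by blast
      next
        assume "q \<in> ideal_plus n K L"
        then obtain a b where "a \<in> K" "b \<in> homog n (int d)" "q = a + L * b"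
          using ideal_plus_homog[OF K L q] by blast
        then show "\<exists>p\<in>homog n (int d). K +>\<^bsub>?R\<^esub> q = K +>\<^bsub>?R\<^esub> (L * p)"
          by (intro bexI[of _ b]) (auto simp: coset_eq_iff[OF I])
      qed
    qed
    finally show ?thesis unfolding Let_def 1 by blast
  qed
  then show ?thesis unfolding weak_lefschetz_def by (intro bex_cong ball_cong all_cong refl) auto
qed

text \<open>The chain of the images of the ideals \<open>K + R\<^sub>\<ge>\<^sub>i\<close> becomes stationary. A form of degree \<open>d\<close> is
  then congruent modulo \<open>K\<close> to a polynomial whose component of degree \<open>d\<close> lies in \<open>K\<close>.\<close>

lemma artinian_contains_high_degrees:
  assumes K: "graded_ideal n K" and A: "artinian_ring (poly_ring n Quot K)"
  obtains D where "\<And>d. d \<ge> D \<Longrightarrow> homog n (int d) \<subseteq> K"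
proof -
  let ?R = "poly_ring n" and ?Q = "poly_ring n Quot K"
  note I = graded_ideal_ideal[OF K]
  note K' = graded_idealD[OF K]
  interpret ideal K ?R by (rule I)
  \<comment> \<open>These ideals are \<open>K + R\<^sub>\<ge>\<^sub>i\<close>.\<close>
  define M where "M i = {p \<in> polys {1..n}. \<forall>d<i. hpart d p \<in> K}" for i
  have M: "ideal (M i) ?R" for i
  proof (rule ideal_polyI)
    fix r p :: "'a mpoly" assume r: "r \<in> polys {1..n}" and p: "p \<in> M i"
    have "hpart d (r * p) \<in> K" if "d < i" for d
    proof -
      \<comment> \<open>Only the components of \<open>p\<close> of degree at most \<open>d\<close> contribute to that of the product.\<close>
      define p' where "p' = pick (\<lambda>m. mdeg m \<le> d) p"
      have e: "hpart e p' = (if e \<le> d then hpart e p else 0)" for e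
        by (rule poly_mapping_eqI) (auto simp: p'_def hpart_def lookup_pick)
      have "hpart e p' \<in> K" for e using p that K'(2) by (auto simp: e M_def)
      then have 1: "hpart d (r * p') \<in> K"
        using hpart_mult_mem[of K n p' r d] K' r by blast
      have "lookup (hpart d (r * p)) m = lookup (hpart d (r * p')) m" for m
      proof (cases "mdeg m = d")
        case True
        then have "fst ab + snd ab = m \<Longrightarrow> lookup p (snd ab) = lookup p' (snd ab)" for ab
          by (auto simp: p'_def lookup_pick)
        then show ?thesis by (simp add: hpart_def lookup_pick lookup_times)
      qed (simp add: hpart_def lookup_pick)
      then show ?thesis using 1 poly_mapping_eqI by metis
    qed
    then show "r * p \<in> M i" using r p by (auto simp: M_def)
  qed (auto simp: M_def hpart_add K')
  define C where "C i = (\<lambda>p. K +>\<^bsub>?R\<^esub> p) ` M i" for i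
  have "ideal (C i) ?Q" for i
    unfolding C_def by (rule ring_ideal_imp_quot_ideal[OF I M])
  moreover have "C (Suc i) \<subseteq> C i" for i unfolding C_def M_def by auto
  ultimately have "\<forall>i. ideal (C i) ?Q \<and> C (Suc i) \<subseteq> C i" by simp
  then have "\<exists>m. \<forall>i\<ge>m. C i = C m" by (rule A[unfolded artinian_ring_def, THEN spec, THEN mp])
  then obtain D where D': "\<forall>i\<ge>D. C i = C D" by (rule exE)
  note D = D'[rule_format]
  have "homog n (int d) \<subseteq> K" if "d \<ge> D" for d
  proof
    fix p :: "'a mpoly" assume p: "p \<in> homog n (int d)"
    have "p \<in> M d" using p K'(2) homog_polys by (auto simp: M_def hpart_other)
    then have "K +>\<^bsub>?R\<^esub> p \<in> C (Suc d)" using D[of d] D[of "Suc d"] that unfolding C_def by auto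
    then obtain q where q: "q \<in> M (Suc d)" "p - q \<in> K"
      unfolding C_def by (auto simp: coset_eq_iff[OF I])
    have "hpart d q \<in> K" using q(1) by (simp add: M_def)
    moreover have "hpart d p - hpart d q \<in> K" using K'(5)[OF q(2), of d] by (simp add: hpart_minus)
    ultimately have "hpart d p \<in> K" using K'(3) by force
    then show "p \<in> K" using hpart_self[OF p] by simp
  qed
  then show thesis using that by blast
qed

lemma homog_subset_mono:
  assumes K: "ideal K (poly_ring n)" and d: "homog n (int d) \<subseteq> K" and "d \<le> e"
  shows "homog n (int e) \<subseteq> K"
proof -
  note K' = idealD_poly[OF K]
  have step: "homog n (int (Suc d)) \<subseteq> K" if d: "homog n (int d) \<subseteq> K" for d
  proof
    fix p :: "'a mpoly" assume p: "p \<in> homog n (int (Suc d))"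
    have "const (lookup p m) * xmonom m \<in> K" if m: "m \<in> keys p" for m
    proof -
      have km: "keys m \<subseteq> {1..n}" "mdeg m = Suc d" using p m by (auto simp: homog_def polys_def)
      then obtain i where i: "i \<in> keys m" by (metis mdeg_eq_0_iff keys_eq_empty all_not_in_conv nat.simps(3) mdeg_zero)
      define w where "w = m - single i 1"
      have w: "m = single i 1 + w"
        by (rule poly_mapping_eqI) (use i in \<open>auto simp: w_def lookup_add lookup_minus lookup_single when_def in_keys_iff\<close>)
      have "keys w \<subseteq> {1..n}" "mdeg w = d" using km by (auto simp: w keys_plus_nat)
      then have "xmonom w \<in> K" using d by (auto simp: homog_xmonom)
      then have "xvar i * xmonom w \<in> K" using K'(4) i km polys_xvar by blast
      then show ?thesis using K'(4) by (simp add: w xmonom_add xvar_def)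
    qed
    moreover have "(\<Sum>m\<in>A. const (lookup p m) * xmonom m) \<in> K"
      if "\<And>m. m \<in> A \<Longrightarrow> const (lookup p m) * xmonom m \<in> K" for A
      using that by (induction A rule: infinite_finite_induct) (auto intro: K'(2,3))
    ultimately have "(\<Sum>m\<in>keys p. const (lookup p m) * xmonom m) \<in> K" by blast
    then show "p \<in> K" by (simp add: poly_xmonom_sum[symmetric])
  qed
  from \<open>d \<le> e\<close> show ?thesis by (induction e rule: dec_induct) (use d step in blast)+
qed

section \<open>Leading monomials in the reverse lexicographic order\<close>

lemma revlex_irrefl: "\<not> revlex_less s s"
  by (auto simp: revlex_less_def)

lemma revlex_trans:
  assumes "revlex_less s t" "revlex_less t u" shows "revlex_less s u"
proof -
  consider "mdeg s < mdeg u" | "mdeg s = mdeg t" "mdeg t = mdeg u"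
    using assms by (auto simp: revlex_less_def)
  then show ?thesis
  proof cases
    case 2
    then obtain i j where i: "lookup t i < lookup s i" "\<And>k. k > i \<Longrightarrow> lookup s k = lookup t k"
      and j: "lookup u j < lookup t j" "\<And>k. k > j \<Longrightarrow> lookup t k = lookup u k"
      using assms by (auto simp: revlex_less_def)
    have "lookup u (max i j) < lookup s (max i j)"
    proof (cases i j rule: linorder_cases)
      case less
      then show ?thesis using j(1) i(2)[of j] by (simp add: max_def)
    next
      case greater
      then show ?thesis using i(1) j(2)[of i] by (simp add: max_def)
    qed (use i(1) j(1) in simp)
    moreover have "lookup s k = lookup u k" if "k > max i j" for k
      using that i(2)[of k] j(2)[of k] by simp
    ultimately have "\<exists>l. lookup u l < lookup s l \<and> (\<forall>k>l. lookup s k = lookup u k)" by blast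
    then show ?thesis using 2 by (simp add: revlex_less_def)
  qed (simp add: revlex_less_def)
qed

lemma revlex_total: assumes "s \<noteq> t" shows "revlex_less s t \<or> revlex_less t s"
proof (cases "mdeg s = mdeg t")
  case True
  define A where "A = {i. lookup s i \<noteq> lookup t i}"
  have "A \<subseteq> keys s \<union> keys t" by (auto simp: A_def in_keys_iff)
  then have fin: "finite A" by (rule finite_subset) simp
  have "\<exists>i. lookup s i \<noteq> lookup t i" using assms poly_mapping_eqI by metis
  then have "A \<noteq> {}" by (simp add: A_def)
  then have M: "lookup s (Max A) \<noteq> lookup t (Max A)" using Max_in[OF fin] by (auto simp: A_def)
  have up: "lookup s k = lookup t k" if "k > Max A" for k using that Max_ge[OF fin, of k] by (force simp: A_def)
  show ?thesis
  proof (cases "lookup t (Max A) < lookup s (Max A)")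
    case True
    then have "\<exists>l. lookup t l < lookup s l \<and> (\<forall>k>l. lookup s k = lookup t k)" using up by blast
    then have "revlex_less s t" using \<open>mdeg s = mdeg t\<close> by (simp add: revlex_less_def)
    then show ?thesis ..
  next
    case False
    then have "lookup s (Max A) < lookup t (Max A)" using M by simp
    then have "\<exists>l. lookup s l < lookup t l \<and> (\<forall>k>l. lookup t k = lookup s k)" using up by (metis)
    then have "revlex_less t s" using \<open>mdeg s = mdeg t\<close> by (simp add: revlex_less_def)
    then show ?thesis ..
  qed
qed (auto simp: revlex_less_def)

lemma revlex_asym: "revlex_less s t \<Longrightarrow> \<not> revlex_less t s"
  using revlex_trans revlex_irrefl by blast

lemma revlex_add_left: "revlex_less (u + s) (u + t) \<longleftrightarrow> revlex_less s t"
  by (simp add: revlex_less_def lookup_add)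

lemma finite_revlex_max:
  "finite A \<Longrightarrow> A \<noteq> {} \<Longrightarrow> \<exists>m\<in>A. \<forall>m'\<in>A. m' \<noteq> m \<longrightarrow> revlex_less m' m"
proof (induction A rule: finite_ne_induct)
  case (insert x A)
  then obtain m where m: "m \<in> A" "\<And>m'. m' \<in> A \<Longrightarrow> m' \<noteq> m \<Longrightarrow> revlex_less m' m" by blast
  show ?case
  proof (cases "revlex_less m x")
    case True
    then show ?thesis using m revlex_trans by (intro bexI[of _ x]) blast+
  next
    case False
    then have "x \<noteq> m \<longrightarrow> revlex_less x m" using revlex_total by blast
    then show ?thesis using m by (intro bexI[of _ m]) auto
  qed
qed auto

lemma finite_revlex_min:
  "finite A \<Longrightarrow> A \<noteq> {} \<Longrightarrow> \<exists>m\<in>A. \<forall>m'\<in>A. \<not> revlex_less m' m"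
proof (induction A rule: finite_ne_induct)
  case (singleton x)
  then show ?case using revlex_irrefl by auto
next
  case (insert x A)
  then obtain m where m: "m \<in> A" "\<And>m'. m' \<in> A \<Longrightarrow> \<not> revlex_less m' m" by blast
  then show ?case using revlex_trans revlex_irrefl
    by (cases "revlex_less x m") (metis insertCI insertE)+
qed

lemma leading_exists: "p \<noteq> 0 \<Longrightarrow> \<exists>m. is_leading p m"
  using finite_revlex_max[of "keys p"] unfolding is_leading_def by (metis finite_keys keys_eq_empty)

lemma leading_unique: assumes "is_leading p m" "is_leading p m'" shows "m = m'"
proof (rule ccontr)
  assume "m \<noteq> m'"
  then have "revlex_less m' m" "revlex_less m m'" using assms unfolding is_leading_def by auto
  then show False using revlex_asym by simp
qed

lemma leading_xmonom_mult: "is_leading (xmonom u * p) (u + m) \<longleftrightarrow> is_leading p m"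
  by (auto simp: is_leading_def keys_xmonom_times revlex_add_left)

lemma leading_in_mons: "is_leading p m \<Longrightarrow> p \<in> homog n (int d) \<Longrightarrow> m \<in> mons n d"
  by (auto simp: is_leading_def homog_iff)

definition lms :: "'k::field mpoly set \<Rightarrow> (nat \<Rightarrow>\<^sub>0 nat) set" where
  "lms V = {m. \<exists>p\<in>V. is_leading p m}"

definition linear_space :: "'k::field mpoly set \<Rightarrow> bool" where
  "linear_space V \<longleftrightarrow> 0 \<in> V \<and> (\<forall>p\<in>V. \<forall>q\<in>V. p + q \<in> V) \<and> (\<forall>p\<in>V. \<forall>c. const c * p \<in> V)"

lemma linear_spaceD:
  assumes "linear_space V"
  shows "0 \<in> V" "p \<in> V \<Longrightarrow> q \<in> V \<Longrightarrow> p + q \<in> V" "p \<in> V \<Longrightarrow> const c * p \<in> V"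
    "p \<in> V \<Longrightarrow> q \<in> V \<Longrightarrow> p - q \<in> V"
proof -
  show 1: "p \<in> V \<Longrightarrow> q \<in> V \<Longrightarrow> p + q \<in> V" and 2: "p \<in> V \<Longrightarrow> const c * p \<in> V" for p q c
    using assms by (auto simp: linear_space_def)
  show "p \<in> V \<Longrightarrow> q \<in> V \<Longrightarrow> p - q \<in> V"
    using 1[of p "- q"] 2[of q "- 1"] by (simp add: const_uminus)
  show "0 \<in> V" using assms by (simp add: linear_space_def)
qed

lemma linear_space_sum:
  "linear_space V \<Longrightarrow> (\<And>i. i \<in> A \<Longrightarrow> f i \<in> V) \<Longrightarrow> (\<Sum>i\<in>A. f i) \<in> V"
  by (induction A rule: infinite_finite_induct) (auto simp: linear_spaceD)

lemma linear_space_homog: "linear_space (homog n e)"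
  by (auto simp: linear_space_def)

lemma linear_space_Int: "linear_space V \<Longrightarrow> linear_space W \<Longrightarrow> linear_space (V \<inter> W)"
  by (auto simp: linear_space_def)

lemma graded_ideal_linear: "graded_ideal n K \<Longrightarrow> linear_space K"
  using graded_idealD[of n K] by (auto simp: linear_space_def)

lemma lms_subset_mons: "V \<subseteq> homog n (int d) \<Longrightarrow> lms V \<subseteq> mons n d"
  by (auto simp: lms_def intro: leading_in_mons)

lemma finite_lms: assumes "V \<subseteq> homog n (int d)" shows "finite (lms V)"
  by (rule finite_subset[OF lms_subset_mons[OF assms] finite_mons])

lemma lms_mono: "V \<subseteq> W \<Longrightarrow> lms V \<subseteq> lms W"
  by (auto simp: lms_def)

text \<open>An element of \<open>U\<close> outside \<open>V\<close> with smallest leading monomial could be reduced further by an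
  element of \<open>V\<close> with the same leading monomial.\<close>

lemma subset_if_lms_subset:
  assumes U: "linear_space U" "U \<subseteq> homog n (int d)" and V: "linear_space V" "V \<subseteq> U"
    and lms: "lms U \<subseteq> lms V"
  shows "U \<subseteq> V"
proof (rule ccontr)
  assume "\<not> U \<subseteq> V"
  then obtain p0 where p0: "p0 \<in> U - V" by blast
  define A where "A = lms (U - V)"
  have "finite A" unfolding A_def by (rule finite_lms) (use U in blast)
  moreover have "p0 \<noteq> 0" using p0 linear_spaceD(1)[OF V(1)] by blast
  then obtain m0 where "is_leading p0 m0" using leading_exists by blast
  then have "A \<noteq> {}" using p0 by (auto simp: A_def lms_def)
  ultimately obtain m where m: "m \<in> A" "\<And>m'. m' \<in> A \<Longrightarrow> \<not> revlex_less m' m"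
    using finite_revlex_min[of A] by metis
  then obtain p where p: "p \<in> U - V" "is_leading p m" by (auto simp: A_def lms_def)
  then have "m \<in> lms V" using lms by (auto simp: lms_def)
  then obtain q where q: "q \<in> V" "is_leading q m" by (auto simp: lms_def)
  define c where "c = lookup p m / lookup q m"
  define r where "r = p - const c * q"
  have rU: "r \<in> U - V"
  proof -
    have cq: "const c * q \<in> V" using q V(1) linear_spaceD by blast
    have "r \<in> U" unfolding r_def using p cq V U(1) linear_spaceD(4) by blast
    moreover have "r \<notin> V"
    proof
      assume "r \<in> V"
      then have "r + const c * q \<in> V" using cq V(1) linear_spaceD(2) by blast
      then show False using p by (simp add: r_def)
    qed
    ultimately show ?thesis by blast
  qed
  then have "r \<noteq> 0" using linear_spaceD(1)[OF V(1)] by blast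
  then obtain m' where m': "is_leading r m'" using leading_exists by blast
  have "lookup q m \<noteq> 0" using q by (simp add: is_leading_def in_keys_iff)
  then have "lookup r m = 0" by (simp add: r_def lookup_minus lookup_const_times c_def)
  then have "m' \<noteq> m" using m' by (auto simp: is_leading_def in_keys_iff)
  have "keys r \<subseteq> keys p \<union> keys q"
    unfolding r_def by (auto simp: in_keys_iff lookup_minus lookup_const_times)
  then have "revlex_less m' m" using m' p(2) q(2) \<open>m' \<noteq> m\<close> unfolding is_leading_def by blast
  moreover have "m' \<in> A" using rU m' by (auto simp: A_def lms_def)
  ultimately show False using m(2) by blast
qed

subsection \<open>Counting leading monomials by determinants\<close>

lemma det_nonzero_iff:
  fixes M :: "nat \<Rightarrow> nat \<Rightarrow> 'k::field"
  shows "det (mat r r (\<lambda>(i, j). M i j)) \<noteq> 0 \<longleftrightarrow>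
    (\<forall>v. (\<forall>i<r. (\<Sum>j<r. M i j * v j) = 0) \<longrightarrow> (\<forall>j<r. v j = 0))"
proof -
  let ?A = "mat r r (\<lambda>(i, j). M i j)"
  have mv: "?A *\<^sub>v vec r v = 0\<^sub>v r \<longleftrightarrow> (\<forall>i<r. (\<Sum>j<r. M i j * v j) = 0)" for v
    by (auto simp: vec_eq_iff scalar_prod_def atLeast0LessThan)
  have z: "vec r v = 0\<^sub>v r \<longleftrightarrow> (\<forall>j<r. v j = 0)" for v :: "nat \<Rightarrow> 'k"
    by (auto simp: vec_eq_iff)
  have "det ?A = 0 \<longleftrightarrow> (\<exists>w. w \<in> carrier_vec r \<and> w \<noteq> 0\<^sub>v r \<and> ?A *\<^sub>v w = 0\<^sub>v r)"
    by (rule det_0_iff_vec_prod_zero_field) auto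
  also have "\<dots> \<longleftrightarrow> (\<exists>v. vec r v \<noteq> 0\<^sub>v r \<and> ?A *\<^sub>v vec r v = 0\<^sub>v r)"
  proof
    assume "\<exists>w. w \<in> carrier_vec r \<and> w \<noteq> 0\<^sub>v r \<and> ?A *\<^sub>v w = 0\<^sub>v r"
    then obtain w where w: "w \<in> carrier_vec r" "w \<noteq> 0\<^sub>v r" "?A *\<^sub>v w = 0\<^sub>v r" by blast
    have "w = vec r (vec_index w)" using w(1) by (auto simp: vec_eq_iff)
    then show "\<exists>v. vec r v \<noteq> 0\<^sub>v r \<and> ?A *\<^sub>v vec r v = 0\<^sub>v r" using w by metis
  qed (auto intro: exI[of _ "vec r v" for v])
  finally show ?thesis unfolding mv z by blast
qed

text \<open>Fewer equations than unknowns have a nonzero solution: the system is filled up with zero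
  equations, and a square matrix with a zero row has determinant zero.\<close>

lemma underdetermined:
  fixes M :: "nat \<Rightarrow> nat \<Rightarrow> 'k::field"
  assumes "s < r"
  obtains v j where "j < r" "v j \<noteq> 0" "\<And>i. i < s \<Longrightarrow> (\<Sum>j<r. M i j * v j) = 0"
proof -
  define N where "N i j = (if i < s then M i j else 0)" for i j
  let ?A = "mat r r (\<lambda>(i, j). N i j)"
  have "det (mat r r (\<lambda>(i, j). N j i)) = 0"
  proof (rule ccontr)
    assume *: "det (mat r r (\<lambda>(i, j). N j i)) \<noteq> 0"
    have "(\<Sum>j<r. N j i * (if j = s then 1 else 0)) = 0" for i
      by (intro sum.neutral) (auto simp: N_def)
    then show False using *[unfolded det_nonzero_iff, rule_format, of "\<lambda>j. if j = s then 1 else 0" s] assms by simp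
  qed
  moreover have "mat r r (\<lambda>(i, j). N j i) = transpose_mat ?A" by auto
  ultimately have "det ?A = 0" using det_transpose[of ?A r] by simp
  then obtain v j where v: "\<forall>i<r. (\<Sum>j<r. N i j * v j) = 0" "j < r" "v j \<noteq> 0"
    using det_nonzero_iff[of r N] by blast
  show thesis
  proof (rule that[where v = v and j = j, OF v(2,3)])
    fix i assume "i < s"
    then show "(\<Sum>j<r. M i j * v j) = 0" using v(1)[rule_format, of i] assms by (simp add: N_def)
  qed
qed

text \<open>The coefficient matrix is triangular up to reordering. Instead of sorting, the largest
  leading monomial that occurs in a supposed linear relation is considered.\<close>

lemma leading_det_nonzero:
  fixes p :: "nat \<Rightarrow> 'k::field mpoly"
  assumes p: "\<And>j. j < r \<Longrightarrow> is_leading (p j) (m j)" and inj: "inj_on m {..<r}"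
  shows "det (mat r r (\<lambda>(i, j). lookup (p j) (m i))) \<noteq> 0"
  unfolding det_nonzero_iff
proof (intro allI impI, rule ccontr)
  fix v j0 assume v: "\<forall>i<r. (\<Sum>j<r. lookup (p j) (m i) * v j) = 0" and j0: "j0 < r" "v j0 \<noteq> 0"
  define A where "A = m ` {j. j < r \<and> v j \<noteq> 0}"
  have "finite A" "A \<noteq> {}" using j0 by (auto simp: A_def)
  then obtain j where j: "j < r" "v j \<noteq> 0" "\<And>m'. m' \<in> A \<Longrightarrow> m' \<noteq> m j \<Longrightarrow> revlex_less m' (m j)"
    using finite_revlex_max[of A] by (auto simp: A_def)
  have "lookup (p k) (m j) * v k = 0" if k: "k < r" "k \<noteq> j" for k
  proof (rule ccontr)
    assume *: "lookup (p k) (m j) * v k \<noteq> 0"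
    then have mem: "m j \<in> keys (p k)" "m k \<in> A" using k by (auto simp: in_keys_iff A_def)
    have "m k \<noteq> m j" using inj k j(1) by (auto simp: inj_on_def)
    then show False using mem p[OF k(1)] j(3)[of "m k"] revlex_asym unfolding is_leading_def by metis
  qed
  then have "(\<Sum>k<r. lookup (p k) (m j) * v k) = (\<Sum>k\<in>{j}. lookup (p k) (m j) * v k)"
    using j(1) by (intro sum.mono_neutral_right) auto
  then show False using v j p[OF j(1)] by (auto simp: is_leading_def in_keys_iff)
qed

text \<open>The projections to the coordinates in such sets detect leading monomials: if \<open>F\<close> contains
  some monomial of a form, then it contains the leading one.\<close>

definition upset :: "nat \<Rightarrow> nat \<Rightarrow> (nat \<Rightarrow>\<^sub>0 nat) set \<Rightarrow> bool" where
  "upset n d F \<longleftrightarrow> F \<subseteq> mons n d \<and> (\<forall>m\<in>F. \<forall>m'\<in>mons n d. revlex_less m m' \<longrightarrow> m' \<in> F)"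

lemma upset_mons: "upset n d (mons n d)"
  by (simp add: upset_def)

text \<open>If there were fewer than \<open>r\<close> leading monomials in \<open>F\<close>, some nonzero combination of the \<open>q\<^sub>j\<close>
  would have coefficient zero at all of them. By the determinant it has a nonzero coefficient in
  \<open>F\<close>, so its own leading monomial would be in \<open>F\<close>.\<close>

lemma card_lms_ge:
  fixes q :: "nat \<Rightarrow> 'k::field mpoly"
  assumes V: "linear_space V" "V \<subseteq> homog n (int d)" and F: "upset n d F"
    and q: "\<And>j. j < r \<Longrightarrow> q j \<in> V" and m: "\<And>i. i < r \<Longrightarrow> m i \<in> F"
    and det: "det (mat r r (\<lambda>(i, j). lookup (q j) (m i))) \<noteq> 0"
  shows "r \<le> card (lms V \<inter> F)"
proof (rule ccontr)
  assume less: "\<not> r \<le> card (lms V \<inter> F)"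
  define s where "s = card (lms V \<inter> F)"
  have "finite (lms V \<inter> F)" using finite_lms[OF V(2)] by simp
  then obtain e where e: "bij_betw e {..<s} (lms V \<inter> F)"
    using ex_bij_betw_nat_finite by (metis s_def atLeast0LessThan)
  have "s < r" using less by (simp add: s_def)
  then obtain v j where v: "j < r" "v j \<noteq> 0" "\<And>i. i < s \<Longrightarrow> (\<Sum>j<r. lookup (q j) (e i) * v j) = 0"
    using underdetermined[of s r "\<lambda>i j. lookup (q j) (e i)"] by metis
  define w where "w = (\<Sum>j<r. const (v j) * q j)"
  have lw: "lookup w a = (\<Sum>j<r. lookup (q j) a * v j)" for a
    unfolding w_def lookup_sum lookup_const_times by (simp add: mult.commute)
  have wV: "w \<in> V" unfolding w_def using V(1) q by (intro linear_space_sum) (auto intro: linear_spaceD)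
  obtain i where i: "i < r" "lookup w (m i) \<noteq> 0"
    using det v(1,2) unfolding det_nonzero_iff lw by blast
  then have "w \<noteq> 0" by auto
  then obtain a where a: "is_leading w a" using leading_exists by blast
  then have am: "a \<in> mons n d" using leading_in_mons wV V(2) by blast
  have "m i \<in> keys w" using i by (simp add: in_keys_iff)
  then have "a \<in> F" using a am m[OF i(1)] F unfolding is_leading_def upset_def by metis
  then have "a \<in> e ` {..<s}" using a wV e by (auto simp: bij_betw_def lms_def)
  then have "lookup w a = 0" using v(3) by (auto simp: lw)
  then show False using a by (auto simp: is_leading_def in_keys_iff)
qed

text \<open>The witnesses turn the number of leading monomials into a nonzero determinant of
  coefficients, and that is an open condition on the coordinates.\<close>

lemma card_lms_witness:
  fixes V :: "'k::field mpoly set"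
  assumes V: "V \<subseteq> homog n (int d)" and r: "r = card (lms V \<inter> F)"
  obtains q m where "\<And>j. j < r \<Longrightarrow> q j \<in> V" "\<And>j. j < r \<Longrightarrow> is_leading (q j) (m j)"
    "m ` {..<r} = lms V \<inter> F" "inj_on m {..<r}"
proof -
  have "finite (lms V \<inter> F)" using finite_lms[OF V] by simp
  then obtain m where m: "bij_betw m {..<r} (lms V \<inter> F)"
    using ex_bij_betw_nat_finite by (metis r atLeast0LessThan)
  then have "\<forall>j<r. \<exists>p\<in>V. is_leading p (m j)" by (auto simp: bij_betw_def lms_def)
  then obtain q where "\<forall>j<r. q j \<in> V \<and> is_leading (q j) (m j)" by metis
  then show thesis using m by (intro that[of q m]) (auto simp: bij_betw_def)
qed

text \<open>The number of leading monomials is the dimension, which an injective linear map does not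
  decrease.\<close>

lemma card_lms_injective_le:
  fixes V W :: "'k::field mpoly set"
  assumes V: "linear_space V" "V \<subseteq> homog n (int d)" and W: "linear_space W" "W \<subseteq> homog n (int d)"
    and \<phi>: "\<And>p. p \<in> V \<Longrightarrow> \<phi> p \<in> W" "\<And>p. p \<in> V \<Longrightarrow> \<phi> p = 0 \<Longrightarrow> p = 0"
    and sum: "\<And>r c (q :: nat \<Rightarrow> 'k mpoly). \<phi> (\<Sum>j<(r::nat). const (c j) * q j) = (\<Sum>j<r. const (c j) * \<phi> (q j))"
  shows "card (lms V) \<le> card (lms W)"
proof (rule ccontr)
  assume less: "\<not> card (lms V) \<le> card (lms W)"
  define r where "r = card (lms V \<inter> UNIV)"
  obtain q m where q: "\<And>j. j < r \<Longrightarrow> q j \<in> V" "\<And>j. j < r \<Longrightarrow> is_leading (q j) (m j)" "inj_on m {..<r}"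
    using card_lms_witness[OF V(2) r_def] by metis
  define s where "s = card (lms W)"
  obtain e where e: "bij_betw e {..<s} (lms W)"
    using ex_bij_betw_nat_finite[OF finite_lms[OF W(2)]] by (metis s_def atLeast0LessThan)
  have "s < r" using less by (simp add: s_def r_def)
  then obtain v j where v: "j < r" "v j \<noteq> 0" "\<And>i. i < s \<Longrightarrow> (\<Sum>j<r. lookup (\<phi> (q j)) (e i) * v j) = 0"
    using underdetermined[of s r "\<lambda>i j. lookup (\<phi> (q j)) (e i)"] by metis
  define u where "u = (\<Sum>j<r. const (v j) * q j)"
  have uV: "u \<in> V" unfolding u_def using V(1) q by (intro linear_space_sum) (auto intro: linear_spaceD)
  have \<phi>u: "lookup (\<phi> u) a = (\<Sum>j<r. lookup (\<phi> (q j)) a * v j)" for a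
    unfolding u_def sum lookup_sum lookup_const_times by (simp add: mult.commute)
  have "\<phi> u = 0"
  proof (rule ccontr)
    assume "\<phi> u \<noteq> 0"
    then obtain a where a: "is_leading (\<phi> u) a" using leading_exists by blast
    then have "a \<in> e ` {..<s}" using \<phi>(1)[OF uV] e by (auto simp: bij_betw_def lms_def)
    then have "lookup (\<phi> u) a = 0" using v(3) by (auto simp: \<phi>u)
    then show False using a by (auto simp: is_leading_def in_keys_iff)
  qed
  then have "u = 0" using \<phi>(2) uV by blast
  moreover have "lookup u a = (\<Sum>j<r. lookup (q j) a * v j)" for a
    unfolding u_def lookup_sum lookup_const_times by (simp add: mult.commute)
  ultimately have "(\<Sum>j<r. lookup (q j) (m i) * v j) = 0" for i
    by (metis lookup_zero)
  then show False using leading_det_nonzero[OF q(2,3)] v(1,2) unfolding det_nonzero_iff by blast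
qed

section \<open>General coordinates\<close>

text \<open>For an ideal that contains the homogeneous components of its elements, these are the
  monomials of degree \<open>d\<close> of the initial ideal.\<close>

definition lm_deg :: "nat \<Rightarrow> 'k::field mpoly set \<Rightarrow> nat \<Rightarrow> (nat \<Rightarrow>\<^sub>0 nat) set" where
  "lm_deg n K d = lms (K \<inter> homog n (int d))"

lemma lm_deg_subset: "lm_deg n K d \<subseteq> mons n d"
  unfolding lm_deg_def by (rule lms_subset_mons) simp

lemma finite_lm_deg [simp]: "finite (lm_deg n K d)"
  by (rule finite_subset[OF lm_deg_subset finite_mons])

text \<open>The given coordinates are at least as good as all others, for all ranks of projections at
  once.\<close>

definition general_coords :: "nat \<Rightarrow> 'k::field mpoly set \<Rightarrow> bool" where
  "general_coords n K \<longleftrightarrow> (\<forall>h\<in>general_linear n. \<forall>d F. upset n d F \<longrightarrow>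
     card (lm_deg n (gl_act n h ` K) d \<inter> F) \<le> card (lm_deg n K d \<inter> F))"

lemma gl_act_graded_ideal:
  assumes K: "graded_ideal n K" and g: "g \<in> general_linear n"
  shows "graded_ideal n (gl_act n g ` K)"
proof -
  obtain h where h: "h \<in> general_linear n" "h * g = 1\<^sub>m n" "g * h = 1\<^sub>m n"
    using general_linear_inverse[OF g] .
  note K' = graded_idealD[OF K]
  have mult: "r * gl_act n g p \<in> gl_act n g ` K" if r: "r \<in> polys {1..n}" and p: "p \<in> K" for r p
  proof -
    have "r * gl_act n g p = gl_act n g (gl_act n h r * p)"
      using gl_act_inverse[OF h(1) g h(3) r] by (simp add: gl_act_mult)
    then show ?thesis using K'(4)[OF gl_act_polys[OF r] p] by blast
  qed
  have part: "hpart d (gl_act n g p) \<in> gl_act n g ` K" if "p \<in> K" for d p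
    using that K'(1,5) by (subst gl_act_hpart[symmetric]) auto
  show ?thesis
    unfolding graded_ideal_def
  proof (intro conjI ballI allI)
    show "gl_act n g ` K \<subseteq> polys {1..n}" using K'(1) gl_act_polys by blast
    show "0 \<in> gl_act n g ` K" by (rule image_eqI[OF _ K'(2)]) simp
    show "p + q \<in> gl_act n g ` K" if pq: "p \<in> gl_act n g ` K" "q \<in> gl_act n g ` K" for p q
    proof -
      obtain p' q' where "p' \<in> K" "q' \<in> K" "p = gl_act n g p'" "q = gl_act n g q'" using pq by blast
      then show ?thesis using K'(3)[of p' q'] by (auto simp: gl_act_add[symmetric])
    qed
  qed (use mult part in auto)
qed

lemma gl_act_Int_homog:
  assumes K: "graded_ideal n K" and g: "g \<in> general_linear n"
  shows "gl_act n g ` K \<inter> homog n e = gl_act n g ` (K \<inter> homog n e)"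
proof
  obtain h where h: "h \<in> general_linear n" "h * g = 1\<^sub>m n" using general_linear_inverse[OF g] .
  show "gl_act n g ` K \<inter> homog n e \<subseteq> gl_act n g ` (K \<inter> homog n e)"
  proof
    fix q assume "q \<in> gl_act n g ` K \<inter> homog n e"
    then obtain p where p: "p \<in> K" "q = gl_act n g p" "q \<in> homog n e" by blast
    then have "gl_act n h q = p" using gl_act_inverse[OF g h] graded_idealD(1)[OF K] by blast
    then have "p \<in> homog n e" using gl_act_homog[OF p(3)] by metis
    then show "q \<in> gl_act n g ` (K \<inter> homog n e)" using p by blast
  qed
qed (auto intro: gl_act_homog)

lemma gl_act_image_times:
  assumes "K \<subseteq> polys {1..n}" "g \<in> general_linear n" "h \<in> general_linear n"
  shows "gl_act n h ` gl_act n g ` K = gl_act n (h * g) ` K"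
  unfolding image_image using assms
  by (intro image_cong refl gl_act_times) (auto simp: general_linear_iff)

lemma linear_space_deg: "graded_ideal n K \<Longrightarrow> linear_space (K \<inter> homog n e)"
  by (intro linear_space_Int graded_ideal_linear linear_space_homog)

text \<open>Both numbers are the dimension of the component of degree \<open>d\<close>.\<close>

lemma card_lm_deg_gl_act:
  assumes K: "graded_ideal n K" and g: "g \<in> general_linear n"
  shows "card (lm_deg n (gl_act n g ` K) d) = card (lm_deg n K d)"
proof -
  have le: "card (lm_deg n K d) \<le> card (lm_deg n (gl_act n g ` K) d)"
    if K: "graded_ideal n K" and g: "g \<in> general_linear n" for K :: "'a mpoly set" and g
    unfolding lm_deg_def
  proof (rule card_lms_injective_le[of _ n d])
    show "linear_space (K \<inter> homog n (int d))" "linear_space (gl_act n g ` K \<inter> homog n (int d))"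
      using K g gl_act_graded_ideal linear_space_deg by blast+
    show "gl_act n g p \<in> gl_act n g ` K \<inter> homog n (int d)" if "p \<in> K \<inter> homog n (int d)" for p
      using that gl_act_homog by blast
    show "p = 0" if p: "p \<in> K \<inter> homog n (int d)" and 0: "gl_act n g p = 0" for p
    proof -
      obtain h where "h \<in> general_linear n" "h * g = 1\<^sub>m n" using general_linear_inverse[OF g] .
      then show ?thesis using gl_act_inverse[OF g] p homog_polys 0 by (metis IntE gl_act_0)
    qed
  qed (auto simp: gl_act_sum gl_act_mult gl_act_const)
  obtain h where h: "h \<in> general_linear n" "h * g = 1\<^sub>m n" using general_linear_inverse[OF g] .
  have "gl_act n h ` gl_act n g ` K = K"
  proof -
    have "gl_act n h (gl_act n g p) = p" if "p \<in> K" for p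
      by (rule gl_act_inverse[OF g h]) (use that graded_idealD(1)[OF K] in blast)
    then show ?thesis unfolding image_image by simp
  qed
  then show ?thesis using le[OF K g] le[OF gl_act_graded_ideal[OF K g] h(1)] by simp
qed

text \<open>For each degree \<open>d < D\<close> and each upward closed \<open>F\<close>, a determinant that is nonzero at a
  matrix with the maximal number of leading monomials defines an open set on which the maximum is
  attained. The intersection of these finitely many open sets is nonempty because the general
  linear group is irreducible. In degrees \<open>d \<ge> D\<close> the numbers are the same in all coordinates.\<close>

lemma general_coords_exist:
  fixes I :: "'k::field_char_0 mpoly set"
  assumes I: "graded_ideal n I" and D: "\<And>d. d \<ge> D \<Longrightarrow> homog n (int d) \<subseteq> I"
  obtains U where "U \<noteq> {}" "zariski_open_in (general_linear n) ({0..<n} \<times> {0..<n}) mat_coord U"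
    "\<And>g. g \<in> U \<Longrightarrow> general_coords n (gl_act n g ` I)"
proof -
  let ?GL = "general_linear n :: 'k mat set" and ?X = "{0..<n} \<times> {0..<n}"
  define N where "N g d F = card (lm_deg n (gl_act n g ` I) d \<inter> F)" for g d F
  define C where "C = (SIGMA d:{..<D}. {F. upset n d F})"
  have finC: "finite C"
  proof -
    have "{F. upset n d F} \<subseteq> Pow (mons n d)" for d by (auto simp: upset_def)
    then have "finite {F. upset n d F}" for d by (rule finite_subset) simp
    then show ?thesis unfolding C_def by (intro finite_SigmaI) auto
  qed
  interpret reg: function_algebra "regular ?X mat_coord" by (rule regular_algebra)
  have ex: "\<exists>f\<in>regular ?X mat_coord. (\<exists>g\<in>?GL. f g \<noteq> 0) \<and>
      (\<forall>g\<in>?GL. f g \<noteq> 0 \<longrightarrow> (\<forall>h\<in>?GL. N h (fst c) (snd c) \<le> N g (fst c) (snd c)))" if c: "c \<in> C" for c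
  proof -
    obtain d F where dF: "c = (d, F)" "upset n d F" using c by (auto simp: C_def)
    have bound: "N g d F \<le> card (mons n d)" for g
      unfolding N_def by (rule card_mono) (use lm_deg_subset in auto)
    define r where "r = Max ((\<lambda>g. N g d F) ` ?GL)"
    have fin: "finite ((\<lambda>g. N g d F) ` ?GL)" 
      by (rule finite_subset[of _ "{..card (mons n d)}"]) (use bound in auto)
    have "r \<in> (\<lambda>g. N g d F) ` ?GL" unfolding r_def
      by (rule Max_in[OF fin]) (use general_linear_one in blast)
    then obtain g0 where g0: "g0 \<in> ?GL" "r = N g0 d F" by blast
    have max: "N h d F \<le> r" if "h \<in> ?GL" for h unfolding r_def using fin that by (intro Max_ge) auto
    have r: "r = card (lms (gl_act n g0 ` I \<inter> homog n (int d)) \<inter> F)"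
      using g0(2) by (simp add: N_def lm_deg_def)
    obtain p m where p: "\<And>j. j < r \<Longrightarrow> p j \<in> gl_act n g0 ` I \<inter> homog n (int d)"
      "\<And>j. j < r \<Longrightarrow> is_leading (p j) (m j)" "m ` {..<r} = lms (gl_act n g0 ` I \<inter> homog n (int d)) \<inter> F" "inj_on m {..<r}"
      using card_lms_witness[OF Int_lower2 r] by metis
    have "\<forall>j<r. \<exists>q\<in>I \<inter> homog n (int d). p j = gl_act n g0 q"
      using p(1) gl_act_Int_homog[OF I g0(1)] by blast
    then obtain q where q: "\<And>j. j < r \<Longrightarrow> q j \<in> I \<inter> homog n (int d)" "\<And>j. j < r \<Longrightarrow> p j = gl_act n g0 (q j)"
      by metis
    define f where "f g = det (mat r r (\<lambda>(i, j). lookup (gl_act n g (q j)) (m i)))" for g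
    have "f \<in> regular ?X mat_coord" unfolding f_def
    proof (rule reg.det_mem)
      fix i j assume "i < r" "j < r"
      then have qj: "q j \<in> polys {1..n}" using q(1) homog_polys by blast
      have "(\<lambda>y :: 'k mat. y $$ (a, b)) \<in> regular ?X mat_coord" if "a < n" "b < n" for a b
        using regular_coord[of "(a, b)" ?X mat_coord] that by simp
      then have "reg.family (\<lambda>g. gl_act n g (q j))" by (rule reg.family_gl_act[OF _ qj])
      then show "(\<lambda>g. lookup (gl_act n g (q j)) (m i)) \<in> regular ?X mat_coord" by (rule reg.family_coeff)
    qed
    moreover have "f g0 \<noteq> 0"
    proof -
      have "f g0 = det (mat r r (\<lambda>(i, j). lookup (p j) (m i)))"
        unfolding f_def by (rule arg_cong[of _ _ det]) (auto simp: q(2))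
      then show ?thesis using leading_det_nonzero[OF p(2,4)] by simp
    qed
    moreover have "N h d F \<le> N g d F" if "g \<in> ?GL" "f g \<noteq> 0" "h \<in> ?GL" for g h
    proof -
      have "r \<le> card (lms (gl_act n g ` I \<inter> homog n (int d)) \<inter> F)"
      proof (rule card_lms_ge[of _ n d F r "\<lambda>j. gl_act n g (q j)" m])
        show "linear_space (gl_act n g ` I \<inter> homog n (int d))"
          using linear_space_deg gl_act_graded_ideal I that(1) by blast
        show "gl_act n g (q j) \<in> gl_act n g ` I \<inter> homog n (int d)" if "j < r" for j
          using q(1)[OF that] gl_act_homog by blast
        show "m i \<in> F" if "i < r" for i using p(3) that by blast
      qed (use dF that(2) in \<open>auto simp: f_def\<close>)
      then show ?thesis using max[OF that(3)] by (simp add: N_def lm_deg_def)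
    qed
    ultimately show ?thesis using g0(1) by (intro bexI[of _ f]) (auto simp: dF)
  qed
  then have "\<forall>c\<in>C. \<exists>f. f \<in> regular ?X mat_coord \<and> (\<exists>g\<in>?GL. f g \<noteq> 0) \<and>
      (\<forall>g\<in>?GL. f g \<noteq> 0 \<longrightarrow> (\<forall>h\<in>?GL. N h (fst c) (snd c) \<le> N g (fst c) (snd c)))"
    unfolding Bex_def by (intro ballI)
  from bchoice[OF this] obtain f where "\<forall>c\<in>C. f c \<in> regular ?X mat_coord \<and> (\<exists>g\<in>?GL. f c g \<noteq> 0) \<and>
      (\<forall>g\<in>?GL. f c g \<noteq> 0 \<longrightarrow> (\<forall>h\<in>?GL. N h (fst c) (snd c) \<le> N g (fst c) (snd c)))"
    by (elim exE)
  then have f: "\<And>c. c \<in> C \<Longrightarrow> f c \<in> regular ?X mat_coord" "\<And>c. c \<in> C \<Longrightarrow> \<exists>g\<in>?GL. f c g \<noteq> 0"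
    "\<And>c g h. c \<in> C \<Longrightarrow> g \<in> ?GL \<Longrightarrow> f c g \<noteq> 0 \<Longrightarrow> h \<in> ?GL \<Longrightarrow> N h (fst c) (snd c) \<le> N g (fst c) (snd c)"
    by simp_all
  define P where "P g = (\<Prod>c\<in>C. f c g)" for g
  have P: "P \<in> regular ?X mat_coord" unfolding P_def by (rule reg.prod_mem) (rule f(1))
  have "\<exists>g\<in>?GL. P g \<noteq> 0" unfolding P_def
    by (rule finite_nonzero_point[OF curve_connected_general_linear _ finC f(1,2)])
      (use general_linear_one in blast)
  then have ne: "{g \<in> ?GL. P g \<noteq> 0} \<noteq> {}" by blast
  show thesis
  proof (rule that[OF ne zariski_open_nonzero[OF P]])
    fix g assume "g \<in> {g \<in> ?GL. P g \<noteq> 0}"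
    then have g: "g \<in> ?GL" "P g \<noteq> 0" by auto
    have le: "N h d F \<le> N g d F" if h: "h \<in> ?GL" and F: "upset n d F" for h d F
    proof (cases "d < D")
      case True
      then have "(d, F) \<in> C" using F by (simp add: C_def)
      then show ?thesis using f(3)[of "(d, F)" g h] g h finC by (auto simp: P_def)
    next
      case False
      have "gl_act n a ` I \<inter> homog n (int d) = homog n (int d)" if a: "a \<in> ?GL" for a
      proof -
        obtain b where b: "b \<in> ?GL" "b * a = 1\<^sub>m n" "a * b = 1\<^sub>m n" using general_linear_inverse[OF a] .
        have "p \<in> gl_act n a ` I" if p: "p \<in> homog n (int d)" for p
          using gl_act_inverse[OF b(1) a b(3) homog_polys[OF p]] gl_act_homog[OF p, of b] D[of d] False
          by (metis imageI linorder_not_le subsetD)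
        then show ?thesis by blast
      qed
      then show ?thesis using g h by (simp add: N_def lm_deg_def)
    qed
    show "general_coords n (gl_act n g ` I)"
      unfolding general_coords_def
    proof (intro ballI allI impI)
      fix h :: "'k mat" and d F assume h: "h \<in> ?GL" and F: "upset n d F"
      show "card (lm_deg n (gl_act n h ` gl_act n g ` I) d \<inter> F) \<le> card (lm_deg n (gl_act n g ` I) d \<inter> F)"
        using le[OF general_linear_times[OF h g(1)] F] gl_act_image_times[OF graded_idealD(1)[OF I] g(1) h]
        by (simp add: N_def)
    qed
  qed
qed

section \<open>The generic initial ideal\<close>

definition monomial_ideal :: "nat \<Rightarrow> (nat \<Rightarrow>\<^sub>0 nat) set \<Rightarrow> 'k::field mpoly set" where
  "monomial_ideal n M = {p \<in> polys {1..n}. keys p \<subseteq> M}"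

lemma lms_graded:
  assumes K: "graded_ideal n K"
  shows "m \<in> lms K \<longleftrightarrow> m \<in> lm_deg n K (mdeg m)"
proof
  assume "m \<in> lms K"
  then obtain p where p: "p \<in> K" "is_leading p m" by (auto simp: lms_def)
  have "is_leading (hpart (mdeg m) p) m"
    using p(2) by (auto simp: is_leading_def hpart_def keys_pick)
  moreover have "hpart (mdeg m) p \<in> K \<inter> homog n (int (mdeg m))"
    using p(1) graded_idealD(1,5)[OF K] by blast
  ultimately show "m \<in> lm_deg n K (mdeg m)" by (auto simp: lm_deg_def lms_def)
qed (auto simp: lm_deg_def lms_def)

lemma lms_keys: "graded_ideal n K \<Longrightarrow> m \<in> lms K \<Longrightarrow> keys m \<subseteq> {1..n}"
  using lm_deg_subset[of n K "mdeg m"] lms_graded[of n K m] by (auto simp: mons_def)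

lemma lms_add:
  assumes K: "graded_ideal n K" and "m \<in> lms K" "keys u \<subseteq> {1..n}"
  shows "u + m \<in> lms K"
proof -
  obtain p where p: "p \<in> K" "is_leading p m" using assms by (auto simp: lms_def)
  have "xmonom u * p \<in> K" using graded_idealD(4)[OF K] p assms(3) by (simp add: polys_xmonom)
  then show ?thesis using p(2) leading_xmonom_mult unfolding lms_def by blast
qed

lemma monomial_ideal_ideal:
  assumes "\<And>m u. m \<in> M \<Longrightarrow> keys u \<subseteq> {1..n} \<Longrightarrow> u + m \<in> M"
  shows "ideal (monomial_ideal n M :: 'k::field mpoly set) (poly_ring n)"
proof (rule ideal_polyI)
  fix r p :: "'k mpoly" assume r: "r \<in> polys {1..n}" "p \<in> monomial_ideal n M"
  have "m \<in> M" if m: "m \<in> keys (r * p)" for m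
  proof -
    obtain a b where "a \<in> keys r" "b \<in> keys p" "m = a + b" using keys_mult_nat[OF m] by blast
    then show ?thesis using r assms[of b a] by (auto simp: monomial_ideal_def polys_def)
  qed
  then show "r * p \<in> monomial_ideal n M" using r by (auto simp: monomial_ideal_def)
next
  fix p q :: "'k mpoly" assume "p \<in> monomial_ideal n M" "q \<in> monomial_ideal n M"
  then show "p + q \<in> monomial_ideal n M"
    using keys_add[of p q] by (auto simp: monomial_ideal_def)
qed (auto simp: monomial_ideal_def)

lemma initial_ideal_eq:
  assumes K: "graded_ideal n K"
  shows "initial_ideal n K = monomial_ideal n (lms K)"
proof
  interpret cring "poly_ring n :: 'a mpoly ring" by (rule cring_poly_ring)
  define S :: "'a mpoly set" where "S = {xmonom m | m. \<exists>p\<in>K. is_leading p m}"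
  have sub: "S \<subseteq> monomial_ideal n (lms K)"
  proof
    fix x assume "x \<in> S"
    then obtain m where m: "x = xmonom m" "m \<in> lms K" by (auto simp: S_def lms_def)
    then show "x \<in> monomial_ideal n (lms K)" using lms_keys[OF K m(2)] by (simp add: monomial_ideal_def polys_xmonom)
  qed
  have "ideal (monomial_ideal n (lms K)) (poly_ring n)"
    by (rule monomial_ideal_ideal) (rule lms_add[OF K])
  then show "initial_ideal n K \<subseteq> monomial_ideal n (lms K)"
    unfolding initial_ideal_def S_def[symmetric] using sub by (rule genideal_minimal)
  have SR: "S \<subseteq> carrier (poly_ring n)" using sub by (auto simp: monomial_ideal_def)
  have id: "ideal (initial_ideal n K) (poly_ring n)" and S_in: "S \<subseteq> initial_ideal n K"
    unfolding initial_ideal_def S_def[symmetric]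
    using genideal_ideal[OF SR] genideal_self[OF SR] by auto
  note J = idealD_poly[OF id]
  show "monomial_ideal n (lms K) \<subseteq> initial_ideal n K"
  proof
    fix p :: "'a mpoly" assume p: "p \<in> monomial_ideal n (lms K)"
    have "const (lookup p m) * xmonom m \<in> initial_ideal n K" if "m \<in> keys p" for m
    proof (rule J(4)[OF polys_const])
      have "m \<in> lms K" using that p by (auto simp: monomial_ideal_def)
      then have "xmonom m \<in> S" by (auto simp: S_def lms_def)
      then show "xmonom m \<in> initial_ideal n K" using S_in by blast
    qed
    moreover have "(\<Sum>m\<in>A. const (lookup p m) * xmonom m) \<in> initial_ideal n K"
      if "\<And>m. m \<in> A \<Longrightarrow> const (lookup p m) * xmonom m \<in> initial_ideal n K" for A
      using that by (induction A rule: infinite_finite_induct) (auto intro: J(2,3))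
    ultimately have "(\<Sum>m\<in>keys p. const (lookup p m) * xmonom m) \<in> initial_ideal n K" by blast
    then show "p \<in> initial_ideal n K" by (simp add: poly_xmonom_sum[symmetric])
  qed
qed

text \<open>A set of monomials of degree \<open>d\<close> is recovered from the sizes of its intersections with the
  upward closed sets of monomials \<open>\<ge> m\<close> and \<open>> m\<close>, and these are the sizes that general
  coordinates maximise.\<close>

lemma general_coords_lms_unique:
  assumes K: "graded_ideal n K" and h: "h \<in> general_linear n"
    and gc: "general_coords n K" "general_coords n (gl_act n h ` K)"
  shows "lms (gl_act n h ` K) = lms K"
proof -
  let ?K = "gl_act n h ` K"
  obtain h' where h': "h' \<in> general_linear n" "h' * h = 1\<^sub>m n" using general_linear_inverse[OF h] .
  have inverse: "gl_act n h' ` ?K = K"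
  proof -
    have "gl_act n h' (gl_act n h p) = p" if "p \<in> K" for p
      by (rule gl_act_inverse[OF h h']) (use that graded_idealD(1)[OF K] in blast)
    then show ?thesis unfolding image_image by simp
  qed
  have eq: "card (lm_deg n ?K d \<inter> F) = card (lm_deg n K d \<inter> F)" if "upset n d F" for d F
    using gc h h'(1) that inverse unfolding general_coords_def by (metis le_antisym)
  have "lm_deg n ?K d = lm_deg n K d" for d
  proof -
    have *: "m \<in> lm_deg n A d \<longleftrightarrow> card (lm_deg n A d \<inter> (insert m {m'\<in>mons n d. revlex_less m m'}))
        = Suc (card (lm_deg n A d \<inter> {m'\<in>mons n d. revlex_less m m'}))"
      if "m \<in> mons n d" for m and A :: "'a mpoly set"
    proof (cases "m \<in> lm_deg n A d")
      case True
      then show ?thesis using revlex_irrefl[of m] by simp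
    qed simp
    have up: "upset n d {m'\<in>mons n d. revlex_less m m'}" "upset n d (insert m {m'\<in>mons n d. revlex_less m m'})"
      if "m \<in> mons n d" for m
      using that revlex_trans unfolding upset_def by blast+
    have "m \<in> lm_deg n ?K d \<longleftrightarrow> m \<in> lm_deg n K d" if m: "m \<in> mons n d" for m
      unfolding *[OF m] eq[OF up(1)[OF m]] eq[OF up(2)[OF m]] by (rule refl)
    then show ?thesis using lm_deg_subset by blast
  qed
  then show ?thesis using lms_graded[OF K] lms_graded[OF gl_act_graded_ideal[OF K h]] by blast
qed

text \<open>All general coordinates give the same leading monomials. Any two nonempty open sets meet, so
  no other value is attained on an open set.\<close>

lemma gin_eq_initial:
  fixes I :: "'k::field_char_0 mpoly set"
  assumes I: "graded_ideal n I" and D: "\<And>d. d \<ge> D \<Longrightarrow> homog n (int d) \<subseteq> I"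
  obtains g where "g \<in> general_linear n" "general_coords n (gl_act n g ` I)"
    "gin n I = monomial_ideal n (lms (gl_act n g ` I))"
proof -
  let ?X = "{0..<n} \<times> {0..<n}"
  obtain U where U: "U \<noteq> {}" "zariski_open_in (general_linear n) ?X mat_coord U"
    "\<And>g. g \<in> U \<Longrightarrow> general_coords n (gl_act n g ` I)"
    using general_coords_exist[OF I D] by metis
  have UG: "U \<subseteq> general_linear n" using U(2) by (auto simp: zariski_open_in_def)
  obtain g where g: "g \<in> U" using U(1) by blast
  have const: "initial_ideal n (gl_act n g' ` I) = initial_ideal n (gl_act n g ` I)" if g': "g' \<in> U" for g'
  proof -
    have gG: "g \<in> general_linear n" "g' \<in> general_linear n" using g g' UG by auto
    obtain h where h: "h \<in> general_linear n" "h * g = 1\<^sub>m n" using general_linear_inverse[OF gG(1)] .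
    have hg: "g' * h \<in> general_linear n" using general_linear_times gG(2) h(1) by blast
    have carr: "g \<in> carrier_mat n n" "g' \<in> carrier_mat n n" "h \<in> carrier_mat n n"
      using gG h(1) by (auto simp: general_linear_iff)
    have "g' * h * g = g'" using h(2) carr assoc_mult_mat[OF carr(2,3,1)] by simp
    then have *: "gl_act n (g' * h) ` gl_act n g ` I = gl_act n g' ` I"
      using gl_act_image_times[OF graded_idealD(1)[OF I] gG(1) hg] by simp
    have K: "graded_ideal n (gl_act n g ` I)" "graded_ideal n (gl_act n g' ` I)"
      using gl_act_graded_ideal I gG by blast+
    have "lms (gl_act n g' ` I) = lms (gl_act n g ` I)"
      using general_coords_lms_unique[OF K(1) hg U(3)[OF g]] U(3)[OF g'] unfolding * by blast
    then show ?thesis by (simp add: initial_ideal_eq K)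
  qed
  have "gin n I = initial_ideal n (gl_act n g ` I)"
    unfolding gin_def
  proof (rule the_equality)
    show "\<exists>U. U \<noteq> {} \<and> zariski_open_in (general_linear n) ?X mat_coord U \<and>
        (\<forall>g'\<in>U. initial_ideal n (gl_act n g' ` I) = initial_ideal n (gl_act n g ` I))"
      using U(1,2) const by blast
    fix J assume "\<exists>U. U \<noteq> {} \<and> zariski_open_in (general_linear n) ?X mat_coord U \<and>
        (\<forall>g'\<in>U. initial_ideal n (gl_act n g' ` I) = J)"
    then obtain V where V: "V \<noteq> {}" "zariski_open_in (general_linear n) ?X mat_coord V"
      "\<And>g'. g' \<in> V \<Longrightarrow> initial_ideal n (gl_act n g' ` I) = J" by blast
    obtain y where "y \<in> U" "y \<in> V"
      using zariski_open_meet[OF curve_connected_general_linear U(2) V(2) U(1) V(1)] by metis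
    then show "J = initial_ideal n (gl_act n g ` I)" using V(3) const by metis
  qed
  then show thesis using that[of g] g UG U(3) initial_ideal_eq gl_act_graded_ideal[OF I] by blast
qed

section \<open>General linear forms and the last variable\<close>

text \<open>The identity matrix with column \<open>k\<close> replaced by \<open>v\<close>: it substitutes a linear form for \<open>x\<^sub>k\<close>
  and fixes the other variables. The entries of matrices are numbered from \<open>0\<close>, the variables from
  \<open>1\<close>.\<close>

definition colmat :: "nat \<Rightarrow> nat \<Rightarrow> (nat \<Rightarrow> 'k::field) \<Rightarrow> 'k mat" where
  "colmat n k v = mat n n (\<lambda>(i, j). if Suc j = k then v (Suc i) else if i = j then 1 else 0)"

lemma colmat_general_linear:
  assumes k: "k \<in> {1..n}" and "v k \<noteq> 0"
  shows "colmat n k v \<in> general_linear n"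
proof -
  have "det (colmat n k v) \<noteq> 0"
    unfolding colmat_def det_nonzero_iff
  proof (intro allI impI)
    fix w j
    assume w: "\<forall>i<n. (\<Sum>j<n. (if Suc j = k then v (Suc i) else if i = j then 1 else 0) * w j) = 0" and j: "j < n"
    have s: "(\<Sum>j<n. (if Suc j = k then v (Suc i) else if i = j then 1 else 0) * w j) =
        v (Suc i) * w (k - 1) + (if Suc i = k then 0 else w i)" if "i < n" for i
    proof -
      have "(\<Sum>j<n. (if Suc j = k then v (Suc i) else if i = j then 1 else 0) * w j) =
          (\<Sum>j<n. (if j = k - 1 then v (Suc i) * w j else 0) + (if j = i then (if Suc i = k then 0 else w i) else 0))"
        using k by (intro sum.cong) auto
      also have "\<dots> = v (Suc i) * w (k - 1) + (if Suc i = k then 0 else w i)"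
      proof -
        have "k - 1 < n" using k by auto
        then show ?thesis using that by (simp add: sum.distrib)
      qed
      finally show ?thesis .
    qed
    have wk: "w (k - 1) = 0"
      using w[rule_format, of "k - 1"] s[of "k - 1"] k assms(2) by auto
    then show "w j = 0" using w[rule_format, OF j] s[OF j] by (auto split: if_splits)
  qed
  then show ?thesis by (simp add: general_linear_iff colmat_def)
qed

lemma gl_act_colmat_xvar:
  assumes k: "k \<in> {1..n}" and j: "j \<in> {1..n}"
  shows "gl_act n (colmat n k v) (xvar j) = (if j = k then \<Sum>i=1..n. const (v i) * xvar i else xvar j)"
proof -
  have "gl_act n (colmat n k v) (xvar j) = (\<Sum>i=1..n. const (if j = k then v i else if i = j then 1 else 0) * xvar i)"
    unfolding gl_act_xvar
  proof (rule sum.cong[OF refl])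
    fix i assume i: "i \<in> {1..n}"
    have "Suc (j - 1) = j" "Suc (i - 1) = i" "i - 1 < n" "j - 1 < n" "i - 1 = j - 1 \<longleftrightarrow> i = j" using i j by auto
    then have "colmat n k v $$ (i - 1, j - 1) = (if j = k then v i else if i = j then 1 else 0)"
      by (simp add: colmat_def)
    then show "const (colmat n k v $$ (i - 1, j - 1)) * xvar i =
        const (if j = k then v i else if i = j then 1 else 0) * xvar i" by simp
  qed
  also have "\<dots> = (if j = k then \<Sum>i=1..n. const (v i) * xvar i else xvar j)"
  proof (cases "j = k")
    case False
    then have "(\<Sum>i=1..n. const (if j = k then v i else if i = j then 1 else 0) * xvar i) =
        (\<Sum>i=1..n. if i = j then xvar i else 0)" by (intro sum.cong) auto
    then show ?thesis using False j by simp
  qed simp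
  finally show ?thesis .
qed

lemma linear_form_sum:
  assumes L: "L \<in> homog n 1"
  shows "L = (\<Sum>i=1..n. const (coeff_coord L i) * xvar i)"
proof (rule poly_mapping_eqI)
  fix m
  have "lookup (\<Sum>i=1..n. const (coeff_coord L i) * xvar i) m =
      (\<Sum>i=1..n. if single i 1 = m then lookup L m else 0)"
    unfolding lookup_sum lookup_const_times
    by (intro sum.cong) (auto simp: xvar_def xmonom_def coeff_coord_def lookup_single when_def)
  also have "\<dots> = lookup L m"
  proof (cases "m \<in> keys L")
    case True
    then have m: "keys m \<subseteq> {1..n}" "mdeg m = 1" using L by (auto simp: homog_def polys_def)
    then have "m \<noteq> 0" by auto
    then obtain i where i: "i \<in> keys m" by (metis all_not_in_conv keys_eq_empty)
    have "mdeg m = lookup m i + (\<Sum>j\<in>keys m - {i}. lookup m j)"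
      unfolding mdeg_def using i by (simp add: sum.remove)
    moreover have "lookup m i \<noteq> 0" using i by (simp add: in_keys_iff)
    ultimately have "lookup m i = 1" "(\<Sum>j\<in>keys m - {i}. lookup m j) = 0" using m(2) by linarith+
    then have one: "lookup m i = 1" "\<forall>j\<in>keys m - {i}. lookup m j = 0" by simp_all
    have "lookup m j = 0" if "j \<noteq> i" for j
    proof (cases "j \<in> keys m")
      case True
      then show ?thesis using one(2) that by blast
    qed (simp add: in_keys_iff)
    then have "m = single i 1"
      using one(1) by (intro poly_mapping_eqI) (auto simp: lookup_single when_def)
    then have "(\<Sum>j=1..n. if single j 1 = m then lookup L m else 0) = (\<Sum>j=1..n. if j = i then lookup L m else 0)"
      by (intro sum.cong) (auto dest: arg_cong[of "single _ _" _ keys])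
    then show ?thesis using i m by auto
  next
    case False
    then have "lookup L m = 0" by (simp add: in_keys_iff)
    then show ?thesis by (simp add: sum.neutral)
  qed
  finally show "lookup L m = lookup (\<Sum>i=1..n. const (coeff_coord L i) * xvar i) m" by simp
qed

lemma gl_act_linear_form:
  assumes L: "L \<in> homog n 1"
  shows "gl_act n g L = (\<Sum>i=1..n. const (coeff_coord L i) * gl_act n g (xvar i))"
  by (subst linear_form_sum[OF L]) (simp add: gl_act_sum gl_act_mult gl_act_const)

text \<open>If \<open>x\<^sub>n\<close> occurs in \<open>L\<close>, solve \<open>L\<close> for it. Otherwise first substitute \<open>x\<^sub>k + x\<^sub>n\<close> for a variable
  \<open>x\<^sub>k\<close> that occurs.\<close>

lemma linear_form_to_last_variable:
  assumes L: "L \<in> homog n 1" "L \<noteq> 0" and n: "n \<ge> 1"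
  obtains h where "h \<in> general_linear n" "gl_act n h L = xvar n"
proof -
  have last: "\<exists>h\<in>general_linear n. gl_act n h L = xvar n" if L: "L \<in> homog n 1" and c: "coeff_coord L n \<noteq> 0" for L :: "'a mpoly"
  proof -
    define c where "c = coeff_coord L n"
    define v where "v i = (if i = n then 1 / c else - coeff_coord L i / c)" for i
    have nn: "n \<in> {1..n}" using n by simp
    have split: "(\<Sum>i=1..n. f i) = f n + (\<Sum>i\<in>{1..n} - {n}. f i)" for f :: "nat \<Rightarrow> 'a mpoly"
      using sum.remove[OF _ nn, of f] by simp
    have "gl_act n (colmat n n v) L =
        const c * (\<Sum>i=1..n. const (v i) * xvar i) + (\<Sum>i\<in>{1..n} - {n}. const (coeff_coord L i) * xvar i)"
      unfolding gl_act_linear_form[OF L] split[of "\<lambda>i. const (coeff_coord L i) * _ i"]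
      using gl_act_colmat_xvar[OF nn nn] by (auto simp: c_def gl_act_colmat_xvar[OF nn] intro!: sum.cong)
    also have "const c * (\<Sum>i=1..n. const (v i) * xvar i) = (\<Sum>i=1..n. const (c * v i) * xvar i)"
      by (simp add: sum_distrib_left const_mult mult.assoc)
    also have "\<dots> = xvar n + (\<Sum>i\<in>{1..n} - {n}. const (- coeff_coord L i) * xvar i)"
      unfolding split using c by (auto simp: v_def c_def intro!: sum.cong)
    finally have "gl_act n (colmat n n v) L = xvar n" by (simp add: const_uminus sum_negf)
    moreover have "colmat n n v \<in> general_linear n"
      by (rule colmat_general_linear) (use n c in \<open>auto simp: v_def c_def\<close>)
    ultimately show ?thesis by blast
  qed
  show thesis
  proof (cases "coeff_coord L n = 0")
    case False
    then show thesis using last[OF L(1)] that by blast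
  next
    case True
    have "\<exists>k\<in>{1..n}. coeff_coord L k \<noteq> 0"
    proof (rule ccontr)
      assume "\<not> ?thesis"
      then have "(\<Sum>i=1..n. const (coeff_coord L i) * xvar i) = 0" by (intro sum.neutral) auto
      then show False using L linear_form_sum[OF L(1)] by simp
    qed
    then obtain k where k: "k \<in> {1..n}" "coeff_coord L k \<noteq> 0" by blast
    have kn: "k \<noteq> n" using k True by auto
    define e where "e = colmat n k (\<lambda>i. if i = k \<or> i = n then (1 :: 'a) else 0)"
    have e: "e \<in> general_linear n" unfolding e_def by (rule colmat_general_linear) (use k in auto)
    have "(\<Sum>i=1..n. const (if i = k \<or> i = n then (1 :: 'a) else 0) * xvar i) =
        (\<Sum>i=1..n. (if i = k then xvar i else 0) + (if i = n then xvar i else 0))"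
      using kn by (intro sum.cong) auto
    also have "\<dots> = xvar k + xvar n" using k n by (simp add: sum.distrib)
    finally have col: "(\<Sum>i=1..n. const (if i = k \<or> i = n then (1 :: 'a) else 0) * xvar i) = xvar k + xvar n" .
    have ex: "gl_act n e (xvar j) = xvar j + (if j = k then xvar n else 0)" if "j \<in> {1..n}" for j
      unfolding e_def gl_act_colmat_xvar[OF k(1) that] col by simp
    have "gl_act n e L = (\<Sum>i=1..n. const (coeff_coord L i) * xvar i + (if i = k then const (coeff_coord L i) * xvar n else 0))"
      unfolding gl_act_linear_form[OF L(1)] by (intro sum.cong) (auto simp: ex distrib_left)
    also have "\<dots> = L + const (coeff_coord L k) * xvar n"
      using k(1) linear_form_sum[OF L(1)] by (simp add: sum.distrib)
    finally have "coeff_coord (gl_act n e L) n = coeff_coord L k"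
      using True by (simp add: coeff_coord_def lookup_add lookup_const_times xvar_def xmonom_def)
    then obtain h where h: "h \<in> general_linear n" "gl_act n h (gl_act n e L) = xvar n"
      using last[OF gl_act_homog[OF L(1)], of e] k by auto
    have "gl_act n (h * e) L = xvar n"
      using gl_act_times[of h n e L] h e homog_polys[OF L(1)] by (simp add: general_linear_iff)
    then show thesis using that general_linear_times[OF h(1) e] by blast
  qed
qed

lemma ideal_plus_gl_act:
  assumes K: "graded_ideal n K" and h: "h \<in> general_linear n" and L: "L \<in> polys {1..n}"
  shows "homog n e \<subseteq> ideal_plus n (gl_act n h ` K) (gl_act n h L) \<longleftrightarrow> homog n e \<subseteq> ideal_plus n K L"
proof -
  have *: "homog n e \<subseteq> ideal_plus n (gl_act n h ` K) (gl_act n h L)"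
    if h: "h \<in> general_linear n" and sub: "homog n e \<subseteq> ideal_plus n K L" for h K and L :: "'a mpoly"
  proof
    fix p :: "'a mpoly" assume p: "p \<in> homog n e"
    obtain h' where h': "h' \<in> general_linear n" "h' * h = 1\<^sub>m n" "h * h' = 1\<^sub>m n" using general_linear_inverse[OF h] .
    have "gl_act n h' p \<in> ideal_plus n K L" using sub gl_act_homog[OF p] by blast
    then obtain a b where ab: "a \<in> K" "b \<in> polys {1..n}" "gl_act n h' p = a + b * L"
      unfolding ideal_plus_def by blast
    have "p = gl_act n h (gl_act n h' p)" using gl_act_inverse[OF h'(1) h h'(3) homog_polys[OF p]] by simp
    also have "\<dots> = gl_act n h a + gl_act n h b * gl_act n h L" by (simp add: ab(3) gl_act_add gl_act_mult)
    finally show "p \<in> ideal_plus n (gl_act n h ` K) (gl_act n h L)"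
      unfolding ideal_plus_def using ab(1) gl_act_polys[OF ab(2)] by blast
  qed
  obtain h' where h': "h' \<in> general_linear n" "h' * h = 1\<^sub>m n" using general_linear_inverse[OF h] .
  have inv: "gl_act n h' (gl_act n h p) = p" if "p \<in> polys {1..n}" for p
    by (rule gl_act_inverse[OF h h' that])
  have "gl_act n h' ` gl_act n h ` K = (\<lambda>p. p) ` K"
    unfolding image_image using graded_idealD(1)[OF K] by (intro image_cong refl inv) blast
  then have "gl_act n h' ` gl_act n h ` K = K" by simp
  then show ?thesis using *[OF h, of K L] *[OF h'(1), of "gl_act n h ` K" "gl_act n h L"] inv[OF L] by auto
qed

lemma mult_injective_gl_act:
  assumes K: "graded_ideal n K" and h: "h \<in> general_linear n" and L: "L \<in> polys {1..n}"
  shows "mult_injective n (gl_act n h ` K) (gl_act n h L) d \<longleftrightarrow> mult_injective n K L d"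
proof -
  obtain h' where h': "h' \<in> general_linear n" "h' * h = 1\<^sub>m n" "h * h' = 1\<^sub>m n" using general_linear_inverse[OF h] .
  note KR = graded_idealD(1)[OF K]
  have inv: "gl_act n h' (gl_act n h p) = p" if "p \<in> polys {1..n}" for p
    by (rule gl_act_inverse[OF h h'(1,2) that])
  have mem: "gl_act n h p \<in> gl_act n h ` K \<longleftrightarrow> p \<in> K" if "p \<in> polys {1..n}" for p
  proof
    assume "gl_act n h p \<in> gl_act n h ` K"
    then obtain q where q: "q \<in> K" "gl_act n h p = gl_act n h q" by blast
    then have "q \<in> polys {1..n}" using KR by blast
    then have "p = q" using arg_cong[OF q(2), of "gl_act n h'"] unfolding inv[OF that] by (simp only: inv)
    then show "p \<in> K" using q(1) by simp
  qed blast
  have eq: "gl_act n h ` homog n (int d) = homog n (int d)"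
  proof
    show "homog n (int d) \<subseteq> gl_act n h ` homog n (int d)"
    proof
      fix p :: "'a mpoly" assume p: "p \<in> homog n (int d)"
      then show "p \<in> gl_act n h ` homog n (int d)"
        using gl_act_inverse[OF h'(1) h h'(3) homog_polys[OF p]] gl_act_homog[OF p, of h'] by (metis imageI)
    qed
  qed (auto intro: gl_act_homog)
  have "mult_injective n (gl_act n h ` K) (gl_act n h L) d \<longleftrightarrow>
      (\<forall>p\<in>homog n (int d). gl_act n h (L * p) \<in> gl_act n h ` K \<longrightarrow> gl_act n h p \<in> gl_act n h ` K)"
    unfolding mult_injective_def by (subst eq[symmetric]) (simp add: gl_act_mult)
  also have "\<dots> \<longleftrightarrow> mult_injective n K L d"
    unfolding mult_injective_def
  proof (rule ball_cong[OF refl])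
    fix p :: "'a mpoly" assume "p \<in> homog n (int d)"
    then have p: "p \<in> polys {1..n}" by (rule homog_polys)
    show "(gl_act n h (L * p) \<in> gl_act n h ` K \<longrightarrow> gl_act n h p \<in> gl_act n h ` K) \<longleftrightarrow> (L * p \<in> K \<longrightarrow> p \<in> K)"
      unfolding mem[OF p] mem[OF polys_mult[OF L p]] by (rule refl)
  qed
  finally show ?thesis .
qed

section \<open>Initial ideals and powers of the last variable\<close>

text \<open>This is the reason for using the reverse lexicographic order: a larger monomial of the same
  degree has at most the same exponent of \<open>x\<^sub>n\<close>.\<close>

lemma upset_last_less: "upset n d {m \<in> mons n d. lookup m n < b}"
  unfolding upset_def
proof (intro conjI ballI impI)
  fix m m' assume m: "m \<in> {m \<in> mons n d. lookup m n < b}" and m': "m' \<in> mons n d" and less: "revlex_less m m'"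
  then obtain i where i: "lookup m' i < lookup m i" "\<forall>j>i. lookup m j = lookup m' j"
    by (auto simp: revlex_less_def mons_def)
  have "i \<in> keys m" using i(1) by (simp add: in_keys_iff)
  then have "i \<le> n" using m by (auto simp: mons_def)
  then have "lookup m' n \<le> lookup m n" using i by (cases "i = n") auto
  then show "m' \<in> {m \<in> mons n d. lookup m n < b}" using m m' by auto
qed auto

lemma lookup_beyond: "m \<in> mons n d \<Longrightarrow> j > n \<Longrightarrow> lookup m j = 0"
  by (fastforce simp: mons_def in_keys_iff)

lemma revlex_last:
  assumes "m \<in> mons n d" "m' \<in> mons n d" "lookup m n < lookup m' n"
  shows "revlex_less m' m"
proof -
  have "\<forall>j>n. lookup m' j = lookup m j" using lookup_beyond assms(1,2) by simp
  then show ?thesis using assms unfolding revlex_less_def by (auto simp: mons_def)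
qed

text \<open>In particular a form is divisible by a power of \<open>x\<^sub>n\<close> as soon as its leading monomial is.\<close>

lemma leading_last_least:
  assumes "is_leading p m" "p \<in> homog n (int d)" "k \<in> keys p"
  shows "lookup m n \<le> lookup k n"
proof (rule ccontr)
  assume "\<not> lookup m n \<le> lookup k n"
  moreover have "k \<in> mons n d" "m \<in> mons n d" using assms by (auto simp: homog_iff is_leading_def)
  ultimately have less: "revlex_less m k" by (intro revlex_last) auto
  have "k = m \<or> revlex_less k m" using assms by (auto simp: is_leading_def)
  then show False using less revlex_asym[OF less] revlex_irrefl[of m] by auto
qed

lemma split_power:
  fixes k :: "nat \<Rightarrow>\<^sub>0 nat"
  assumes "b \<le> lookup k i" shows "k = single i b + (k - single i b)"
  by (rule poly_mapping_eqI) (use assms in \<open>auto simp: lookup_add lookup_minus lookup_single when_def\<close>)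

lemma divisible_by_power:
  fixes p :: "'k::field mpoly"
  assumes "\<And>k. k \<in> keys p \<Longrightarrow> b \<le> lookup k i"
  obtains q where "p = xmonom (single i b) * q"
proof
  define q where "q = (\<Sum>k\<in>keys p. single (k - single i b) (lookup p k))"
  have "xmonom (single i b) * q = (\<Sum>k\<in>keys p. single (single i b + (k - single i b)) (lookup p k))"
    by (simp add: q_def sum_distrib_left xmonom_def mult_single)
  also have "\<dots> = (\<Sum>k\<in>keys p. single k (lookup p k))"
    using split_power[OF assms, symmetric] by (intro sum.cong) auto
  finally show "p = xmonom (single i b) * q" by (simp add: poly_monomial_sum[symmetric])
qed

lemma homog_cancel_xmonom:
  assumes "xmonom u * q \<in> homog n (int (mdeg u + d))" shows "q \<in> homog n (int d)"
  using assms by (fastforce simp: homog_def polys_def keys_xmonom_times keys_plus_nat)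

lemma keys_const_mult: "c \<noteq> 0 \<Longrightarrow> keys (const c * p) = keys (p :: 'k::field mpoly)"
  by (auto simp: in_keys_iff lookup_const_times)

lemma leading_const_mult: "c \<noteq> 0 \<Longrightarrow> is_leading (const c * p) m \<longleftrightarrow> is_leading p m"
  by (simp add: is_leading_def keys_const_mult)

lemma leading_xmonom: "is_leading (xmonom m) m"
  by (simp add: is_leading_def)

lemma lms_full: assumes "homog n (int d) \<subseteq> K" shows "lm_deg n K d = mons n d"
proof
  show "mons n d \<subseteq> lm_deg n K d"
  proof
    fix m assume m: "m \<in> mons n d"
    then have "xmonom m \<in> K \<inter> homog n (int d)" using assms by (auto simp: homog_xmonom mons_def)
    then show "m \<in> lm_deg n K d" using leading_xmonom by (auto simp: lm_deg_def lms_def)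
  qed
qed (rule lm_deg_subset)

text \<open>Among the monomials of one degree, those divisible by \<open>x\<^sub>n\<close> are the smallest, so passing to
  the initial ideal commutes with adding \<open>x\<^sub>n\<close>.\<close>

lemma plus_last_variable:
  assumes K: "graded_ideal n K" and n: "n \<ge> 1"
  shows "homog n (int (Suc d)) \<subseteq> ideal_plus n K (xvar n) \<longleftrightarrow>
    {m \<in> mons n (Suc d). lookup m n = 0} \<subseteq> lm_deg n K (Suc d)"
proof -
  have xn: "xvar n \<in> homog n 1" by (rule homog_xvar) (use n in simp)
  show ?thesis
  proof
    assume sub: "homog n (int (Suc d)) \<subseteq> ideal_plus n K (xvar n)"
    show "{m \<in> mons n (Suc d). lookup m n = 0} \<subseteq> lm_deg n K (Suc d)"
    proof
      fix m assume m: "m \<in> {m \<in> mons n (Suc d). lookup m n = 0}"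
      then have xm: "xmonom m \<in> homog n (int (Suc d))" by (auto simp: homog_xmonom mons_def)
      obtain a b where ab: "a \<in> K \<inter> homog n (int (Suc d))" "b \<in> homog n (int d)" "xmonom m = a + xvar n * b"
        using ideal_plus_homog[OF K xn xm] sub xm by blast
      have pos: "0 < lookup k n" if "k \<in> keys (xvar n * b)" for k
        using that by (auto simp: xvar_def keys_xmonom_times lookup_add)
      have ka: "keys a \<subseteq> mons n (Suc d)" using ab(1) unfolding Int_iff homog_iff by blast
      have a: "a = xmonom m - xvar n * b" using ab(3) by simp
      have "lookup (xvar n * b) m = 0" using pos[of m] m by (auto simp: in_keys_iff)
      then have mk: "m \<in> keys a" by (simp add: a in_keys_iff lookup_minus xmonom_def)
      have "revlex_less k m" if k: "k \<in> keys a" "k \<noteq> m" for k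
      proof (rule revlex_last)
        have "k \<in> keys (xvar n * b)" using k keys_minus_subset[of "xmonom m" "xvar n * b"] by (auto simp: a)
        then show "lookup m n < lookup k n" using pos m by auto
      qed (use m k ka in auto)
      then have "is_leading a m" using mk by (simp add: is_leading_def)
      then show "m \<in> lm_deg n K (Suc d)" using ab(1) by (auto simp: lm_deg_def lms_def)
    qed
  next
    assume sub: "{m \<in> mons n (Suc d). lookup m n = 0} \<subseteq> lm_deg n K (Suc d)"
    define V where "V = ideal_plus n K (xvar n) \<inter> homog n (int (Suc d))"
    have id: "ideal (ideal_plus n K (xvar n)) (poly_ring n)"
      by (rule ideal_plus_ideal[OF graded_ideal_ideal[OF K] homog_polys[OF xn]])
    have "linear_space (ideal_plus n K (xvar n))"
      unfolding linear_space_def using idealD_poly[OF id] by simp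
    then have V: "linear_space V" unfolding V_def by (intro linear_space_Int linear_space_homog)
    have "homog n (int (Suc d)) \<subseteq> V"
    proof (rule subset_if_lms_subset[OF linear_space_homog subset_refl V])
      show "V \<subseteq> homog n (int (Suc d))" by (simp add: V_def)
      show "lms (homog n (int (Suc d)) :: 'a mpoly set) \<subseteq> lms V"
      proof
        fix m assume "m \<in> lms (homog n (int (Suc d)) :: 'a mpoly set)"
        then have m: "m \<in> mons n (Suc d)" using lms_subset_mons by blast
        show "m \<in> lms V"
        proof (cases "lookup m n = 0")
          case True
          then have "m \<in> lm_deg n K (Suc d)" using sub m by blast
          moreover have "K \<subseteq> ideal_plus n K (xvar n)"
          proof
            fix p assume "p \<in> K"
            moreover have "p = p + 0 * xvar n" by simp
            ultimately show "p \<in> ideal_plus n K (xvar n)" unfolding ideal_plus_def by blast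
          qed
          ultimately show ?thesis by (auto simp: lm_deg_def lms_def V_def)
        next
          case False
          define w where "w = m - single n 1"
          have mw: "m = single n 1 + w" unfolding w_def by (rule split_power) (use False in simp)
          have "xmonom m \<in> homog n (int (Suc d))" using m by (auto simp: homog_xmonom mons_def)
          moreover have "(xmonom m :: 'a mpoly) = 0 + xmonom w * xvar n"
            by (simp add: mw xmonom_add xvar_def mult.commute)
          moreover have "keys w \<subseteq> {1..n}" using m by (auto simp: mons_def mw keys_plus_nat)
          ultimately have "xmonom m \<in> V" unfolding V_def ideal_plus_def
            using graded_idealD(2)[OF K] polys_xmonom by blast
          then show ?thesis using leading_xmonom by (auto simp: lms_def)
        qed
      qed
    qed
    then show "homog n (int (Suc d)) \<subseteq> ideal_plus n K (xvar n)" by (auto simp: V_def)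
  qed
qed

section \<open>Reduction number and weak Lefschetz property in general coordinates\<close>

locale general_position =
  fixes n :: nat and I :: "'k::field_char_0 mpoly set" and g :: "'k mat"
  assumes n: "n \<ge> 2" and I: "graded_ideal n I" and proper: "1 \<notin> I"
    and artinian: "\<exists>D. \<forall>d\<ge>D. homog n (int d) \<subseteq> I"
    and g: "g \<in> general_linear n" and general: "general_coords n (gl_act n g ` I)"
begin

definition "K = gl_act n g ` I"

definition "M = lms K"

definition "s = (LEAST t. {m \<in> mons n (Suc t). lookup m n = 0} \<subseteq> M)"

lemma K: "graded_ideal n K"
  unfolding K_def by (rule gl_act_graded_ideal[OF I g])

lemma lm_deg_K: "lm_deg n K d = M \<inter> mons n d"
  using lms_graded[OF K] lm_deg_subset[of n K d] by (auto simp: M_def mons_def)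

lemma n_mem: "n \<in> {1..n}" using n by simp

lemma high_degrees: "\<exists>D. \<forall>d\<ge>D. mons n d \<subseteq> M"
proof -
  obtain D where D: "\<forall>d\<ge>D. homog n (int d) \<subseteq> I" using artinian by blast
  obtain h where h: "h \<in> general_linear n" "h * g = 1\<^sub>m n" "g * h = 1\<^sub>m n" using general_linear_inverse[OF g] .
  have "homog n (int d) \<subseteq> K" if "d \<ge> D" for d
  proof
    fix p :: "'k mpoly" assume p: "p \<in> homog n (int d)"
    have "gl_act n h p \<in> I" using gl_act_homog[OF p] D that by blast
    moreover have "p = gl_act n g (gl_act n h p)" using gl_act_inverse[OF h(1) g h(3) homog_polys[OF p]] by simp
    ultimately show "p \<in> K" unfolding K_def by (rule image_eqI[rotated])
  qed
  then have "mons n d \<subseteq> M" if "d \<ge> D" for d using lms_full[of n d K] lm_deg_K[of d] that by blast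
  then show ?thesis by blast
qed

lemma M_keys: "m \<in> M \<Longrightarrow> keys m \<subseteq> {1..n}"
  unfolding M_def by (rule lms_keys[OF K])

lemma M_add: "m \<in> M \<Longrightarrow> keys u \<subseteq> {1..n} \<Longrightarrow> u + m \<in> M"
  unfolding M_def by (rule lms_add[OF K])

lemma zero_not_M: "0 \<notin> M"
proof
  assume "0 \<in> M"
  then have "0 \<in> lm_deg n K 0" by (simp add: lm_deg_K mons_def)
  then obtain p where p: "p \<in> K" "p \<in> homog n (int 0)" "is_leading p 0" by (auto simp: lm_deg_def lms_def)
  define c where "c = lookup p 0"
  have "keys p \<subseteq> {0}" using p(2) unfolding homog_iff by (auto simp: mons_def mdeg_eq_0_iff)
  then have "p = const c"
    by (intro poly_mapping_eqI) (auto simp: const_def c_def lookup_single when_def in_keys_iff)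
  moreover have "c \<noteq> 0" using p(3) by (auto simp: is_leading_def c_def in_keys_iff)
  ultimately have "const (1 / c) * p = 1" by (simp add: const_mult[symmetric])
  then have "1 \<in> K" using graded_idealD(6)[OF K p(1), of "1 / c"] by simp
  then obtain q where q: "q \<in> I" "gl_act n g q = 1" by (auto simp: K_def)
  obtain h where h: "h \<in> general_linear n" "h * g = 1\<^sub>m n" using general_linear_inverse[OF g] .
  have "q = gl_act n h 1" using gl_act_inverse[OF g h, of q] q graded_idealD(1)[OF I] by auto
  then have "q = 1" using gl_act_const[of n h 1] by simp
  then show False using q(1) proper by simp
qed

text \<open>Maximality compares \<open>K\<close> with the images of \<open>K\<close>; as \<open>K = g I\<close>, these are all the images of
  \<open>I\<close>.\<close>

lemma dominates:
  assumes h: "h \<in> general_linear n" and F: "upset n d F"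
  shows "card (lm_deg n (gl_act n h ` I) d \<inter> F) \<le> card (M \<inter> F)"
proof -
  obtain g' where g': "g' \<in> general_linear n" "g' * g = 1\<^sub>m n" using general_linear_inverse[OF g] .
  have carr: "g \<in> carrier_mat n n" "g' \<in> carrier_mat n n" "h \<in> carrier_mat n n"
    using g g'(1) h by (auto simp: general_linear_iff)
  have hg': "h * g' \<in> general_linear n" by (rule general_linear_times[OF h g'(1)])
  have "h * g' * g = h" using g'(2) carr assoc_mult_mat[OF carr(3,2,1)] by simp
  then have "gl_act n (h * g') ` K = gl_act n h ` I"
    using gl_act_image_times[OF graded_idealD(1)[OF I] g hg'] by (simp add: K_def)
  then have "card (lm_deg n (gl_act n h ` I) d \<inter> F) \<le> card (lm_deg n K d \<inter> F)"
    using general hg' F unfolding general_coords_def K_def[symmetric] by metis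
  also have "lm_deg n K d \<inter> F = M \<inter> F" using F by (auto simp: lm_deg_K upset_def)
  finally show ?thesis .
qed

text \<open>In coordinates where \<open>L\<close> is \<open>x\<^sub>n\<close>, surjectivity says that all monomials without \<open>x\<^sub>n\<close> are
  leading monomials. Their number cannot be larger than in general coordinates.\<close>

lemma surjective_imp:
  assumes L: "L \<in> homog n 1" and sub: "homog n (int (Suc t)) \<subseteq> ideal_plus n I L"
  shows "{m \<in> mons n (Suc t). lookup m n = 0} \<subseteq> M"
proof -
  let ?F = "{m \<in> mons n (Suc t). lookup m n = 0}"
  have F: "?F = {m \<in> mons n (Suc t). lookup m n < 1}" by auto
  have nz: "?F \<subseteq> M" if L: "L \<in> homog n 1" "L \<noteq> 0" and sub: "homog n (int (Suc t)) \<subseteq> ideal_plus n I L" for L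
  proof -
    obtain h where h: "h \<in> general_linear n" "gl_act n h L = xvar n"
      by (rule linear_form_to_last_variable[OF L]) (use n in auto)
    have "homog n (int (Suc t)) \<subseteq> ideal_plus n (gl_act n h ` I) (xvar n)"
      using ideal_plus_gl_act[OF I h(1) homog_polys[OF L(1)]] h(2) sub by metis
    then have "?F \<subseteq> lm_deg n (gl_act n h ` I) (Suc t)"
      using plus_last_variable[OF gl_act_graded_ideal[OF I h(1)]] n by simp
    then have "card ?F = card (lm_deg n (gl_act n h ` I) (Suc t) \<inter> ?F)" by (simp add: Int_absorb1)
    also have "\<dots> \<le> card (M \<inter> ?F)" unfolding F by (rule dominates[OF h(1) upset_last_less])
    finally have "card ?F \<le> card (M \<inter> ?F)" .
    then have "M \<inter> ?F = ?F" by (intro card_seteq) auto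
    then show ?thesis by blast
  qed
  show ?thesis
  proof (cases "L = 0")
    case True
    then have "homog n (int (Suc t)) \<subseteq> I" using sub by (auto simp: ideal_plus_def)
    moreover have "I \<subseteq> ideal_plus n I (xvar n)"
    proof
      fix p assume "p \<in> I"
      moreover have "p = p + 0 * xvar n" by simp
      ultimately show "p \<in> ideal_plus n I (xvar n)" unfolding ideal_plus_def by blast
    qed
    ultimately have "homog n (int (Suc t)) \<subseteq> ideal_plus n I (xvar n)" by blast
    moreover have "xvar n \<noteq> (0 :: 'k mpoly)" by (simp add: xvar_def)
    ultimately show ?thesis using nz[OF homog_xvar[OF n_mem]] by blast
  qed (use nz L sub in blast)
qed

text \<open>This is \<open>g\<^sup>-\<^sup>1 x\<^sub>n\<close>, a general linear form for general \<open>g\<close>.\<close>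

definition "L0 = (SOME L. L \<in> homog n 1 \<and> gl_act n g L = xvar n)"

lemma L0: "L0 \<in> homog n 1" "gl_act n g L0 = xvar n"
proof -
  obtain h where h: "h \<in> general_linear n" "h * g = 1\<^sub>m n" "g * h = 1\<^sub>m n" using general_linear_inverse[OF g] .
  have x: "xvar n \<in> homog n 1" by (rule homog_xvar[OF n_mem])
  then have "\<exists>L. L \<in> homog n 1 \<and> gl_act n g L = xvar n"
    using gl_act_inverse[OF h(1) g h(3) homog_polys[OF x]] gl_act_homog[OF x] by blast
  then have "L0 \<in> homog n 1 \<and> gl_act n g L0 = xvar n" unfolding L0_def by (rule someI_ex)
  then show "L0 \<in> homog n 1" "gl_act n g L0 = xvar n" by auto
qed

lemma surjective_L0_iff:
  "homog n (int (Suc t)) \<subseteq> ideal_plus n I L0 \<longleftrightarrow> {m \<in> mons n (Suc t). lookup m n = 0} \<subseteq> M"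
proof -
  have "homog n (int (Suc t)) \<subseteq> ideal_plus n I L0 \<longleftrightarrow> homog n (int (Suc t)) \<subseteq> ideal_plus n K (xvar n)"
    using ideal_plus_gl_act[OF I g homog_polys[OF L0(1)]] L0(2) by (simp add: K_def)
  also have "\<dots> \<longleftrightarrow> {m \<in> mons n (Suc t). lookup m n = 0} \<subseteq> lm_deg n K (Suc t)"
    by (rule plus_last_variable[OF K]) (use n in simp)
  finally show ?thesis by (auto simp: lm_deg_K)
qed

lemma s_surjective: "{m \<in> mons n (Suc s). lookup m n = 0} \<subseteq> M"
proof -
  obtain D where "\<forall>d\<ge>D. mons n d \<subseteq> M" using high_degrees by blast
  then have "{m \<in> mons n (Suc D). lookup m n = 0} \<subseteq> M" by (auto dest: spec[of _ "Suc D"])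
  then show ?thesis unfolding s_def by (rule LeastI)
qed

lemma below_s: "t < s \<Longrightarrow> L \<in> homog n 1 \<Longrightarrow> \<not> homog n (int (Suc t)) \<subseteq> ideal_plus n I L"
proof
  assume t: "t < s" and L: "L \<in> homog n 1" and sub: "homog n (int (Suc t)) \<subseteq> ideal_plus n I L"
  have "\<not> {m \<in> mons n (Suc t). lookup m n = 0} \<subseteq> M" using t unfolding s_def by (rule not_less_Least)
  then show False using surjective_imp[OF L sub] by blast
qed

lemma surjective_from_s: "s \<le> d \<Longrightarrow> homog n (int (Suc d)) \<subseteq> ideal_plus n I L0"
  using homog_subset_mono[OF ideal_plus_ideal[OF graded_ideal_ideal[OF I] homog_polys[OF L0(1)]], of "Suc s" "Suc d"]
    surjective_L0_iff[of s] s_surjective by simp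

text \<open>No linear form has a smaller value than \<open>s\<close>, and \<open>L0\<close> attains it. That \<open>L\<close> attains it too is
  an open condition: write every monomial of degree \<open>s + 1\<close> as an element of \<open>I\<close> plus a multiple
  of \<open>L0\<close> and replace \<open>L0\<close> by \<open>L\<close>; the coefficient matrix, the identity at \<open>L0\<close>, stays invertible
  nearby.\<close>

theorem reduction_number_eq: "reduction_number n I = s"
proof -
  let ?J = "\<lambda>L. I <+>\<^bsub>poly_ring n\<^esub> (PIdl\<^bsub>poly_ring n\<^esub> L)"
  define \<rho> where "\<rho> L = (LEAST t. homog n (int (t + 1)) \<subseteq> ideal_plus n I L)" for L
  have \<rho>: "(let J = ?J L in (LEAST t. quot_comp n J (t + 1) = {\<zero>\<^bsub>poly_ring n Quot J\<^esub>}) = r) \<longleftrightarrow> \<rho> L = r"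
    if "L \<in> homog n 1" for L r
    unfolding Let_def ideal_plus_eq \<rho>_def
    using quot_comp_zero_iff[OF ideal_plus_ideal[OF graded_ideal_ideal[OF I] homog_polys[OF that]]] by simp
  have \<rho>_eq: "\<rho> L = s" if L: "L \<in> homog n 1" and sub: "homog n (int (Suc s)) \<subseteq> ideal_plus n I L" for L
    unfolding \<rho>_def
  proof (rule Least_equality)
    show "homog n (int (s + 1)) \<subseteq> ideal_plus n I L" using sub by simp
    show "s \<le> t" if "homog n (int (t + 1)) \<subseteq> ideal_plus n I L" for t
      using that below_s[OF _ L, of t] by (force simp: not_less[symmetric])
  qed
  define N where "N = card (mons n (Suc s))"
  obtain m where m: "bij_betw m {..<N} (mons n (Suc s))"
    using ex_bij_betw_nat_finite[OF finite_mons] by (metis N_def atLeast0LessThan)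
  have "\<exists>a b. a \<in> I \<inter> homog n (int (Suc s)) \<and> b \<in> homog n (int s) \<and> xmonom (m j) = a + L0 * b" if "j < N" for j
  proof -
    have "m j \<in> mons n (Suc s)" using m that by (auto simp: bij_betw_def)
    then have x: "xmonom (m j) \<in> homog n (int (Suc s))" by (auto simp: homog_xmonom mons_def)
    then have "xmonom (m j) \<in> ideal_plus n I L0" using surjective_from_s[of s] by blast
    then show ?thesis using ideal_plus_homog[OF I L0(1) x] by metis
  qed
  then obtain a b where ab: "\<And>j. j < N \<Longrightarrow> a j \<in> I \<inter> homog n (int (Suc s))"
    "\<And>j. j < N \<Longrightarrow> b j \<in> homog n (int s)" "\<And>j. j < N \<Longrightarrow> xmonom (m j) = a j + L0 * b j"
    by metis
  \<comment> \<open>On linear forms this is the identity, but it is a polynomial in the coordinates everywhere.\<close>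
  define lin where "lin L = (\<Sum>i=1..n. const (coeff_coord L i) * xvar i)" for L :: "'k mpoly"
  have lin: "lin L = L" if "L \<in> homog n 1" for L using linear_form_sum[OF that] by (simp add: lin_def)
  define f where "f L = det (mat N N (\<lambda>(i, j). lookup (a j + lin L * b j) (m i)))" for L
  interpret reg: function_algebra "regular {1..n} (coeff_coord :: 'k mpoly \<Rightarrow> _)" by (rule regular_algebra)
  have f: "f \<in> regular {1..n} coeff_coord"
    unfolding f_def
  proof (rule reg.det_mem)
    fix i j
    have "reg.family lin" unfolding lin_def
      by (intro reg.family_sum reg.family_mult reg.family_fixed reg.family_const regular_coord)
    then have "reg.family (\<lambda>L. a j + lin L * b j)" by (intro reg.family_add reg.family_mult reg.family_fixed)
    then show "(\<lambda>L. lookup (a j + lin L * b j) (m i)) \<in> regular {1..n} coeff_coord" by (rule reg.family_coeff)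
  qed
  define U where "U = {L \<in> homog n 1. f L \<noteq> 0}"
  have "mat N N (\<lambda>(i, j). lookup (a j + lin L0 * b j) (m i)) = mat N N (\<lambda>(i, j). lookup (xmonom (m j) :: 'k mpoly) (m i))"
    using ab(3) by (intro eq_matI) (auto simp: lin[OF L0(1)])
  moreover have "det (mat N N (\<lambda>(i, j). lookup (xmonom (m j) :: 'k mpoly) (m i))) \<noteq> 0"
    by (rule leading_det_nonzero) (use m in \<open>auto simp: leading_xmonom bij_betw_def\<close>)
  ultimately have "L0 \<in> U" using L0(1) by (simp add: U_def f_def)
  have U_open: "zariski_open_in (homog n 1) {1..n} coeff_coord U"
    unfolding U_def by (rule zariski_open_nonzero[OF f])
  have U: "\<rho> L = s" if "L \<in> U" for L
  proof -
    have L: "L \<in> homog n 1" "f L \<noteq> 0" using that by (auto simp: U_def)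
    define V where "V = ideal_plus n I L \<inter> homog n (int (Suc s))"
    have id: "ideal (ideal_plus n I L) (poly_ring n)"
      by (rule ideal_plus_ideal[OF graded_ideal_ideal[OF I] homog_polys[OF L(1)]])
    have "linear_space (ideal_plus n I L)"
      unfolding linear_space_def using idealD_poly[OF id] by simp
    then have V: "linear_space V" "V \<subseteq> homog n (int (Suc s))"
      unfolding V_def by (auto intro: linear_space_Int linear_space_homog)
    have "N \<le> card (lms V \<inter> mons n (Suc s))"
    proof (rule card_lms_ge[OF V upset_mons, of N "\<lambda>j. a j + L * b j" m])
      fix j assume j: "j < N"
      have "a j + b j * L \<in> ideal_plus n I L"
        unfolding ideal_plus_def using ab(1)[OF j] homog_polys[OF ab(2)[OF j]] by blast
      then have "a j + L * b j \<in> ideal_plus n I L" by (simp add: mult.commute)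
      moreover have "L * b j \<in> homog n (int (Suc s))" using homog_mult[OF L(1) ab(2)[OF j]] by simp
      ultimately show "a j + L * b j \<in> V" unfolding V_def using ab(1)[OF j] by blast
    qed (use m L in \<open>auto simp: bij_betw_def f_def lin[OF L(1)]\<close>)
    then have "mons n (Suc s) \<subseteq> lms V"
      using card_seteq[of "mons n (Suc s)" "lms V \<inter> mons n (Suc s)"] by (auto simp: N_def)
    then have "homog n (int (Suc s)) \<subseteq> V"
      using lms_subset_mons[of "homog n (int (Suc s))"]
      by (intro subset_if_lms_subset[OF linear_space_homog subset_refl V]) blast
    then have "homog n (int (Suc s)) \<subseteq> ideal_plus n I L" by (simp add: V_def)
    then show ?thesis by (rule \<rho>_eq[OF L(1)])
  qed
  have UR: "U \<subseteq> homog n 1" by (auto simp: U_def)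
  show ?thesis
    unfolding reduction_number_def
  proof (rule the_equality)
    show "\<exists>U. U \<noteq> {} \<and> zariski_open_in (homog n 1) {1..n} coeff_coord U \<and>
       (\<forall>L\<in>U. let J = ?J L in (LEAST t. quot_comp n J (t + 1) = {\<zero>\<^bsub>poly_ring n Quot J\<^esub>}) = s)"
    proof (intro exI[of _ U] conjI ballI)
      fix L assume "L \<in> U"
      then show "let J = ?J L in (LEAST t. quot_comp n J (t + 1) = {\<zero>\<^bsub>poly_ring n Quot J\<^esub>}) = s"
        using \<rho>[of L s] U UR by blast
    qed (use \<open>L0 \<in> U\<close> U_open in auto)
    fix r assume "\<exists>U. U \<noteq> {} \<and> zariski_open_in (homog n 1) {1..n} coeff_coord U \<and>
       (\<forall>L\<in>U. let J = ?J L in (LEAST t. quot_comp n J (t + 1) = {\<zero>\<^bsub>poly_ring n Quot J\<^esub>}) = r)"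
    then obtain W where W: "W \<noteq> {}" "zariski_open_in (homog n 1) {1..n} coeff_coord W"
      "\<forall>L\<in>W. let J = ?J L in (LEAST t. quot_comp n J (t + 1) = {\<zero>\<^bsub>poly_ring n Quot J\<^esub>}) = r"
      by (elim exE conjE)
    obtain L where L: "L \<in> U" "L \<in> W"
      using zariski_open_meet[OF curve_connected_linear_forms U_open W(2) _ W(1)] \<open>L0 \<in> U\<close> by blast
    then have "\<rho> L = r" using W(3) \<rho>[of L r] UR by blast
    then show "r = s" using U[OF L(1)] by simp
  qed
qed

text \<open>Multiplication by \<open>x\<^sub>n\<close> on the quotient by the initial ideal is injective in degrees below
  \<open>s\<close>. All conditions of the theorem are compared with this one.\<close>

definition "injective_below \<longleftrightarrow> (\<forall>m. keys m \<subseteq> {1..n} \<longrightarrow> mdeg m < s \<longrightarrow> single n 1 + m \<in> M \<longrightarrow> m \<in> M)"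

text \<open>A linear form \<open>L\<close> with maximal ranks is injective in degree \<open>d < s\<close>, where nothing is
  surjective. In coordinates in which it is \<open>x\<^sub>n\<close>, the leading monomials of degree \<open>d + 1\<close>
  divisible by \<open>x\<^sub>n\<close> are the multiples by \<open>x\<^sub>n\<close> of those of degree \<open>d\<close>. In general coordinates there
  are at most as many divisible by \<open>x\<^sub>n\<close>, since there are at least as many not divisible by it and
  the totals agree. A monomial \<open>m\<close> violating the condition would make it one more.\<close>

lemma weak_lefschetz_imp:
  assumes "weak_lefschetz n I" shows injective_below
  unfolding injective_below_def
proof (intro allI impI, rule ccontr)
  fix m assume m: "keys m \<subseteq> {1..n}" "mdeg m < s" "single n 1 + m \<in> M" "m \<notin> M"
  define d where "d = mdeg m"
  have md: "m \<in> mons n d" using m by (simp add: mons_def d_def)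
  obtain L where L: "L \<in> homog n 1" "\<And>d. mult_injective n I L d \<or> homog n (int (Suc d)) \<subseteq> ideal_plus n I L"
    using assms unfolding weak_lefschetz_iff[OF I] by blast
  then have inj: "mult_injective n I L d" using below_s[of d L] m(2) by (auto simp: d_def)
  have "L \<noteq> 0"
  proof
    assume "L = 0"
    then have "homog n (int d) \<subseteq> I" using inj graded_idealD(2)[OF I] by (auto simp: mult_injective_def)
    then have "lm_deg n I d = mons n d" by (rule lms_full)
    then have "card (M \<inter> mons n d) = card (mons n d)"
      using card_lm_deg_gl_act[OF I g, of d] unfolding K_def[symmetric] lm_deg_K by simp
    then have "M \<inter> mons n d = mons n d" by (intro card_subset_eq) auto
    then show False using md m(4) by blast
  qed
  then obtain h where h: "h \<in> general_linear n" "gl_act n h L = xvar n"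
    using linear_form_to_last_variable[OF L(1)] n by (metis one_le_numeral order_trans)
  define H where "H = gl_act n h ` I"
  have H: "graded_ideal n H" unfolding H_def by (rule gl_act_graded_ideal[OF I h(1)])
  have injH: "mult_injective n H (xvar n) d"
    using mult_injective_gl_act[OF I h(1) homog_polys[OF L(1)], of d] inj h(2) by (simp add: H_def)
  define A where "A = lm_deg n K (Suc d)"
  define B where "B = lm_deg n H (Suc d)"
  define F where "F = {m \<in> mons n (Suc d). lookup m n < 1}"
  have fin: "finite A" "finite B" by (simp_all add: A_def B_def)
  have "card A = card B"
    unfolding A_def B_def H_def K_def card_lm_deg_gl_act[OF I h(1)] card_lm_deg_gl_act[OF I g] by (rule refl)
  moreover have "card (B \<inter> F) \<le> card (A \<inter> F)"
  proof -
    have "card (B \<inter> F) \<le> card (M \<inter> F)"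
      unfolding B_def H_def F_def by (rule dominates[OF h(1) upset_last_less])
    also have "M \<inter> F = A \<inter> F" by (auto simp: A_def lm_deg_K F_def)
    finally show ?thesis .
  qed
  moreover have "card A = card (A \<inter> F) + card (A - F)" "card B = card (B \<inter> F) + card (B - F)"
    using fin by (simp_all add: card_Diff_subset_Int card_mono)
  ultimately have le: "card (A - F) \<le> card (B - F)" by linarith
  have "card (lm_deg n K d) + 1 = card (insert m (lm_deg n K d))" using m(4) by (simp add: lm_deg_K)
  also have "\<dots> = card ((+) (single n 1) ` insert m (lm_deg n K d))"
    by (rule card_image[symmetric], rule inj_onI) simp
  also have "\<dots> \<le> card (A - F)"
  proof (rule card_mono)
    have "single n 1 + k \<in> M" if "k \<in> M" for k by (rule M_add[OF that]) (use n in auto)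
    moreover have "single n 1 + k \<in> mons n (Suc d)" if "k \<in> mons n d" for k
      using that n by (auto simp: mons_def keys_plus_nat)
    moreover have "lookup (single n 1 + k) n \<noteq> 0" for k :: "nat \<Rightarrow>\<^sub>0 nat" by (simp add: lookup_add)
    ultimately show "(+) (single n 1) ` insert m (lm_deg n K d) \<subseteq> A - F"
      using m(3) md unfolding A_def F_def lm_deg_K by blast
  qed (use fin in simp)
  also note le
  also have "card (B - F) \<le> card ((+) (single n 1) ` lm_deg n H d)"
  proof (rule card_mono)
    show "B - F \<subseteq> (+) (single n 1) ` lm_deg n H d"
    proof
      fix k assume k: "k \<in> B - F"
      then obtain p where p: "p \<in> H" "p \<in> homog n (int (Suc d))" "is_leading p k" by (auto simp: B_def lm_deg_def lms_def)
      have "1 \<le> lookup k n" using k lm_deg_subset[of n H "Suc d"] by (auto simp: B_def F_def)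
      then have "1 \<le> lookup k' n" if "k' \<in> keys p" for k'
        using leading_last_least[OF p(3,2) that] by simp
      then obtain q where q: "p = xmonom (single n 1) * q" by (rule divisible_by_power)
      have q_hom: "q \<in> homog n (int d)" by (rule homog_cancel_xmonom[of "single n 1"]) (use p(2) q in simp)
      then have qH: "q \<in> H" using injH p(1) unfolding mult_injective_def q xvar_def by blast
      have "q \<noteq> 0" using p(3) q by (auto simp: is_leading_def)
      then obtain k' where k': "is_leading q k'" using leading_exists by blast
      then have "is_leading p (single n 1 + k')" unfolding q leading_xmonom_mult .
      then have "k = single n 1 + k'" using leading_unique p(3) by blast
      moreover have "k' \<in> lm_deg n H d" using qH q_hom k' by (auto simp: lm_deg_def lms_def)
      ultimately show "k \<in> (+) (single n 1) ` lm_deg n H d" by blast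
    qed
  qed simp
  also have "\<dots> \<le> card (lm_deg n H d)" by (rule card_image_le) simp
  also have "\<dots> = card (lm_deg n K d)"
    unfolding H_def K_def card_lm_deg_gl_act[OF I h(1)] card_lm_deg_gl_act[OF I g] by (rule refl)
  finally show False by simp
qed

text \<open>The form \<open>L0\<close> works: it is surjective from degree \<open>s\<close> on. Below, the polynomials that \<open>x\<^sub>n\<close>
  multiplies into \<open>K\<close> have leading monomials that \<open>x\<^sub>n\<close> multiplies into \<open>M\<close>, so they reduce to zero
  modulo \<open>K\<close>.\<close>

lemma weak_lefschetz_if:
  assumes injective_below shows "weak_lefschetz n I"
  unfolding weak_lefschetz_iff[OF I]
proof (intro bexI[OF _ L0(1)] allI)
  fix d
  show "mult_injective n I L0 d \<or> homog n (int (Suc d)) \<subseteq> ideal_plus n I L0"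
  proof (cases "s \<le> d")
    case True
    then show ?thesis using surjective_from_s by blast
  next
    case False
    define U where "U = {p \<in> homog n (int d). xvar n * p \<in> K}"
    have "linear_space U"
      unfolding linear_space_def U_def
      using graded_idealD[OF K] homog_const_mult[of _ n "int d"] by (auto simp: distrib_left mult.left_commute)
    moreover have "K \<inter> homog n (int d) \<subseteq> U"
      using graded_idealD(4)[OF K] n_mem by (auto simp: U_def polys_xvar)
    moreover have "lms U \<subseteq> lms (K \<inter> homog n (int d))"
    proof
      fix m assume "m \<in> lms U"
      then obtain p where p: "p \<in> homog n (int d)" "xvar n * p \<in> K" "is_leading p m" by (auto simp: U_def lms_def)
      have m: "m \<in> mons n d" by (rule leading_in_mons[OF p(3,1)])
      have "single n 1 + m \<in> M" unfolding M_def lms_def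
        using p(2,3) leading_xmonom_mult[of "single n 1" p m] unfolding xvar_def by blast
      then have "m \<in> M" using assms m False unfolding injective_below_def by (simp add: mons_def)
      then show "m \<in> lms (K \<inter> homog n (int d))" using m lm_deg_K[of d] by (auto simp: lm_deg_def)
    qed
    moreover have "U \<subseteq> homog n (int d)" by (auto simp: U_def)
    ultimately have "U \<subseteq> K \<inter> homog n (int d)"
      using subset_if_lms_subset[of U n d "K \<inter> homog n (int d)"] linear_space_deg[OF K] by blast
    then have "mult_injective n K (xvar n) d" by (auto simp: mult_injective_def U_def)
    then show ?thesis using mult_injective_gl_act[OF I g homog_polys[OF L0(1)], of d] L0(2) by (simp add: K_def)
  qed
qed

lemma weak_lefschetz_iff_injective_below: "weak_lefschetz n I \<longleftrightarrow> injective_below"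
  using weak_lefschetz_imp weak_lefschetz_if by blast

end

section \<open>Strong stability in characteristic zero\<close>

lemma of_nat_const: "(of_nat k :: 'k::field mpoly) = const (of_nat k)"
  by (induction k) (auto simp: const_add)

lemma const_power: "const (c ^ k) = const (c :: 'k::field) ^ k"
  by (induction k) (auto simp: const_mult)

text \<open>The difference quotient of \<open>(x\<^sub>n + t x\<^sub>i)\<^sup>a\<^sup>+\<^sup>1\<close> in \<open>t\<close>, as a polynomial in \<open>t\<close>; its value at
  \<open>t = 0\<close> is the derivative \<open>(a + 1) x\<^sub>i x\<^sub>n\<^sup>a\<close>.\<close>

definition shear_rest :: "nat \<Rightarrow> nat \<Rightarrow> nat \<Rightarrow> 'k::field \<Rightarrow> 'k mpoly" where
  "shear_rest n i a t = (\<Sum>k\<le>a. const (of_nat (Suc a choose Suc k) * t ^ k) * (xvar i ^ Suc k * xvar n ^ (a - k)))"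

lemma shear_power:
  "(xvar n + const t * xvar i) ^ Suc a = xvar n ^ Suc a + const t * shear_rest n i a t"
proof -
  have "(const t * xvar i + xvar n) ^ Suc a =
      (\<Sum>k\<le>Suc a. of_nat (Suc a choose k) * (const t * xvar i) ^ k * xvar n ^ (Suc a - k))"
    by (rule binomial_ring)
  also have "\<dots> = xvar n ^ Suc a +
      (\<Sum>k\<le>a. of_nat (Suc a choose Suc k) * (const t * xvar i) ^ Suc k * xvar n ^ (Suc a - Suc k))"
    by (subst sum.atMost_Suc_shift) simp
  also have "(\<Sum>k\<le>a. of_nat (Suc a choose Suc k) * (const t * xvar i) ^ Suc k * xvar n ^ (Suc a - Suc k)) =
      const t * shear_rest n i a t"
    unfolding shear_rest_def sum_distrib_left
    by (intro sum.cong refl) (simp add: of_nat_const const_mult const_power power_mult_distrib mult_ac)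
  finally show ?thesis by (simp add: add.commute)
qed

lemma shear_rest_0: "shear_rest n i a 0 = const (of_nat (Suc a)) * (xvar i * xvar n ^ a)"
proof -
  have "shear_rest n i a 0 = (\<Sum>k\<le>a. if k = 0 then const (of_nat (Suc a)) * (xvar i * xvar n ^ a) else 0)"
    unfolding shear_rest_def by (intro sum.cong) (auto simp: power_0_left)
  then show ?thesis by simp
qed

context general_position
begin

text \<open>Let \<open>a\<close> be the exponent of \<open>x\<^sub>n\<close> in \<open>m\<close>, and let \<open>F\<close> consist of the monomials not divisible
  by \<open>x\<^sub>n\<^sup>a\<^sup>+\<^sup>1\<close>. An element \<open>f\<close> of \<open>K\<close> with leading monomial \<open>x\<^sub>n m\<close> is \<open>x\<^sub>n\<^sup>a\<^sup>+\<^sup>1 f'\<close> and has no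
  coefficients in \<open>F\<close>. After the substitution of \<open>x\<^sub>n + t x\<^sub>i\<close> for \<open>x\<^sub>n\<close> its coefficients in \<open>F\<close> are
  \<open>t\<close> times those of \<open>W t\<close>, and \<open>W 0 = (a + 1) x\<^sub>i x\<^sub>n\<^sup>a f'\<close> has leading monomial \<open>x\<^sub>i m\<close>, with a
  nonzero coefficient in characteristic zero. If \<open>x\<^sub>i m\<close> were not in \<open>M\<close>, then at \<open>t = 0\<close> the form
  \<open>W t\<close> and the elements of \<open>K\<close> with leading monomials in \<open>F\<close> would be independent in the
  coordinates of \<open>F\<close>. The determinant expressing this is a polynomial in \<open>t\<close>, so it is nonzero for
  some \<open>t \<noteq> 0\<close>, and the substitution would produce more leading monomials in \<open>F\<close> than general
  coordinates have.\<close>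

theorem stable:
  assumes m: "keys m \<subseteq> {1..n}" and mn: "single n 1 + m \<in> M" and i: "i \<in> {1..n}"
  shows "single i 1 + m \<in> M"
proof (rule ccontr)
  assume T_not: "single i 1 + m \<notin> M"
  then have "i \<noteq> n" using mn by auto
  define a where "a = lookup m n"
  define m' where "m' = m - single n a"
  have mm': "m = single n a + m'" unfolding m'_def by (rule split_power) (simp add: a_def)
  define d where "d = Suc (mdeg m)"
  define T where "T = single i 1 + m"
  have Td: "T \<in> mons n d" using m i by (auto simp: T_def mons_def d_def keys_plus_nat)
  have Mnd: "single n 1 + m \<in> mons n d" using m n by (auto simp: mons_def d_def keys_plus_nat)
  then have "single n 1 + m \<in> lm_deg n K d" using mn by (simp add: lm_deg_K)
  then obtain f where f: "f \<in> K" "f \<in> homog n (int d)" "is_leading f (single n 1 + m)"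
    by (auto simp: lm_deg_def lms_def)
  have "Suc a \<le> lookup k n" if "k \<in> keys f" for k
    using leading_last_least[OF f(3,2) that] by (simp add: lookup_add a_def)
  then obtain f' where f': "f = xmonom (single n (Suc a)) * f'" by (rule divisible_by_power)
  have "single n 1 + m = single n (Suc a) + m'"
    by (simp add: mm' add.assoc[symmetric] single_add[symmetric])
  then have lf': "is_leading f' m'" using f(3) unfolding f' by (simp only: leading_xmonom_mult)
  have f'R: "f' \<in> polys {1..n}"
    using f(2) by (auto simp: f' homog_def polys_def keys_xmonom_times keys_plus_nat)
  define F where "F = {k \<in> mons n d. lookup k n < Suc a}"
  have F: "upset n d F" unfolding F_def by (rule upset_last_less)
  have TF: "T \<in> F" using Td \<open>i \<noteq> n\<close> by (simp add: F_def T_def lookup_add lookup_single a_def)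
  define c where "c = card (lms (K \<inter> homog n (int d)) \<inter> F)"
  obtain p e where p: "\<And>j. j < c \<Longrightarrow> p j \<in> K \<inter> homog n (int d)" "\<And>j. j < c \<Longrightarrow> is_leading (p j) (e j)"
    "e ` {..<c} = lms (K \<inter> homog n (int d)) \<inter> F" "inj_on e {..<c}"
    using card_lms_witness[OF Int_lower2 c_def] by metis
  define v where "v t k = (if k = n then 1 else if k = i then t else 0)" for t :: 'k and k
  define h where "h t = colmat n n (v t)" for t
  have hG: "h t \<in> general_linear n" for t
    unfolding h_def by (rule colmat_general_linear[OF n_mem]) (simp add: v_def)
  have h_xn: "gl_act n (h t) (xvar n) = xvar n + const t * xvar i" for t
  proof -
    have "gl_act n (h t) (xvar n) = (\<Sum>k=1..n. const (v t k) * xvar k)"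
      unfolding h_def using gl_act_colmat_xvar[OF n_mem n_mem] by simp
    also have "\<dots> = (\<Sum>k=1..n. (if k = n then xvar k else 0) + (if k = i then const t * xvar k else 0))"
      using \<open>i \<noteq> n\<close> by (intro sum.cong) (auto simp: v_def)
    also have "\<dots> = xvar n + const t * xvar i" using i n by (simp add: sum.distrib)
    finally show ?thesis .
  qed
  have h0: "gl_act n (h 0) q = q" if "q \<in> polys {1..n}" for q
  proof -
    have "h 0 = 1\<^sub>m n" by (rule eq_matI) (use n in \<open>auto simp: h_def colmat_def v_def\<close>)
    then show ?thesis using gl_act_one[OF that] by simp
  qed
  define W where "W t = shear_rest n i a t * gl_act n (h t) f'" for t
  have hf: "gl_act n (h t) f = xmonom (single n (Suc a)) * gl_act n (h t) f' + const t * W t" for t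
  proof -
    have "gl_act n (h t) (xvar n ^ Suc a) = (xvar n + const t * xvar i) ^ Suc a"
    proof -
      have "gl_act n (h t) (xvar n ^ b) = (xvar n + const t * xvar i) ^ b" for b
        by (induction b) (use gl_act_const[of n "h t" 1] in \<open>auto simp: gl_act_mult h_xn\<close>)
      then show ?thesis .
    qed
    then have "gl_act n (h t) f = (xvar n ^ Suc a + const t * shear_rest n i a t) * gl_act n (h t) f'"
      by (simp only: f' gl_act_mult xvar_power[symmetric] shear_power)
    then show ?thesis by (simp only: W_def distrib_right xvar_power mult.assoc)
  qed
  have coeff: "lookup (gl_act n (h t) f) k = t * lookup (W t) k" if "k \<in> F" for t k
  proof -
    have "k \<noteq> single n (Suc a) + w" for w
    proof
      assume "k = single n (Suc a) + w"
      then have "Suc a \<le> lookup k n" by (simp add: lookup_add)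
      then show False using that by (simp add: F_def)
    qed
    then have "lookup (xmonom (single n (Suc a)) * gl_act n (h t) f') k = 0"
      unfolding xmonom_def by (rule lookup_single_times_other)
    then show ?thesis by (simp add: hf lookup_add lookup_const_times)
  qed
  define P where "P t j = (if j < c then gl_act n (h t) (p j) else W t)" for t j
  define E where "E j = (if j < c then e j else T)" for j
  have EF: "E j \<in> F" if "j < Suc c" for j
    using that p(3) TF unfolding E_def by (auto simp: image_def)
  interpret pf: function_algebra "range (poly :: 'k poly \<Rightarrow> 'k \<Rightarrow> 'k)" by (rule poly_function_algebra)
  have id_poly: "(\<lambda>t :: 'k. t) \<in> range poly" by (rule range_eqI[of _ _ "[:0, 1:]"]) auto
  have fam_act: "pf.family (\<lambda>t. gl_act n (h t) q)" if "q \<in> polys {1..n}" for q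
  proof (rule pf.family_gl_act[OF _ that])
    fix k l assume kl: "k < n" "l < n"
    have "(\<lambda>t. v t b) \<in> range poly" for b
      unfolding v_def by (cases "b = n"; cases "b = i") (auto intro: pf.const_mem id_poly)
    then show "(\<lambda>t. h t $$ (k, l)) \<in> range poly"
      using kl by (cases "Suc l = n") (simp_all add: h_def colmat_def pf.const_mem)
  qed
  have fam_W: "pf.family W"
    unfolding W_def shear_rest_def
    by (intro pf.family_mult pf.family_sum pf.family_const pf.family_fixed pf.mult_mem pf.const_mem
        pf.power_mem id_poly fam_act f'R)
  have "(\<lambda>t. det (mat (Suc c) (Suc c) (\<lambda>(k, j). lookup (P t j) (E k)))) \<in> range poly"
  proof (rule pf.det_mem)
    fix k j
    have "pf.family (\<lambda>t. P t j)"
    proof (cases "j < c")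
      case True
      then have "p j \<in> polys {1..n}" using p(1) homog_polys by blast
      then show ?thesis using True fam_act by (simp add: P_def)
    qed (simp add: P_def fam_W)
    then show "(\<lambda>t. lookup (P t j) (E k)) \<in> range poly" by (rule pf.family_coeff)
  qed
  then obtain q where q: "\<And>t. det (mat (Suc c) (Suc c) (\<lambda>(k, j). lookup (P t j) (E k))) = poly q t"
    by (metis (no_types) imageE)
  have "det (mat (Suc c) (Suc c) (\<lambda>(k, j). lookup (P 0 j) (E k))) \<noteq> 0"
  proof (rule leading_det_nonzero)
    fix j assume "j < Suc c"
    show "is_leading (P 0 j) (E j)"
    proof (cases "j < c")
      case True
      then have "p j \<in> polys {1..n}" using p(1) homog_polys by blast
      then show ?thesis using True p(2) h0 by (simp add: P_def E_def)
    next
      case False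
      have "W 0 = const (of_nat (Suc a)) * (xmonom (single i 1 + single n a) * f')"
        unfolding W_def shear_rest_0 h0[OF f'R] xvar_power xmonom_add by (simp only: xvar_def mult.assoc)
      moreover have "T = (single i 1 + single n a) + m'" by (simp add: T_def mm' add.assoc)
      moreover have "(of_nat (Suc a) :: 'k) \<noteq> 0" by (rule of_nat_neq_0)
      moreover have "is_leading (xmonom (single i 1 + single n a) * f') ((single i 1 + single n a) + m')"
        using lf' by (simp only: leading_xmonom_mult)
      ultimately have "is_leading (W 0) T" using leading_const_mult by metis
      then show ?thesis using False by (simp add: P_def E_def)
    qed
  next
    have "T \<notin> e ` {..<c}" using p(3) T_not lm_deg_K[of d] by (auto simp: T_def lm_deg_def)
    then show "inj_on E {..<Suc c}" using p(4) unfolding inj_on_def E_def by (auto simp: less_Suc_eq)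
  qed
  then have "q \<noteq> 0" using q[of 0] by auto
  \<comment> \<open>A parameter \<open>t \<noteq> 0\<close> is required, since the column of \<open>f\<close> is \<open>t\<close> times that of \<open>W t\<close>.\<close>
  then obtain t where t: "t \<noteq> 0" "poly q t \<noteq> 0" using poly_nonzero_point[of q 0] by blast
  define Q where "Q j = (if j < c then gl_act n (h t) (p j) else gl_act n (h t) f)" for j
  have Qk: "(\<Sum>j<Suc c. lookup (Q j) (E k) * w j) = (\<Sum>j<Suc c. lookup (P t j) (E k) * (if j < c then w j else t * w j))"
    if "k < Suc c" for w k
    by (intro sum.cong refl) (use coeff[OF EF[OF that]] in \<open>auto simp: Q_def P_def\<close>)
  have detQ: "det (mat (Suc c) (Suc c) (\<lambda>(k, j). lookup (Q j) (E k))) \<noteq> 0"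
    unfolding det_nonzero_iff
  proof (intro allI impI)
    fix w j assume w: "\<forall>k<Suc c. (\<Sum>j<Suc c. lookup (Q j) (E k) * w j) = 0" and j: "j < Suc c"
    have dP: "det (mat (Suc c) (Suc c) (\<lambda>(k, j). lookup (P t j) (E k))) \<noteq> 0" using t(2) q[of t] by simp
    have "\<forall>k<Suc c. (\<Sum>j<Suc c. lookup (P t j) (E k) * (if j < c then w j else t * w j)) = 0"
      using w Qk by simp
    from dP[unfolded det_nonzero_iff, rule_format, OF _ j, of "\<lambda>j. if j < c then w j else t * w j", OF this[rule_format]]
    show "w j = 0" using t(1) by (auto split: if_splits)
  qed
  define H where "H = gl_act n (h t) ` K"
  have H_I: "H = gl_act n (h t * g) ` I"
    unfolding H_def K_def by (rule gl_act_image_times[OF graded_idealD(1)[OF I] g hG])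
  have Hid: "graded_ideal n H" unfolding H_def by (rule gl_act_graded_ideal[OF K hG])
  have "Suc c \<le> card (lms (H \<inter> homog n (int d)) \<inter> F)"
  proof (rule card_lms_ge[OF linear_space_deg[OF Hid] Int_lower2 F _ EF detQ])
    fix j assume "j < Suc c"
    then show "Q j \<in> H \<inter> homog n (int d)"
      using p(1)[of j] f(1,2) gl_act_homog unfolding Q_def H_def by auto
  qed
  also have "\<dots> \<le> card (M \<inter> F)"
    using dominates[OF general_linear_times[OF hG g] F, of t] unfolding H_I lm_deg_def .
  also have "M \<inter> F = lms (K \<inter> homog n (int d)) \<inter> F"
    using lm_deg_K[of d] by (auto simp: lm_deg_def F_def)
  finally show False by (simp add: c_def)
qed

end

section \<open>Generators of the generic initial ideal\<close>

lemma xmonom_dvd_iff: "(xmonom a :: 'k::field mpoly) dvd xmonom b \<longleftrightarrow> (\<exists>u. b = a + u)"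
proof
  assume "(xmonom a :: 'k mpoly) dvd xmonom b"
  then obtain q :: "'k mpoly" where "xmonom b = xmonom a * q" by (rule dvdE)
  then have "{b} = (+) a ` keys q" by (metis keys_xmonom keys_xmonom_times)
  then show "\<exists>u. b = a + u" by blast
qed (auto simp: xmonom_add)

lemma lookup_tuple_monom:
  "lookup (tuple_monom \<alpha>) i = (if 1 \<le> i \<and> i \<le> length \<alpha> then \<alpha> ! (i - 1) else 0)"
proof -
  have "lookup (tuple_monom \<alpha>) i = (\<Sum>j<length \<alpha>. if j = i - 1 then (if 1 \<le> i then \<alpha> ! j else 0) else 0)"
    unfolding tuple_monom_def lookup_sum by (intro sum.cong) (auto simp: lookup_single when_def)
  then show ?thesis by auto
qed

lemma keys_tuple_monom: "keys (tuple_monom \<alpha>) \<subseteq> {1..length \<alpha>}"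
  by (auto simp: in_keys_iff lookup_tuple_monom split: if_splits)

lemma tuple_monom_snoc: "tuple_monom (\<alpha> @ [t]) = tuple_monom \<alpha> + single (Suc (length \<alpha>)) t"
  by (rule poly_mapping_eqI) (auto simp: lookup_tuple_monom lookup_add lookup_single when_def nth_append)

lemma mdeg_tuple_monom: "mdeg (tuple_monom \<alpha>) = sum_list \<alpha>"
proof (induction \<alpha> rule: rev_induct)
  case Nil
  then show ?case by (simp add: tuple_monom_def)
qed (simp add: tuple_monom_snoc)

lemma tuple_monom_of_monomial:
  assumes "keys m \<subseteq> {1..k}" shows "tuple_monom (map (\<lambda>j. lookup m (Suc j)) [0..<k]) = m"
proof (rule poly_mapping_eqI)
  fix i
  show "lookup (tuple_monom (map (\<lambda>j. lookup m (Suc j)) [0..<k])) i = lookup m i"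
  proof (cases "i \<in> {1..k}")
    case True
    then show ?thesis by (auto simp: lookup_tuple_monom)
  next
    case False
    then have "i \<notin> keys m" using assms by blast
    then show ?thesis using False by (auto simp: lookup_tuple_monom in_keys_iff)
  qed
qed

context general_position
begin

abbreviation "J \<equiv> monomial_ideal n M :: 'k mpoly set"

lemma xmonom_J [simp]: "xmonom m \<in> J \<longleftrightarrow> m \<in> M"
  using M_keys[of m] by (auto simp: monomial_ideal_def polys_xmonom)

text \<open>A minimal generator \<open>T\<close> divisible by \<open>x\<^sub>n\<close> gives the monomial \<open>T / x\<^sub>n\<close> outside \<open>M\<close>.
  Conversely, if \<open>x\<^sub>n m \<in> M\<close> and \<open>m \<notin> M\<close>, then a divisor of \<open>x\<^sub>n m\<close> of smallest degree in \<open>M\<close> is a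
  minimal generator, and it contains \<open>x\<^sub>n\<close> because it does not divide \<open>m\<close>.\<close>

lemma injective_below_iff_generators:
  "injective_below \<longleftrightarrow> (\<forall>T d. T \<in> min_gens J \<and> mdeg T = d \<and> max_var T = n \<longrightarrow> d \<ge> s + 1)"
proof (intro iffI allI impI)
  fix T d assume inj: injective_below and T: "T \<in> min_gens J \<and> mdeg T = d \<and> max_var T = n"
  have TM: "T \<in> M" using T by (simp add: min_gens_def)
  then have "keys T \<noteq> {}" using zero_not_M by auto
  then have "n \<in> keys T" using T Max_in[of "keys T"] by (auto simp: max_var_def)
  define w where "w = T - single n 1"
  have w: "T = single n 1 + w"
    unfolding w_def by (rule split_power) (use \<open>n \<in> keys T\<close> in \<open>simp add: in_keys_iff\<close>)
  have "w \<notin> M"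
  proof
    assume "w \<in> M"
    moreover have "(xmonom w :: 'k mpoly) dvd xmonom T" unfolding xmonom_dvd_iff w by (metis add.commute)
    ultimately have "w = T" using T by (simp add: min_gens_def)
    then show False using arg_cong[OF w, of mdeg] by simp
  qed
  moreover have "keys w \<subseteq> {1..n}" using M_keys[OF TM] by (auto simp: w keys_plus_nat)
  ultimately have "\<not> mdeg w < s" using inj TM unfolding injective_below_def w by blast
  then show "d \<ge> s + 1" using T w by auto
next
  assume gens: "\<forall>T d. T \<in> min_gens J \<and> mdeg T = d \<and> max_var T = n \<longrightarrow> d \<ge> s + 1"
  show injective_below
    unfolding injective_below_def
  proof (intro allI impI, rule ccontr)
    fix m assume m: "keys m \<subseteq> {1..n}" "mdeg m < s" "single n 1 + m \<in> M" "m \<notin> M"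
    define A where "A = {T \<in> M. \<exists>u. single n 1 + m = T + u}"
    have "single n 1 + m \<in> A" using m(3) by (auto simp: A_def intro: exI[of _ 0])
    then obtain T where T: "T \<in> A" "\<And>T'. T' \<in> A \<Longrightarrow> mdeg T \<le> mdeg T'"
      using ex_has_least_nat[of "\<lambda>T. T \<in> A" _ mdeg] by blast
    then obtain u where u: "T \<in> M" "single n 1 + m = T + u" by (auto simp: A_def)
    have "keys u \<subseteq> keys (single n 1 + m)" unfolding u(2) keys_plus_nat by blast
    also have "\<dots> \<subseteq> {1..n}" by (rule M_keys[OF m(3)])
    finally have uk: "keys u \<subseteq> {1..n}" .
    have "T \<in> min_gens J"
    proof -
      have "T' = T" if "T' \<in> M" "T = T' + u'" for T' u'
      proof -
        have "T' \<in> A" using that u(2) by (auto simp: A_def add.assoc)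
        then have "mdeg u' = 0" using T(2)[of T'] that(2) by simp
        then show ?thesis using that(2) by (simp add: mdeg_eq_0_iff)
      qed
      then show ?thesis using u(1) by (auto simp: min_gens_def xmonom_dvd_iff)
    qed
    moreover have "n \<in> keys T"
    proof (rule ccontr)
      assume "n \<notin> keys T"
      then have "lookup u n = Suc (lookup m n)"
        using arg_cong[OF u(2), of "\<lambda>k. lookup k n"] by (simp add: lookup_add in_keys_iff)
      then have "u = single n 1 + (u - single n 1)" by (intro split_power) simp
      then obtain u' where u': "u = single n 1 + u'" by blast
      have "single n 1 + m = single n 1 + (u' + T)" using u(2) by (simp add: u' ac_simps)
      then have "m = u' + T" by (rule add_left_imp_eq)
      moreover have "keys u' \<subseteq> {1..n}" using uk by (auto simp: u' keys_plus_nat)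
      ultimately show False using M_add[OF u(1)] m(4) by blast
    qed
    then have "max_var T = n"
      using M_keys[OF u(1)] unfolding max_var_def by (intro Max_eqI) auto
    ultimately have "s + 1 \<le> mdeg T" using gens by blast
    moreover have "mdeg T \<le> Suc (mdeg m)" using arg_cong[OF u(2), of mdeg] by simp
    ultimately show False using m(2) by simp
  qed
qed

text \<open>Since \<open>R/I\<close> is Artinian, \<open>M\<close> contains \<open>x\<^sup>\<alpha> x\<^sub>i\<^sup>t\<close> for large \<open>t\<close>, where \<open>x\<^sub>i\<close> is the variable
  after those of \<open>\<alpha>\<close>; so the minima defining \<open>f\<^sub>i\<close> exist.\<close>

lemma less_Least_iff:
  assumes \<alpha>: "length \<alpha> < n"
  shows "t < (LEAST t. tuple_monom (\<alpha> @ [t]) \<in> M) \<longleftrightarrow> tuple_monom (\<alpha> @ [t]) \<notin> M"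
    and "tuple_monom (\<alpha> @ [LEAST t. tuple_monom (\<alpha> @ [t]) \<in> M]) \<in> M"
proof -
  have up: "tuple_monom (\<alpha> @ [t']) \<in> M" if "tuple_monom (\<alpha> @ [t]) \<in> M" "t \<le> t'" for t t'
  proof -
    have "single (Suc (length \<alpha>)) (t' - t) + tuple_monom (\<alpha> @ [t]) \<in> M"
      by (rule M_add[OF that(1)]) (use \<alpha> in \<open>auto split: if_splits\<close>)
    moreover have "single (Suc (length \<alpha>)) (t' - t) + tuple_monom (\<alpha> @ [t]) = tuple_monom (\<alpha> @ [t'])"
      by (rule poly_mapping_eqI) (use that(2) in \<open>auto simp: tuple_monom_snoc lookup_add lookup_single when_def\<close>)
    ultimately show ?thesis by simp
  qed
  obtain D where D: "\<forall>d\<ge>D. mons n d \<subseteq> M" using high_degrees by blast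
  have "keys (tuple_monom (\<alpha> @ [D])) \<subseteq> {1..n}" using keys_tuple_monom[of "\<alpha> @ [D]"] \<alpha> by auto
  then have "tuple_monom (\<alpha> @ [D]) \<in> M"
    using D[rule_format, of "sum_list \<alpha> + D"] by (auto simp: mons_def mdeg_tuple_monom)
  then show least: "tuple_monom (\<alpha> @ [LEAST t. tuple_monom (\<alpha> @ [t]) \<in> M]) \<in> M" by (rule LeastI)
  show "t < (LEAST t. tuple_monom (\<alpha> @ [t]) \<in> M) \<longleftrightarrow> tuple_monom (\<alpha> @ [t]) \<notin> M"
    using up[OF least] not_less_Least by (metis not_less)
qed

lemma M_divisor: "m + u \<in> mons n d \<Longrightarrow> m + u \<notin> M \<Longrightarrow> m \<notin> M"
  using M_add[of m u] by (auto simp: mons_def keys_plus_nat add.commute)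

text \<open>The conditions on the entries say one after the other that the prefixes of \<open>\<alpha>\<close> are exponents
  of monomials outside \<open>M\<close>; the condition on the whole tuple implies the others.\<close>

lemma gin_J_eq:
  assumes gin: "gin n I = J"
  shows "gin_J n I (n - 1) = {\<alpha>. length \<alpha> = n - 1 \<and> tuple_monom \<alpha> \<notin> M}"
proof -
  have "(\<forall>j<n - 1. \<alpha> ! j < gin_f n I (take j \<alpha>)) \<longleftrightarrow> tuple_monom \<alpha> \<notin> M" if len: "length \<alpha> = n - 1" for \<alpha>
  proof -
    have step: "\<alpha> ! j < gin_f n I (take j \<alpha>) \<longleftrightarrow> tuple_monom (take (Suc j) \<alpha>) \<notin> M" if "j < n - 1" for j
      using less_Least_iff(1)[of "take j \<alpha>" "\<alpha> ! j"] that len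
      by (simp add: gin_f_def gin take_Suc_conv_app_nth)
    have pre: "tuple_monom (take j \<alpha>) \<notin> M" if "tuple_monom \<alpha> \<notin> M" for j
    proof -
      define u where "u = tuple_monom \<alpha> - tuple_monom (take j \<alpha>)"
      have u: "tuple_monom \<alpha> = tuple_monom (take j \<alpha>) + u"
        by (rule poly_mapping_eqI) (auto simp: u_def lookup_add lookup_minus lookup_tuple_monom)
      have "keys (tuple_monom \<alpha>) \<subseteq> {1..n}" by (rule order_trans[OF keys_tuple_monom]) (use len in auto)
      then have "tuple_monom \<alpha> \<in> mons n (sum_list \<alpha>)" by (simp add: mons_def mdeg_tuple_monom)
      then show ?thesis using that M_divisor unfolding u by blast
    qed
    show ?thesis
    proof
      assume *: "\<forall>j<n - 1. \<alpha> ! j < gin_f n I (take j \<alpha>)"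
      have "n - 2 < n - 1" "Suc (n - 2) = n - 1" using n by auto
      then show "tuple_monom \<alpha> \<notin> M" using * step[of "n - 2"] len by simp
    qed (use step pre in blast)
  qed
  then show ?thesis unfolding gin_J_def by blast
qed

text \<open>The monomials \<open>m \<notin> M\<close> with \<open>x\<^sub>n m \<in> M\<close> are \<open>x\<^sup>\<alpha> x\<^sub>n\<^sup>t\<close> with \<open>x\<^sup>\<alpha> \<notin> M\<close> and \<open>t + 1 = f\<^sub>n(\<alpha>)\<close>.\<close>

lemma injective_below_iff_gin_f:
  assumes gin: "gin n I = J"
  shows "injective_below \<longleftrightarrow> (\<forall>\<alpha>\<in>gin_J n I (n - 1). sum_list \<alpha> + gin_f n I \<alpha> \<ge> s + 1)"
proof -
  have f: "gin_f n I \<alpha> = (LEAST t. tuple_monom (\<alpha> @ [t]) \<in> M)" for \<alpha>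
    by (simp add: gin_f_def gin)
  show ?thesis
  proof (intro iffI ballI)
    fix \<alpha> assume inj: injective_below and "\<alpha> \<in> gin_J n I (n - 1)"
    then have \<alpha>: "length \<alpha> = n - 1" "tuple_monom \<alpha> \<notin> M" unfolding gin_J_eq[OF gin] by auto
    then have len: "length \<alpha> < n" using n by simp
    note L = less_Least_iff[OF len, folded f]
    have "0 < gin_f n I \<alpha>" unfolding L(1) using \<alpha>(2) by (simp add: tuple_monom_snoc)
    then obtain t where t: "gin_f n I \<alpha> = Suc t" by (metis gr0_conv_Suc)
    define w where "w = tuple_monom (\<alpha> @ [t])"
    have "w \<notin> M" using L(1)[of t] t by (simp add: w_def)
    moreover have "single n 1 + w \<in> M"
    proof -
      have "Suc (length \<alpha>) = n" using \<alpha>(1) n by simp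
      then have "single n 1 + w = tuple_monom (\<alpha> @ [Suc t])"
        unfolding w_def tuple_monom_snoc by (intro poly_mapping_eqI) (simp add: lookup_add lookup_single when_def)
      then show ?thesis using L(2) t by simp
    qed
    moreover have "keys w \<subseteq> {1..n}" using keys_tuple_monom[of "\<alpha> @ [t]"] \<alpha>(1) n by (simp add: w_def)
    ultimately have "\<not> mdeg w < s" using inj unfolding injective_below_def by blast
    then show "sum_list \<alpha> + gin_f n I \<alpha> \<ge> s + 1" by (simp add: t w_def mdeg_tuple_monom)
  next
    assume *: "\<forall>\<alpha>\<in>gin_J n I (n - 1). sum_list \<alpha> + gin_f n I \<alpha> \<ge> s + 1"
    show injective_below
      unfolding injective_below_def
    proof (intro allI impI, rule ccontr)
      fix m assume m: "keys m \<subseteq> {1..n}" "mdeg m < s" "single n 1 + m \<in> M" "m \<notin> M"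
      define \<alpha> where "\<alpha> = map (\<lambda>j. lookup m (Suc j)) [0..<n - 1]"
      have len: "length \<alpha> = n - 1" "length \<alpha> < n" "Suc (length \<alpha>) = n" using n by (auto simp: \<alpha>_def)
      note L = less_Least_iff[OF len(2), folded f]
      have "\<alpha> @ [lookup m n] = map (\<lambda>j. lookup m (Suc j)) [0..<n]"
        using n by (cases n) (auto simp: \<alpha>_def)
      then have \<alpha>m: "tuple_monom (\<alpha> @ [lookup m n]) = m" using tuple_monom_of_monomial[OF m(1)] by simp
      have "tuple_monom \<alpha> + single n (lookup m n) = m" using \<alpha>m len(3) by (simp add: tuple_monom_snoc)
      then have "tuple_monom \<alpha> \<notin> M" using M_divisor[of "tuple_monom \<alpha>" "single n (lookup m n)" "mdeg m"] m(1,4)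
        by (simp add: mons_def)
      then have "\<alpha> \<in> gin_J n I (n - 1)" using len(1) unfolding gin_J_eq[OF gin] by blast
      moreover have "tuple_monom (\<alpha> @ [Suc (lookup m n)]) = single n 1 + m"
      proof -
        have "tuple_monom (\<alpha> @ [Suc (lookup m n)]) = single n 1 + tuple_monom (\<alpha> @ [lookup m n])"
          unfolding tuple_monom_snoc len(3)
          by (intro poly_mapping_eqI) (simp add: lookup_add lookup_single when_def)
        then show ?thesis by (simp add: \<alpha>m)
      qed
      then have "\<not> Suc (lookup m n) < gin_f n I \<alpha>" unfolding L(1) using m(3) by simp
      ultimately have "s + 1 \<le> sum_list \<alpha> + Suc (lookup m n)" using * by force
      moreover have "mdeg m = sum_list \<alpha> + lookup m n"
        using mdeg_tuple_monom[of "\<alpha> @ [lookup m n]"] by (simp add: \<alpha>m)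
      ultimately show False using m(2) by simp
    qed
  qed
qed

section \<open>The socle\<close>

text \<open>By stability a monomial that \<open>x\<^sub>n\<close> multiplies into \<open>M\<close> is multiplied into \<open>M\<close> by all
  variables.\<close>

lemma injective_below_iff_socle:
  "injective_below \<longleftrightarrow>
    (\<forall>e < int s. \<forall>p\<in>homog n e. (\<forall>i\<in>{1..n}. xvar i * p \<in> J) \<longrightarrow> p \<in> J)"
proof (intro iffI allI impI ballI)
  fix e p assume inj: injective_below and e: "e < int s" and p: "p \<in> homog n e" and soc: "\<forall>i\<in>{1..n}. xvar i * p \<in> J"
  have "m \<in> M" if m: "m \<in> keys p" for m
  proof -
    have "xvar n * p \<in> J" using soc n_mem by blast
    then have "single n 1 + m \<in> M" using m by (auto simp: monomial_ideal_def xvar_def keys_xmonom_times)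
    moreover have "keys m \<subseteq> {1..n}" "mdeg m < s" using p m e by (auto simp: homog_def polys_def)
    ultimately show ?thesis using inj unfolding injective_below_def by blast
  qed
  then show "p \<in> J" using homog_polys[OF p] by (auto simp: monomial_ideal_def)
next
  assume *: "\<forall>e < int s. \<forall>p\<in>homog n e. (\<forall>i\<in>{1..n}. xvar i * p \<in> J) \<longrightarrow> p \<in> J"
  show injective_below
    unfolding injective_below_def
  proof (intro allI impI)
    fix m assume m: "keys m \<subseteq> {1..n}" "mdeg m < s" "single n 1 + m \<in> M"
    have "xvar i * xmonom m \<in> J" if "i \<in> {1..n}" for i
      using stable[OF m(1,3) that] by (simp add: xvar_def xmonom_add[symmetric])
    moreover have "xmonom m \<in> homog n (int (mdeg m))" using m(1) by (simp add: homog_xmonom)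
    moreover have "int (mdeg m) < int s" using m(2) by simp
    ultimately have "(xmonom m :: 'k mpoly) \<in> J" using * by blast
    then show "m \<in> M" by simp
  qed
qed

end

section \<open>The last Betti numbers and the socle\<close>

text \<open>The part of the structure of a graded free resolution that the diagram chase uses. \<open>G q e\<close>
  is the component of degree \<open>e\<close> of the module in position \<open>q\<close>, \<open>x i\<close> is multiplication by a
  variable, and \<open>P i q e\<close> is the component of degree \<open>e\<close> of the submodule \<open>(x\<^sub>1, \<dots>, x\<^sub>i) G\<^sub>q\<close>. The
  last two assumptions say that \<open>x\<^sub>i\<^sub>+\<^sub>1\<close> generates the next submodule modulo \<open>P i\<close> and is a
  nonzerodivisor modulo \<open>P i\<close>.\<close>

locale graded_complex =
  fixes n :: nat and G :: "nat \<Rightarrow> int \<Rightarrow> 'v::ab_group_add set" and \<delta> :: "nat \<Rightarrow> 'v \<Rightarrow> 'v"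
    and x :: "nat \<Rightarrow> 'v \<Rightarrow> 'v" and P :: "nat \<Rightarrow> nat \<Rightarrow> int \<Rightarrow> 'v set"
  assumes G_diff: "v \<in> G q e \<Longrightarrow> w \<in> G q e \<Longrightarrow> v - w \<in> G q e"
    and \<delta>_mem: "v \<in> G (Suc q) e \<Longrightarrow> \<delta> q v \<in> G q e"
    and \<delta>_diff: "\<delta> q (v - w) = \<delta> q v - \<delta> q w"
    and exact: "v \<in> G (Suc q) e \<Longrightarrow> \<delta> q v = 0 \<Longrightarrow> \<exists>u\<in>G (Suc (Suc q)) e. \<delta> (Suc q) u = v"
    and \<delta>_\<delta>: "u \<in> G (Suc (Suc q)) e \<Longrightarrow> \<delta> q (\<delta> (Suc q) u) = 0"
    and x_mem: "i \<in> {1..n} \<Longrightarrow> v \<in> G q e \<Longrightarrow> x i v \<in> G q (e + 1)"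
    and x_diff: "x i (v - w) = x i v - x i w"
    and x_\<delta>: "\<delta> q (x i v) = x i (\<delta> q v)"
    and x_x: "x i (x j v) = x j (x i v)"
    and P_G: "v \<in> P i q e \<Longrightarrow> v \<in> G q e"
    and P_diff: "v \<in> P i q e \<Longrightarrow> w \<in> P i q e \<Longrightarrow> v - w \<in> P i q e"
    and P_0: "P 0 q e = {0}"
    and zero_P: "0 \<in> P i q e"
    and P_Suc: "v \<in> P i q e \<Longrightarrow> v \<in> P (Suc i) q e"
    and x_P: "i \<le> n \<Longrightarrow> j \<in> {1..i} \<Longrightarrow> v \<in> G q e \<Longrightarrow> x j v \<in> P i q (e + 1)"
    and \<delta>_P: "v \<in> P i (Suc q) e \<Longrightarrow> \<delta> q v \<in> P i q e"
    and P_x: "j \<in> {1..n} \<Longrightarrow> v \<in> P i q e \<Longrightarrow> x j v \<in> P i q (e + 1)"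
    and P_split: "i < n \<Longrightarrow> v \<in> P (Suc i) q e \<Longrightarrow> \<exists>w\<in>G q (e - 1). v - x (Suc i) w \<in> P i q e"
    and P_regular: "i < n \<Longrightarrow> w \<in> G q e \<Longrightarrow> x (Suc i) w \<in> P i q (e + 1) \<Longrightarrow> w \<in> P i q e"
begin

text \<open>Cycles and boundaries of the complex modulo \<open>(x\<^sub>1, \<dots>, x\<^sub>i)\<close>, as elements of \<open>G\<close> and not as
  classes, so that no quotients have to be formed.\<close>

definition "cycles i q e = {v \<in> G q e. \<forall>q'. q = Suc q' \<longrightarrow> \<delta> q' v \<in> P i q' e}"

definition "boundaries i q e = {v. \<exists>u\<in>G (Suc q) e. v - \<delta> q u \<in> P i q e}"

lemma G_0: "0 \<in> G q e"
  using zero_P P_G by blast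

lemma \<delta>_0 [simp]: "\<delta> q 0 = 0" and x_0 [simp]: "x i 0 = 0"
  using \<delta>_diff[of q 0 0] x_diff[of i 0 0] by simp_all

lemma P_uminus: "v \<in> P i q e \<Longrightarrow> - v \<in> P i q e"
  using P_diff[OF zero_P, of v i q e] by simp

lemma P_add: "v \<in> P i q e \<Longrightarrow> w \<in> P i q e \<Longrightarrow> v + w \<in> P i q e"
  using P_diff[OF _ P_uminus, of v i q e w] by simp

lemma G_uminus: "v \<in> G q e \<Longrightarrow> - v \<in> G q e"
  using G_diff[OF G_0, of v q e] by simp

lemma x_P_Suc: "i < n \<Longrightarrow> v \<in> G q (e - 1) \<Longrightarrow> x (Suc i) v \<in> P (Suc i) q e"
  using x_P[of "Suc i" "Suc i" v q "e - 1"] by simp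

lemma P_x': "j \<in> {1..n} \<Longrightarrow> v \<in> P i q (e - 1) \<Longrightarrow> x j v \<in> P i q e"
  using P_x[of j v i q "e - 1"] by simp

lemma P_regular': "i < n \<Longrightarrow> w \<in> G q (e - 1) \<Longrightarrow> x (Suc i) w \<in> P i q e \<Longrightarrow> w \<in> P i q (e - 1)"
  using P_regular[of i w q "e - 1"] by simp

text \<open>The connecting map for multiplication by \<open>x\<^sub>i\<^sub>+\<^sub>1\<close>: a cycle \<open>v\<close> modulo \<open>(x\<^sub>1, \<dots>, x\<^sub>i\<^sub>+\<^sub>1)\<close> has
  \<open>\<delta> v = x\<^sub>i\<^sub>+\<^sub>1 w\<close> modulo \<open>(x\<^sub>1, \<dots>, x\<^sub>i)\<close>.\<close>

lemma quotient_is_cycle: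
  assumes i: "i < n" and v: "v \<in> G (Suc q) e" and w: "w \<in> G q (e - 1)" and vw: "\<delta> q v - x (Suc i) w \<in> P i q e"
  shows "w \<in> cycles i q (e - 1)"
  unfolding cycles_def
proof (intro CollectI conjI allI impI w)
  fix q' assume q: "q = Suc q'"
  have "\<delta> q' (\<delta> q v - x (Suc i) w) \<in> P i q' e" using \<delta>_P vw unfolding q by blast
  moreover have "\<delta> q' (\<delta> q v) = 0" using \<delta>_\<delta> v unfolding q by blast
  ultimately have "- x (Suc i) (\<delta> q' w) \<in> P i q' e" by (simp add: \<delta>_diff x_\<delta>)
  then have "x (Suc i) (\<delta> q' w) \<in> P i q' e" using P_uminus by fastforce
  moreover have "\<delta> q' w \<in> G q' (e - 1)" using \<delta>_mem w unfolding q by blast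
  ultimately show "\<delta> q' w \<in> P i q' (e - 1)" using P_regular' i by blast
qed

text \<open>Injectivity of the connecting map, given that the homology modulo \<open>(x\<^sub>1, \<dots>, x\<^sub>i)\<close> vanishes in
  the higher position.\<close>

lemma boundary_lift:
  assumes i: "i < n" and z: "z \<in> G (Suc q) e" and zw: "\<delta> q z - x (Suc i) w \<in> P i q e"
    and w: "w \<in> boundaries i q (e - 1)" and van: "cycles i (Suc q) e \<subseteq> boundaries i (Suc q) e"
  shows "z \<in> boundaries (Suc i) (Suc q) e"
proof -
  have iS: "Suc i \<in> {1..n}" using i by simp
  obtain u where u: "u \<in> G (Suc q) (e - 1)" "w - \<delta> q u \<in> P i q (e - 1)" using w by (auto simp: boundaries_def)
  have xu: "x (Suc i) u \<in> G (Suc q) e" using x_mem[OF iS u(1)] by simp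
  have "\<delta> q (z - x (Suc i) u) = (\<delta> q z - x (Suc i) w) + x (Suc i) (w - \<delta> q u)"
    by (simp add: \<delta>_diff x_\<delta> x_diff)
  then have "\<delta> q (z - x (Suc i) u) \<in> P i q e" using P_add[OF zw P_x'[OF iS u(2)]] by simp
  then have "z - x (Suc i) u \<in> cycles i (Suc q) e" using G_diff[OF z xu] by (simp add: cycles_def)
  then obtain u' where u': "u' \<in> G (Suc (Suc q)) e" "(z - x (Suc i) u) - \<delta> (Suc q) u' \<in> P i (Suc q) e"
    using van by (auto simp: boundaries_def)
  have "z - \<delta> (Suc q) u' = ((z - x (Suc i) u) - \<delta> (Suc q) u') + x (Suc i) u" by simp
  then have "z - \<delta> (Suc q) u' \<in> P (Suc i) (Suc q) e"
    using P_add[OF P_Suc[OF u'(2)] x_P_Suc[OF i u(1)]] by simp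
  then show ?thesis using u'(1) by (auto simp: boundaries_def)
qed

text \<open>The homology modulo \<open>i\<close> variables vanishes in positions above \<open>i\<close>: for \<open>i = 0\<close> this is
  exactness, and the connecting map transports it to \<open>i + 1\<close>.\<close>

lemma vanishing: "i \<le> n \<Longrightarrow> i < q \<Longrightarrow> cycles i q e \<subseteq> boundaries i q e"
proof (induction i arbitrary: q e)
  case 0
  then obtain q' where q: "q = Suc q'" by (cases q) auto
  show ?case
  proof
    fix v assume "v \<in> cycles 0 q e"
    then have "v \<in> G (Suc q') e" "\<delta> q' v = 0" by (auto simp: cycles_def q P_0)
    then obtain u where "u \<in> G (Suc q) e" "\<delta> q u = v" using exact unfolding q by blast
    moreover from this have "v - \<delta> q u \<in> P 0 q e" using zero_P by simp
    ultimately show "v \<in> boundaries 0 q e" unfolding boundaries_def by blast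
  qed
next
  case (Suc i)
  then obtain q' where q: "q = Suc q'" "i < q'" by (cases q) auto
  have i: "i < n" using Suc.prems by simp
  show ?case
  proof
    fix v assume "v \<in> cycles (Suc i) q e"
    then have v: "v \<in> G (Suc q') e" "\<delta> q' v \<in> P (Suc i) q' e" by (auto simp: cycles_def q)
    obtain w where w: "w \<in> G q' (e - 1)" "\<delta> q' v - x (Suc i) w \<in> P i q' e" using P_split[OF i v(2)] by blast
    have "w \<in> cycles i q' (e - 1)" by (rule quotient_is_cycle[OF i v(1) w])
    then have "w \<in> boundaries i q' (e - 1)" using Suc.IH[of q'] i q(2) by auto
    moreover have "cycles i (Suc q') e \<subseteq> boundaries i (Suc q') e" using Suc.IH[of "Suc q'"] i q(2) by simp
    ultimately show "v \<in> boundaries (Suc i) q e" unfolding q(1) using boundary_lift[OF i v(1) w(2)] by blast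
  qed
qed

text \<open>The iterated connecting map, as a relation between cycles in position \<open>i\<close> modulo \<open>i\<close>
  variables and elements in position \<open>0\<close>. Each step lowers the degree by one.\<close>

primrec linked :: "nat \<Rightarrow> int \<Rightarrow> 'v \<Rightarrow> 'v \<Rightarrow> bool" where
  "linked 0 e z a \<longleftrightarrow> z \<in> G 0 e \<and> z = a"
| "linked (Suc i) e z a \<longleftrightarrow> z \<in> G (Suc i) e \<and> (\<exists>w. linked i (e - 1) w a \<and> \<delta> i z - x (Suc i) w \<in> P i i e)"

definition "image_deg e = \<delta> 0 ` G 1 e"

lemma linked_G: "linked i e z a \<Longrightarrow> z \<in> G i e"
  by (cases i) auto

lemma linked_x: "j \<in> {1..n} \<Longrightarrow> linked i e z a \<Longrightarrow> linked i (e + 1) (x j z) (x j a)"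
proof (induction i arbitrary: e z)
  case (Suc i)
  then obtain w where w: "linked i (e - 1) w a" "\<delta> i z - x (Suc i) w \<in> P i i e" by auto
  have "\<delta> i (x j z) - x (Suc i) (x j w) = x j (\<delta> i z - x (Suc i) w)"
    by (simp add: x_\<delta> x_diff x_x[of "Suc i"])
  then have "\<delta> i (x j z) - x (Suc i) (x j w) \<in> P i i (e + 1)" using P_x[OF Suc.prems(1) w(2)] by simp
  moreover have "linked i (e + 1 - 1) (x j w) (x j a)" using Suc.IH[OF Suc.prems(1) w(1)] by simp
  ultimately show ?case using x_mem[OF Suc.prems(1) linked_G[OF Suc.prems(2)]] by auto
qed (auto intro: x_mem)

lemma linked_exists: "i \<le> n \<Longrightarrow> z \<in> cycles i i e \<Longrightarrow> \<exists>a\<in>G 0 (e - int i). linked i e z a"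
proof (induction i arbitrary: e z)
  case (Suc i)
  have i: "i < n" using Suc.prems by simp
  have z: "z \<in> G (Suc i) e" "\<delta> i z \<in> P (Suc i) i e" using Suc.prems by (auto simp: cycles_def)
  obtain w where w: "w \<in> G i (e - 1)" "\<delta> i z - x (Suc i) w \<in> P i i e" using P_split[OF i z(2)] by blast
  have "w \<in> cycles i i (e - 1)" by (rule quotient_is_cycle[OF i z(1) w])
  then obtain a where "a \<in> G 0 (e - 1 - int i)" "linked i (e - 1) w a" using Suc.IH i by fastforce
  then show ?case using w z(1) by (auto simp: algebra_simps)
qed (auto simp: cycles_def)

lemma linked_cycle: "i \<le> n \<Longrightarrow> linked i e z a \<Longrightarrow> z \<in> cycles i i e"
proof (cases i)
  case (Suc i')
  assume "i \<le> n" "linked i e z a"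
  then obtain w where w: "linked i' (e - 1) w a" "\<delta> i' z - x (Suc i') w \<in> P i' i' e" "z \<in> G i e" "i' < n"
    by (auto simp: Suc)
  have "(\<delta> i' z - x (Suc i') w) + x (Suc i') w \<in> P (Suc i') i' e"
    by (rule P_add[OF P_Suc[OF w(2)] x_P_Suc[OF w(4) linked_G[OF w(1)]]])
  then show ?thesis using w(3) by (auto simp: cycles_def Suc)
qed (auto simp: cycles_def)

lemma linked_boundary_iff:
  "i \<le> n \<Longrightarrow> linked i e z a \<Longrightarrow> z \<in> boundaries i i e \<longleftrightarrow> a \<in> image_deg (e - int i)"
proof (induction i arbitrary: e z)
  case 0
  then show ?case by (auto simp: boundaries_def image_deg_def P_0 G_0)
next
  case (Suc i)
  have i: "i < n" using Suc.prems by simp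
  have iS: "Suc i \<in> {1..n}" using i by simp
  obtain w where w: "linked i (e - 1) w a" "\<delta> i z - x (Suc i) w \<in> P i i e" and z: "z \<in> G (Suc i) e"
    using Suc.prems(2) by auto
  have "z \<in> boundaries (Suc i) (Suc i) e \<longleftrightarrow> w \<in> boundaries i i (e - 1)"
  proof
    assume "z \<in> boundaries (Suc i) (Suc i) e"
    then obtain u where u: "u \<in> G (Suc (Suc i)) e" "z - \<delta> (Suc i) u \<in> P (Suc i) (Suc i) e"
      by (auto simp: boundaries_def)
    obtain y where y: "y \<in> G (Suc i) (e - 1)" "(z - \<delta> (Suc i) u) - x (Suc i) y \<in> P i (Suc i) e"
      using P_split[OF i u(2)] by blast
    have "\<delta> i ((z - \<delta> (Suc i) u) - x (Suc i) y) = \<delta> i z - x (Suc i) (\<delta> i y)"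
      using \<delta>_\<delta>[OF u(1)] by (simp add: \<delta>_diff x_\<delta>)
    then have "\<delta> i z - x (Suc i) (\<delta> i y) \<in> P i i e" using \<delta>_P[OF y(2)] by simp
    moreover have "x (Suc i) (w - \<delta> i y) = (\<delta> i z - x (Suc i) (\<delta> i y)) - (\<delta> i z - x (Suc i) w)"
      by (simp add: x_diff)
    ultimately have "x (Suc i) (w - \<delta> i y) \<in> P i i e" using P_diff[OF _ w(2)] by presburger
    then have "w - \<delta> i y \<in> P i i (e - 1)"
      using P_regular'[OF i G_diff[OF linked_G[OF w(1)] \<delta>_mem[OF y(1)]]] by blast
    then show "w \<in> boundaries i i (e - 1)" using y(1) by (auto simp: boundaries_def)
  next
    assume "w \<in> boundaries i i (e - 1)"
    then show "z \<in> boundaries (Suc i) (Suc i) e"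
      using boundary_lift[OF i z w(2)] vanishing[of i "Suc i" e] i by simp
  qed
  then show ?case using Suc.IH[of "e - 1" w] i w(1) by (simp add: algebra_simps)
qed

text \<open>If \<open>x\<^sub>i\<^sub>+\<^sub>1 a\<close> is a boundary, then so is \<open>x\<^sub>i\<^sub>+\<^sub>1 w\<close> for the cycle \<open>w\<close> linked to \<open>a\<close>, and a chain
  that bounds it is a cycle modulo one more variable.\<close>

lemma linked_surj:
  "i \<le> n \<Longrightarrow> a \<in> G 0 (e - int i) \<Longrightarrow> (\<And>j. j \<in> {1..i} \<Longrightarrow> x j a \<in> image_deg (e - int i + 1)) \<Longrightarrow>
    \<exists>z. linked i e z a"
proof (induction i arbitrary: e)
  case (Suc i)
  have i: "i < n" using Suc.prems by simp
  have iS: "Suc i \<in> {1..n}" using i by simp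
  have "\<exists>w. linked i (e - 1) w a"
    using Suc.prems(2,3) i by (intro Suc.IH) (auto simp: algebra_simps)
  then obtain w where w: "linked i (e - 1) w a" by blast
  have l: "linked i e (x (Suc i) w) (x (Suc i) a)" using linked_x[OF iS w] by simp
  have "x (Suc i) a \<in> image_deg (e - int i)" using Suc.prems(3)[of "Suc i"] by (simp add: algebra_simps)
  then have "x (Suc i) w \<in> boundaries i i e" using linked_boundary_iff[OF _ l] i by simp
  then obtain z where z: "z \<in> G (Suc i) e" "x (Suc i) w - \<delta> i z \<in> P i i e" by (auto simp: boundaries_def)
  then have "\<delta> i z - x (Suc i) w \<in> P i i e" using P_uminus[OF z(2)] by simp
  then show ?case using w z(1) by auto
qed auto

text \<open>This is the isomorphism of the top \<open>Tor\<close> with the socle of the cokernel of the first map,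
  shifted by \<open>n\<close>; the linked pairs represent its graph.\<close>

theorem cycles_boundaries_iff_socle:
  "cycles n n e \<subseteq> boundaries n n e \<longleftrightarrow>
    (\<forall>a\<in>G 0 (e - int n). (\<forall>j\<in>{1..n}. x j a \<in> image_deg (e - int n + 1)) \<longrightarrow> a \<in> image_deg (e - int n))"
proof (intro iffI ballI impI subsetI)
  fix a assume sub: "cycles n n e \<subseteq> boundaries n n e" and a: "a \<in> G 0 (e - int n)"
    and soc: "\<forall>j\<in>{1..n}. x j a \<in> image_deg (e - int n + 1)"
  obtain z where z: "linked n e z a" using linked_surj[OF order_refl a] soc by blast
  then have "z \<in> boundaries n n e" using linked_cycle[OF order_refl z] sub by blast
  then show "a \<in> image_deg (e - int n)" using linked_boundary_iff[OF order_refl z] by blast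
next
  fix z assume *: "\<forall>a\<in>G 0 (e - int n). (\<forall>j\<in>{1..n}. x j a \<in> image_deg (e - int n + 1)) \<longrightarrow> a \<in> image_deg (e - int n)"
    and z: "z \<in> cycles n n e"
  obtain a where a: "a \<in> G 0 (e - int n)" "linked n e z a" using linked_exists[OF order_refl z] by blast
  have "x j a \<in> image_deg (e - int n + 1)" if j: "j \<in> {1..n}" for j
  proof -
    have "x j z - \<delta> n 0 \<in> P n n (e + 1)" using x_P[OF order_refl j] z by (simp add: cycles_def)
    then have "x j z \<in> boundaries n n (e + 1)" unfolding boundaries_def using G_0 by blast
    then show ?thesis using linked_boundary_iff[OF order_refl linked_x[OF j a(2)]] by (simp add: algebra_simps)
  qed
  then show "z \<in> boundaries n n e" using * a linked_boundary_iff[OF order_refl a(2)] by blast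
qed

end

subsection \<open>The complex of a graded free resolution\<close>

text \<open>Homogeneous components indexed by integers: the degrees of the entries of a vector are
  differences with shifts and may be negative.\<close>

definition ipart :: "int \<Rightarrow> 'k::field mpoly \<Rightarrow> 'k mpoly" where
  "ipart e = pick (\<lambda>m. int (mdeg m) = e)"

lemma ipart_homog: "p \<in> polys {1..n} \<Longrightarrow> ipart e p \<in> homog n e"
  by (auto simp: homog_def ipart_def keys_pick)

lemma ipart_self: "p \<in> homog n e \<Longrightarrow> ipart e p = p"
  by (auto simp: ipart_def homog_def intro: pick_eq_self)

lemma ipart_sum: "ipart e (\<Sum>i\<in>A. f i) = (\<Sum>i\<in>A. ipart e (f i))"
  by (simp add: ipart_def pick_sum)

lemma ipart_mult:
  assumes q: "q \<in> homog n c" shows "ipart (c + e) (q * p) = q * ipart e p"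
proof (rule poly_mapping_eqI)
  fix m
  have deg: "int (mdeg a) = c" if "lookup q a \<noteq> 0" for a
    using q that by (auto simp: homog_def in_keys_iff)
  have "lookup (ipart (c + e) (q * p)) m = (\<Sum>ab | fst ab + snd ab = m.
      if int (mdeg m) = c + e then lookup q (fst ab) * lookup p (snd ab) else 0)"
    by (simp add: ipart_def lookup_pick lookup_times)
  also have "\<dots> = (\<Sum>ab | fst ab + snd ab = m. lookup q (fst ab) * lookup (ipart e p) (snd ab))"
  proof (rule sum.cong[OF refl])
    fix ab :: "(nat \<Rightarrow>\<^sub>0 nat) \<times> (nat \<Rightarrow>\<^sub>0 nat)" assume "ab \<in> {ab. fst ab + snd ab = m}"
    then have m: "m = fst ab + snd ab" by simp
    show "(if int (mdeg m) = c + e then lookup q (fst ab) * lookup p (snd ab) else 0) =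
        lookup q (fst ab) * lookup (ipart e p) (snd ab)"
    proof (cases "lookup q (fst ab) = 0")
      case False
      then have "int (mdeg m) = c + e \<longleftrightarrow> int (mdeg (snd ab)) = e" using deg by (auto simp: m)
      then show ?thesis by (simp add: ipart_def lookup_pick)
    qed simp
  qed
  finally show "lookup (ipart (c + e) (q * p)) m = lookup (q * ipart e p) m" by (simp add: lookup_times)
qed

definition graded_vectors :: "nat \<Rightarrow> int list \<Rightarrow> int \<Rightarrow> (nat \<Rightarrow> 'k::field mpoly) set" where
  "graded_vectors n ds e = {v. (\<forall>b<length ds. v b \<in> homog n (e - ds ! b)) \<and> (\<forall>b\<ge>length ds. v b = 0)}"

definition homog_matrix :: "nat \<Rightarrow> int list \<Rightarrow> int list \<Rightarrow> (nat \<Rightarrow> nat \<Rightarrow> 'k::field mpoly) \<Rightarrow> bool" where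
  "homog_matrix n ds es M \<longleftrightarrow> (\<forall>a<length ds. \<forall>b<length es. M a b \<in> homog n (es ! b - ds ! a))"

lemma apply_mat_graded:
  assumes M: "homog_matrix n ds es M" and v: "v \<in> graded_vectors n es e"
  shows "apply_mat (length ds) (length es) M v \<in> graded_vectors n ds e"
proof -
  have "(\<Sum>b<length es. M a b * v b) \<in> homog n (e - ds ! a)" if a: "a < length ds" for a
  proof (rule homog_sum)
    fix b assume b: "b \<in> {..<length es}"
    have "M a b * v b \<in> homog n ((es ! b - ds ! a) + (e - es ! b))"
      using M v a b by (intro homog_mult) (auto simp: homog_matrix_def graded_vectors_def)
    then show "M a b * v b \<in> homog n (e - ds ! a)" by simp
  qed
  then show ?thesis by (auto simp: graded_vectors_def apply_mat_def)
qed

lemma graded_vectors_free: "v \<in> graded_vectors n ds e \<Longrightarrow> v \<in> free_mod n (length ds)"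
  unfolding graded_vectors_def free_mod_def carrier_poly_ring using homog_polys by blast

definition vpart :: "int list \<Rightarrow> int \<Rightarrow> (nat \<Rightarrow> 'k::field mpoly) \<Rightarrow> nat \<Rightarrow> 'k mpoly" where
  "vpart ds e v = (\<lambda>b. if b < length ds then ipart (e - ds ! b) (v b) else 0)"

lemma vpart_graded: "v \<in> free_mod n (length ds) \<Longrightarrow> vpart ds e v \<in> graded_vectors n ds e"
  by (auto simp: graded_vectors_def free_mod_def vpart_def intro: ipart_homog)

lemma vpart_self: "v \<in> graded_vectors n ds e \<Longrightarrow> vpart ds e v = v"
  by (rule ext) (auto simp: graded_vectors_def vpart_def ipart_self)

text \<open>Homogeneous maps commute with taking components, so exactness of a resolution holds degree
  by degree.\<close>

lemma apply_mat_vpart: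
  assumes M: "homog_matrix n ds es M"
  shows "apply_mat (length ds) (length es) M (vpart es e v) = vpart ds e (apply_mat (length ds) (length es) M v)"
proof (rule ext)
  fix a
  show "apply_mat (length ds) (length es) M (vpart es e v) a = vpart ds e (apply_mat (length ds) (length es) M v) a"
  proof (cases "a < length ds")
    case True
    have "ipart (e - ds ! a) (M a b * v b) = M a b * ipart (e - es ! b) (v b)" if "b < length es" for b
      using ipart_mult[of "M a b" n "es ! b - ds ! a" "e - es ! b" "v b"] M True that by (simp add: homog_matrix_def)
    then show ?thesis using True by (auto simp: apply_mat_def vpart_def ipart_sum intro!: sum.cong)
  qed (simp add: apply_mat_def vpart_def)
qed

lemma apply_mat_diff: "apply_mat r s M (v - w) = apply_mat r s M v - apply_mat r s M w"
  by (rule ext) (simp add: apply_mat_def right_diff_distrib sum_subtractf)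

lemma apply_mat_scale: "apply_mat r s M (\<lambda>b. c * v b) = (\<lambda>a. c * apply_mat r s M v a)"
  by (rule ext) (simp add: apply_mat_def sum_distrib_left mult.left_commute)

text \<open>The ideal \<open>(x\<^sub>1, \<dots>, x\<^sub>i)\<close>. Reducing modulo it is killing the first \<open>i\<close> variables.\<close>

definition var_ideal :: "nat \<Rightarrow> 'k::field mpoly set" where
  "var_ideal i = {p. \<forall>m\<in>keys p. keys m \<inter> {1..i} \<noteq> {}}"

lemma var_ideal_Suc: "p \<in> var_ideal i \<Longrightarrow> p \<in> var_ideal (Suc i)"
  by (fastforce simp: var_ideal_def)

lemma var_ideal_zero: "0 \<in> var_ideal i"
  by (simp add: var_ideal_def)

lemma var_ideal_diff: "p \<in> var_ideal i \<Longrightarrow> q \<in> var_ideal i \<Longrightarrow> p - q \<in> var_ideal i"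
  using keys_minus_subset[of p q] by (auto simp: var_ideal_def)

lemma var_ideal_mult: "q \<in> var_ideal i \<Longrightarrow> p * q \<in> var_ideal i"
  by (fastforce simp: var_ideal_def keys_plus_nat dest!: keys_mult_nat)

lemma var_ideal_sum: "(\<And>j. j \<in> A \<Longrightarrow> f j \<in> var_ideal i) \<Longrightarrow> (\<Sum>j\<in>A. f j) \<in> var_ideal i"
  using keys_sum_subset[of f A] by (auto simp: var_ideal_def)

lemma xvar_var_ideal: "j \<in> {1..i} \<Longrightarrow> xvar j * p \<in> var_ideal i"
  by (auto simp: var_ideal_def xvar_def keys_xmonom_times keys_plus_nat)

lemma var_ideal_regular: "xvar (Suc i) * p \<in> var_ideal i \<Longrightarrow> p \<in> var_ideal i"
  by (auto simp: var_ideal_def xvar_def keys_xmonom_times keys_plus_nat split: if_splits)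

lemma var_ideal_split:
  assumes p: "p \<in> var_ideal (Suc i)" "p \<in> homog n e"
  shows "\<exists>q\<in>homog n (e - 1). p - xvar (Suc i) * q \<in> var_ideal i"
proof -
  define p1 where "p1 = pick (\<lambda>m. keys m \<inter> {1..i} = {}) p"
  have "1 \<le> lookup k (Suc i)" if "k \<in> keys p1" for k
  proof -
    have k: "k \<in> keys p" "keys k \<inter> {1..i} = {}" using that by (auto simp: p1_def keys_pick)
    then have "keys k \<inter> {1..Suc i} \<noteq> {}" using p(1) by (auto simp: var_ideal_def)
    then have "Suc i \<in> keys k" using k(2) by (auto simp: atLeastAtMostSuc_conv)
    then show ?thesis by (simp add: in_keys_iff)
  qed
  then obtain q where q: "p1 = xmonom (single (Suc i) 1) * q" by (rule divisible_by_power)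
  have kq: "single (Suc i) 1 + m \<in> keys p" if "m \<in> keys q" for m
  proof -
    have "single (Suc i) 1 + m \<in> keys p1" using that by (simp add: q keys_xmonom_times)
    then show ?thesis by (simp add: p1_def keys_pick)
  qed
  have "q \<in> homog n (e - 1)"
    using p(2) kq by (fastforce simp: homog_def polys_def keys_plus_nat)
  moreover have "p - xvar (Suc i) * q \<in> var_ideal i"
  proof -
    have "p - xvar (Suc i) * q = p - p1" by (simp add: q xvar_def)
    then show ?thesis
      by (auto simp: var_ideal_def in_keys_iff lookup_minus p1_def lookup_pick split: if_splits)
  qed
  ultimately show ?thesis by blast
qed

text \<open>The resolution of \<open>K\<close> is continued to the right by \<open>R\<close>, so that it becomes one of \<open>R/K\<close>; all
  indices move up by one.\<close>

definition aug_shifts :: "(nat \<Rightarrow> int list) \<Rightarrow> nat \<Rightarrow> int list" where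
  "aug_shifts ds q = (case q of 0 \<Rightarrow> [0] | Suc q' \<Rightarrow> ds q')"

definition aug_matrix ::
  "(nat \<Rightarrow> 'k mpoly) \<Rightarrow> (nat \<Rightarrow> nat \<Rightarrow> nat \<Rightarrow> 'k mpoly) \<Rightarrow> nat \<Rightarrow> nat \<Rightarrow> nat \<Rightarrow> 'k::field mpoly" where
  "aug_matrix aug D q = (case q of 0 \<Rightarrow> (\<lambda>a b. aug b) | Suc q' \<Rightarrow> D q')"

definition aug_map :: "(nat \<Rightarrow> int list) \<Rightarrow> (nat \<Rightarrow> 'k::field mpoly) \<Rightarrow> (nat \<Rightarrow> nat \<Rightarrow> nat \<Rightarrow> 'k mpoly) \<Rightarrow>
    nat \<Rightarrow> (nat \<Rightarrow> 'k mpoly) \<Rightarrow> nat \<Rightarrow> 'k mpoly" where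
  "aug_map ds aug D q =
    apply_mat (length (aug_shifts ds q)) (length (aug_shifts ds (Suc q))) (aug_matrix aug D q)"

definition var_vectors :: "nat \<Rightarrow> (nat \<Rightarrow> int list) \<Rightarrow> nat \<Rightarrow> nat \<Rightarrow> int \<Rightarrow> (nat \<Rightarrow> 'k::field mpoly) set" where
  "var_vectors n ds i q e = {v \<in> graded_vectors n (aug_shifts ds q) e. \<forall>b. v b \<in> var_ideal i}"

lemma aug_map_0: "aug_map ds aug D 0 v = (\<lambda>a. if a = 0 then \<Sum>b<length (ds 0). aug b * v b else 0)"
  by (rule ext) (simp add: aug_map_def apply_mat_def aug_shifts_def aug_matrix_def)

lemma aug_map_Suc: "aug_map ds aug D (Suc q) = apply_mat (length (ds q)) (length (ds (Suc q))) (D q)"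
  by (simp add: aug_map_def aug_shifts_def aug_matrix_def)

lemma resolution_exact:
  assumes res: "graded_free_resolution n K ds aug D"
  shows "{v \<in> free_mod n (length (aug_shifts ds (Suc q))). aug_map ds aug D q v = 0} =
      aug_map ds aug D (Suc q) ` free_mod n (length (aug_shifts ds (Suc (Suc q))))"
proof (cases q)
  case 0
  have "aug_map ds aug D 0 v = 0 \<longleftrightarrow> (\<Sum>b<length (ds 0). aug b * v b) = 0" for v
    unfolding aug_map_0 by (auto simp: fun_eq_iff)
  moreover have "{v \<in> free_mod n (length (ds 0)). (\<Sum>b<length (ds 0). aug b * v b) = 0} =
      apply_mat (length (ds 0)) (length (ds 1)) (D 0) ` free_mod n (length (ds 1))"
    using res unfolding graded_free_resolution_def Let_def by simp
  ultimately show ?thesis by (simp add: 0 aug_map_Suc aug_shifts_def)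
next
  case (Suc q')
  show ?thesis
    using res unfolding graded_free_resolution_def Let_def by (simp add: Suc aug_map_Suc aug_shifts_def)
qed

lemma resolution_homog_matrix:
  assumes res: "graded_free_resolution n K ds aug D"
  shows "homog_matrix n (aug_shifts ds q) (aug_shifts ds (Suc q)) (aug_matrix aug D q)"
  using res unfolding graded_free_resolution_def Let_def homog_matrix_def aug_shifts_def aug_matrix_def
  by (cases q) auto

lemma resolution_graded_complex:
  assumes res: "graded_free_resolution n K ds aug D"
  shows "graded_complex n (\<lambda>q. graded_vectors n (aug_shifts ds q)) (aug_map ds aug D)
    (\<lambda>i v b. xvar i * v b) (var_vectors n ds)"
proof -
  let ?E = "aug_shifts ds" and ?d = "aug_map ds aug D"
  note hm = resolution_homog_matrix[OF res]
  have mem: "?d q v \<in> graded_vectors n (?E q) e" if "v \<in> graded_vectors n (?E (Suc q)) e" for q v e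
    unfolding aug_map_def by (rule apply_mat_graded[OF hm that])
  have scale: "(\<lambda>b. xvar i * v b) \<in> graded_vectors n (?E q) (e + 1)"
    if "i \<in> {1..n}" "v \<in> graded_vectors n (?E q) e" for i v q e
  proof -
    have "xvar i * v b \<in> homog n (e + 1 - ?E q ! b)" if "b < length (?E q)" for b
      using homog_mult[OF homog_xvar[OF \<open>i \<in> {1..n}\<close>], of "v b" "e - ?E q ! b"] that
        \<open>v \<in> graded_vectors n (?E q) e\<close> by (simp add: graded_vectors_def algebra_simps)
    then show ?thesis using that by (simp add: graded_vectors_def)
  qed
  have diff: "v - w \<in> graded_vectors n (?E q) e"
    if "v \<in> graded_vectors n (?E q) e" "w \<in> graded_vectors n (?E q) e" for v w q e
    using that by (simp add: graded_vectors_def homog_minus)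
  show ?thesis
  proof
    show "\<exists>u\<in>graded_vectors n (?E (Suc (Suc q))) e. ?d (Suc q) u = v"
      if v: "v \<in> graded_vectors n (?E (Suc q)) e" "?d q v = 0" for v q e
    proof -
      have "v \<in> ?d (Suc q) ` free_mod n (length (?E (Suc (Suc q))))"
        using resolution_exact[OF res, of q] v graded_vectors_free by blast
      then obtain u where u: "u \<in> free_mod n (length (?E (Suc (Suc q))))" "?d (Suc q) u = v" by blast
      have "?d (Suc q) (vpart (?E (Suc (Suc q))) e u) = vpart (?E (Suc q)) e v"
        unfolding u(2)[symmetric] aug_map_def by (rule apply_mat_vpart[OF hm])
      then show ?thesis using vpart_graded[OF u(1), of e] vpart_self[OF v(1)] by auto
    qed
    show "?d q (?d (Suc q) u) = 0" if "u \<in> graded_vectors n (?E (Suc (Suc q))) e" for u q e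
      using resolution_exact[OF res, of q] graded_vectors_free[OF that] by blast
    show "?d q (v - w) = ?d q v - ?d q w" for q v w unfolding aug_map_def by (rule apply_mat_diff)
    show "?d q (\<lambda>b. xvar i * v b) = (\<lambda>b. xvar i * ?d q v b)" for q i v
      unfolding aug_map_def by (rule apply_mat_scale)
    show "\<exists>w\<in>graded_vectors n (?E q) (e - 1). v - (\<lambda>b. xvar (Suc i) * w b) \<in> var_vectors n ds i q e"
      if i: "i < n" and v: "v \<in> var_vectors n ds (Suc i) q e" for i v q e
    proof -
      have "\<forall>b. \<exists>w. (if b < length (?E q) then w \<in> homog n (e - ?E q ! b - 1) else w = 0) \<and>
          v b - xvar (Suc i) * w \<in> var_ideal i"
      proof
        fix b
        show "\<exists>w. (if b < length (?E q) then w \<in> homog n (e - ?E q ! b - 1) else w = 0) \<and>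
          v b - xvar (Suc i) * w \<in> var_ideal i"
        proof (cases "b < length (?E q)")
          case True
          then show ?thesis using var_ideal_split[of "v b" i n "e - ?E q ! b"] v
            by (auto simp: var_vectors_def graded_vectors_def)
        next
          case False
          then show ?thesis using v by (auto simp: var_vectors_def graded_vectors_def var_ideal_zero)
        qed
      qed
      from choice[OF this] obtain w where w: "\<And>b. b < length (?E q) \<Longrightarrow> w b \<in> homog n (e - ?E q ! b - 1)"
        "\<And>b. \<not> b < length (?E q) \<Longrightarrow> w b = 0" "\<And>b. v b - xvar (Suc i) * w b \<in> var_ideal i" by metis
      have wG: "w \<in> graded_vectors n (?E q) (e - 1)" using w(1,2) by (simp add: graded_vectors_def algebra_simps)
      have "Suc i \<in> {1..n}" using i by simp
      then have "(\<lambda>b. xvar (Suc i) * w b) \<in> graded_vectors n (?E q) e"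
        using scale[of "Suc i" w q "e - 1"] wG by simp
      then have "v - (\<lambda>b. xvar (Suc i) * w b) \<in> graded_vectors n (?E q) e"
        using diff v unfolding var_vectors_def by blast
      then show ?thesis using wG w(3) by (auto simp: var_vectors_def)
    qed
    show "w \<in> var_vectors n ds i q e"
      if "w \<in> graded_vectors n (?E q) e" "(\<lambda>b. xvar (Suc i) * w b) \<in> var_vectors n ds i q (e + 1)" for i w q e
      using that var_ideal_regular by (auto simp: var_vectors_def)
    show "?d q v \<in> var_vectors n ds i q e" if "v \<in> var_vectors n ds i (Suc q) e" for q v i e
    proof -
      have "?d q v b \<in> var_ideal i" for b
        using that unfolding aug_map_def apply_mat_def
        by (auto simp: var_vectors_def var_ideal_zero intro!: var_ideal_sum var_ideal_mult)
      then show ?thesis using that mem by (simp add: var_vectors_def)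
    qed
    show "(\<lambda>b. xvar i * (v - w) b) = (\<lambda>b. xvar i * v b) - (\<lambda>b. xvar i * w b)" for i and v w :: "nat \<Rightarrow> 'a mpoly"
      by (rule ext) (simp add: right_diff_distrib)
    show "(\<lambda>b. xvar i * (xvar j * v b)) = (\<lambda>b. xvar j * (xvar i * v b))" for i j and v :: "nat \<Rightarrow> 'a mpoly"
      by (rule ext) (simp add: mult.left_commute)
    show "var_vectors n ds 0 q e = {0 :: nat \<Rightarrow> 'a mpoly}" for q e
    proof -
      have "p = 0" if "p \<in> var_ideal 0" for p :: "'a mpoly"
        using that by (intro poly_mapping_eqI) (auto simp: var_ideal_def in_keys_iff)
      then show ?thesis
        by (auto simp: var_vectors_def graded_vectors_def var_ideal_zero fun_eq_iff)
    qed
    show "0 \<in> var_vectors n ds i q e" for i q e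
      by (auto simp: var_vectors_def graded_vectors_def var_ideal_zero)
    show "(\<lambda>b. xvar j * v b) \<in> var_vectors n ds i q (e + 1)"
      if "i \<le> n" "j \<in> {1..i}" "v \<in> graded_vectors n (?E q) e" for i j v q e
    proof -
      have "j \<in> {1..n}" using that(1,2) by auto
      then show ?thesis using scale[OF _ that(3)] by (simp add: var_vectors_def xvar_var_ideal[OF that(2)])
    qed
    show "v \<in> var_vectors n ds (Suc i) q e" if "v \<in> var_vectors n ds i q e" for v i q e
      using that var_ideal_Suc unfolding var_vectors_def by blast
    show "v \<in> graded_vectors n (?E q) e" if "v \<in> var_vectors n ds i q e" for v i q e
      using that unfolding var_vectors_def by blast
    show "v - w \<in> var_vectors n ds i q e" if "v \<in> var_vectors n ds i q e" "w \<in> var_vectors n ds i q e" for v w i q e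
      using that by (simp add: var_vectors_def var_ideal_diff diff)
    show "(\<lambda>b. xvar j * v b) \<in> var_vectors n ds i q (e + 1)"
      if "j \<in> {1..n}" "v \<in> var_vectors n ds i q e" for j v i q e
    proof -
      have "v \<in> graded_vectors n (?E q) e" "\<And>b. v b \<in> var_ideal i" using that(2) by (auto simp: var_vectors_def)
      then show ?thesis using scale[OF that(1)] by (simp add: var_vectors_def var_ideal_mult)
    qed
  qed (fact diff mem scale)+
qed

subsection \<open>Tensoring with the residue field\<close>

definition const_part :: "(nat \<Rightarrow> 'k::field mpoly) \<Rightarrow> nat \<Rightarrow> 'k" where
  "const_part v = (\<lambda>b. lookup (v b) 0)"

lemma lookup_times_0: "lookup (p * q) 0 = lookup p 0 * lookup (q :: 'k::field mpoly) 0"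
proof -
  have "a = 0 \<and> b = 0" if "a + b = 0" for a b :: "nat \<Rightarrow>\<^sub>0 nat"
    using arg_cong[OF that, of mdeg] by (simp add: mdeg_eq_0_iff)
  then have "ab = (0, 0)" if "fst ab + snd ab = 0" for ab :: "(nat \<Rightarrow>\<^sub>0 nat) \<times> (nat \<Rightarrow>\<^sub>0 nat)"
    using that by (metis prod.collapse)
  then have "{ab :: (nat \<Rightarrow>\<^sub>0 nat) \<times> (nat \<Rightarrow>\<^sub>0 nat). fst ab + snd ab = 0} = {(0, 0)}"
    by (intro equalityI subsetI) (simp_all only: mem_Collect_eq singleton_iff fst_conv snd_conv add_0)
  then show ?thesis by (simp add: lookup_times)
qed

lemma const_part_apply_mat:
  "const_part (apply_mat r s M v) = apply_mat r s (\<lambda>a b. lookup (M a b) 0) (const_part v)"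
  by (rule ext) (simp add: const_part_def apply_mat_def lookup_sum lookup_times_0)

lemma const_part_comp: "v \<in> graded_vectors n (ds q) e \<Longrightarrow> const_part v \<in> tensor_comp ds q e"
proof -
  assume v: "v \<in> graded_vectors n (ds q) e"
  have "b < length (ds q) \<and> ds q ! b = e" if "lookup (v b) 0 \<noteq> 0" for b
  proof -
    have b: "b < length (ds q)" using v that by (cases "b < length (ds q)") (auto simp: graded_vectors_def)
    then have "v b \<in> homog n (e - ds q ! b)" using v by (simp add: graded_vectors_def)
    moreover have "0 \<in> keys (v b)" using that by (simp add: in_keys_iff)
    ultimately have "int (mdeg (0 :: nat \<Rightarrow>\<^sub>0 nat)) = e - ds q ! b" unfolding homog_def by blast
    then show ?thesis using b by simp
  qed
  then show ?thesis by (auto simp: tensor_comp_def const_part_def)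
qed

lemma const_vector_graded: "c \<in> tensor_comp ds q e \<Longrightarrow> (\<lambda>b. const (c b)) \<in> graded_vectors n (ds q) e"
proof -
  assume c: "c \<in> tensor_comp ds q e"
  have "const (c b) \<in> homog n (e - ds q ! b)" for b
    using c homog_const[of "c b" n] by (cases "c b = 0") (auto simp: tensor_comp_def)
  moreover have "c b = 0" if "b \<ge> length (ds q)" for b
    using c that by (cases "c b = 0") (auto simp: tensor_comp_def)
  ultimately show ?thesis by (simp add: graded_vectors_def)
qed

lemma const_part_const [simp]: "const_part (\<lambda>b. const (c b)) = c"
  by (rule ext) (simp add: const_part_def const_def)

text \<open>Tensoring with \<open>k\<close> is reduction modulo all variables.\<close>

lemma const_part_zero_iff:
  assumes v: "v \<in> graded_vectors n (aug_shifts ds q) e"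
  shows "v \<in> var_vectors n ds n q e \<longleftrightarrow> const_part v = 0"
proof
  assume "v \<in> var_vectors n ds n q e"
  then have *: "keys m \<inter> {1..n} \<noteq> {}" if "m \<in> keys (v b)" for b m
    using that unfolding var_vectors_def var_ideal_def by blast
  have "0 \<notin> keys (v b)" for b using *[of 0 b] by auto
  then show "const_part v = 0" by (auto simp: const_part_def fun_eq_iff in_keys_iff)
next
  assume z: "const_part v = 0"
  have "v b \<in> var_ideal n" for b
    unfolding var_ideal_def
  proof (intro CollectI ballI)
    fix m assume m: "m \<in> keys (v b)"
    have "keys m \<subseteq> {1..n}" using m v
      by (cases "b < length (aug_shifts ds q)") (auto simp: graded_vectors_def homog_def polys_def)
    moreover have "m \<noteq> 0" using m fun_cong[OF z, of b] by (auto simp: const_part_def in_keys_iff)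
    ultimately show "keys m \<inter> {1..n} \<noteq> {}" by (simp add: Int_absorb2)
  qed
  then show "v \<in> var_vectors n ds n q e" using v by (simp add: var_vectors_def)
qed

interpretation fun_space: vector_space "\<lambda>(c :: 'k::field) (v :: nat \<Rightarrow> 'k) b. c * v b"
  by unfold_locales (auto simp: fun_eq_iff algebra_simps)

text \<open>The space of all functions has infinite dimension, but \<open>Z\<close> is contained in the span of a
  finite set, so an element of \<open>Z\<close> outside \<open>B\<close> would enlarge a basis of \<open>B\<close> and make the
  dimensions differ.\<close>

lemma dim_diff_zero_iff:
  fixes B Z :: "(nat \<Rightarrow> 'k::field) set"
  assumes B: "fun_space.subspace B" "B \<subseteq> Z" and Z: "Z \<subseteq> fun_space.span W" "finite W"
  shows "kdim Z - kdim B = 0 \<longleftrightarrow> Z \<subseteq> B"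
proof
  assume le: "kdim Z - kdim B = 0"
  obtain bB where bB: "bB \<subseteq> B" "fun_space.independent bB" "B \<subseteq> fun_space.span bB" "card bB = kdim B"
    using fun_space.basis_exists by blast
  obtain bZ where bZ: "bZ \<subseteq> Z" "fun_space.independent bZ" "Z \<subseteq> fun_space.span bZ" "card bZ = kdim Z"
    using fun_space.basis_exists by blast
  have fZ: "finite bZ" using fun_space.independent_span_bound[OF Z(2) bZ(2)] bZ(1) Z(1) by blast
  show "Z \<subseteq> B"
  proof (rule ccontr)
    assume "\<not> Z \<subseteq> B"
    then obtain z where z: "z \<in> Z" "z \<notin> B" by blast
    have "fun_space.span bB \<subseteq> B" by (rule fun_space.span_minimal[OF bB(1) B(1)])
    then have ind: "fun_space.independent (insert z bB)"
      using z(2) bB(2) by (intro fun_space.independent_insertI) auto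
    have "insert z bB \<subseteq> fun_space.span bZ" using z(1) bB(1) B(2) bZ(3) by blast
    then have c: "finite (insert z bB)" "card (insert z bB) \<le> card bZ"
      using fun_space.independent_span_bound[OF fZ ind] by auto
    moreover have "z \<notin> bB" using z(2) bB(1) by blast
    ultimately show False using le bB(4) bZ(4) by simp
  qed
next
  assume "Z \<subseteq> B"
  then have "Z = B" using B(2) by blast
  then show "kdim Z - kdim B = 0" by simp
qed

lemma tensor_comp_span:
  "\<exists>W. finite W \<and> tensor_comp ds q e \<subseteq> fun_space.span (W :: (nat \<Rightarrow> 'k::field) set)"
proof (intro exI conjI)
  define u where "u b = (\<lambda>b'. if b' = b then 1 else 0 :: 'k)" for b :: nat
  show "finite (u ` {..<length (ds q)})" by simp
  show "tensor_comp ds q e \<subseteq> fun_space.span (u ` {..<length (ds q)})"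
  proof
    fix v :: "nat \<Rightarrow> 'k" assume v: "v \<in> tensor_comp ds q e"
    have vb: "v b = 0" if "\<not> b < length (ds q)" for b
      using v that by (auto simp: tensor_comp_def)
    have "(\<Sum>b<length (ds q). (\<lambda>b'. v b * u b b')) \<in> fun_space.span (u ` {..<length (ds q)})"
      by (intro fun_space.span_sum fun_space.span_scale fun_space.span_base) auto
    moreover have "(\<Sum>b<length (ds q). (\<lambda>b'. v b * u b b')) = v"
    proof (rule ext)
      fix b'
      have "(\<Sum>b\<in>A. (\<lambda>b'. v b * u b b')) b' = (\<Sum>b\<in>A. v b * u b b')" for A
        by (induction A rule: infinite_finite_induct) auto
      moreover have "(\<Sum>b<length (ds q). v b * u b b') = (\<Sum>b<length (ds q). if b = b' then v b' else 0)"
        by (rule sum.cong) (auto simp: u_def)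
      ultimately have "(\<Sum>b<length (ds q). (\<lambda>b'. v b * u b b')) b' = (\<Sum>b<length (ds q). if b = b' then v b' else 0)"
        by simp
      then show "(\<Sum>b<length (ds q). (\<lambda>b'. v b * u b b')) b' = v b'" using vb[of b'] by simp
    qed
    ultimately show "v \<in> fun_space.span (u ` {..<length (ds q)})" by simp
  qed
qed

lemma tensor_diff_const_part:
  "const_part (aug_map ds aug D (Suc q) v) = tensor_diff ds D q (const_part v)"
  by (simp add: aug_map_Suc const_part_apply_mat tensor_diff_def)

text \<open>Position \<open>n - 1\<close> of a resolution of \<open>K\<close> is position \<open>n\<close> of the one of \<open>R/K\<close>. Constant terms
  turn cycles and boundaries modulo all variables into those of the complex tensored with \<open>k\<close>, and
  the diagram chase applies.\<close>

lemma betti_resolution_zero_iff: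
  fixes K :: "'k::field mpoly set"
  assumes n: "n \<ge> 2" and res: "graded_free_resolution n K ds aug D"
  shows "kdim (tensor_cycles ds D (n - 1) e) - kdim (tensor_boundaries ds D (n - 1) e) = 0 \<longleftrightarrow>
    (\<forall>a\<in>homog n (e - int n). (\<forall>j\<in>{1..n}. xvar j * a \<in> K) \<longrightarrow> a \<in> K)"
proof -
  interpret graded_complex n "\<lambda>q. graded_vectors n (aug_shifts ds q)" "aug_map ds aug D"
    "\<lambda>i v b. xvar i * v b" "var_vectors n ds"
    by (rule resolution_graded_complex[OF res])
  let ?G = "\<lambda>q. graded_vectors n (aug_shifts ds q)" and ?d = "aug_map ds aug D"
  define q where "q = n - 2"
  have nq: "n = Suc (Suc q)" "n - 1 = Suc q" using n by (auto simp: q_def)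
  have top: "cycles n n e = cycles n (Suc (Suc q)) e" "boundaries n n e = boundaries n (Suc (Suc q)) e"
    by (rule arg_cong[OF nq(1), of "\<lambda>p. cycles n p e"], rule arg_cong[OF nq(1), of "\<lambda>p. boundaries n p e"])
  have G: "?G (Suc p) = graded_vectors n (ds p)" for p by (simp add: aug_shifts_def)
  have comp: "const_part v \<in> tensor_comp ds p e" if "v \<in> ?G (Suc p) e" for v p
    using that const_part_comp unfolding G by blast
  have vec: "(\<lambda>b. const (c b)) \<in> ?G (Suc p) e" if "c \<in> tensor_comp ds p e" for c p
    using that const_vector_graded unfolding G by blast
  have diff: "const_part (v - w) = const_part v - const_part w" for v w :: "nat \<Rightarrow> 'k mpoly"
    by (rule ext) (simp add: const_part_def lookup_minus)
  have cyc: "tensor_cycles ds D (n - 1) e = {c \<in> tensor_comp ds (Suc q) e. tensor_diff ds D q c = 0}"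
    unfolding tensor_cycles_def nq(2) by auto
  have bnd: "tensor_boundaries ds D (n - 1) e = tensor_diff ds D (Suc q) ` tensor_comp ds (Suc (Suc q)) e"
    unfolding tensor_boundaries_def nq(2) by simp
  have sub: "tensor_boundaries ds D (n - 1) e \<subseteq> tensor_cycles ds D (n - 1) e"
  proof
    fix c assume "c \<in> tensor_boundaries ds D (n - 1) e"
    then obtain c' where c': "c' \<in> tensor_comp ds (Suc (Suc q)) e" "c = tensor_diff ds D (Suc q) c'"
      unfolding bnd by blast
    define u where "u = (\<lambda>b. const (c' b))"
    have u: "u \<in> ?G (Suc (Suc (Suc q))) e" "const_part u = c'" using vec[OF c'(1)] by (auto simp: u_def)
    have du: "?d (Suc (Suc q)) u \<in> ?G (Suc (Suc q)) e" by (rule \<delta>_mem[OF u(1)])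
    have c: "c = const_part (?d (Suc (Suc q)) u)" by (simp add: c'(2) tensor_diff_const_part u(2))
    have "tensor_diff ds D q c = const_part (?d (Suc q) (?d (Suc (Suc q)) u))"
      unfolding c tensor_diff_const_part[of ds aug D q] by (rule refl)
    also have "\<dots> = 0" unfolding \<delta>_\<delta>[OF u(1)] by (rule ext) (simp add: const_part_def)
    finally show "c \<in> tensor_cycles ds D (n - 1) e" unfolding cyc using comp[OF du] c by simp
  qed
  have "fun_space.subspace (tensor_boundaries ds D (n - 1) e)"
    unfolding fun_space.subspace_def
  proof (intro conjI ballI allI)
    have add: "tensor_diff ds D p (v + w) = tensor_diff ds D p v + tensor_diff ds D p w" for p v w
      by (rule ext) (simp add: tensor_diff_def apply_mat_def distrib_left sum.distrib)
    have scl: "tensor_diff ds D p (\<lambda>b. c * v b) = (\<lambda>b. c * tensor_diff ds D p v b)" for p c v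
      unfolding tensor_diff_def by (rule apply_mat_scale)
    have "tensor_diff ds D (Suc q) 0 = 0" using add[of "Suc q" 0 0] by simp
    moreover have "0 \<in> tensor_comp ds (Suc (Suc q)) e" by (simp add: tensor_comp_def)
    ultimately show "0 \<in> tensor_boundaries ds D (n - 1) e" unfolding bnd by (metis imageI)
    fix v assume "v \<in> tensor_boundaries ds D (n - 1) e"
    then obtain v' where v': "v' \<in> tensor_comp ds (Suc (Suc q)) e" "v = tensor_diff ds D (Suc q) v'"
      unfolding bnd by blast
    show "v + w \<in> tensor_boundaries ds D (n - 1) e" if "w \<in> tensor_boundaries ds D (n - 1) e" for w
    proof -
      obtain w' where w': "w' \<in> tensor_comp ds (Suc (Suc q)) e" "w = tensor_diff ds D (Suc q) w'"
        using \<open>w \<in> _\<close> unfolding bnd by blast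
      have "v' b \<noteq> 0 \<or> w' b \<noteq> 0" if "(v' + w') b \<noteq> 0" for b using that by auto
      then have "v' + w' \<in> tensor_comp ds (Suc (Suc q)) e"
        using v'(1) w'(1) unfolding tensor_comp_def by blast
      then show ?thesis unfolding bnd v'(2) w'(2) add[symmetric] by (rule imageI)
    qed
    show "(\<lambda>b. c * v b) \<in> tensor_boundaries ds D (n - 1) e" for c
    proof -
      have "(\<lambda>b. c * v' b) \<in> tensor_comp ds (Suc (Suc q)) e"
        using v'(1) by (auto simp: tensor_comp_def)
      then show ?thesis unfolding bnd v'(2) scl[symmetric] by (rule imageI)
    qed
  qed
  moreover obtain W where "finite W" "tensor_comp ds (Suc q) e \<subseteq> fun_space.span (W :: (nat \<Rightarrow> 'k) set)"
    using tensor_comp_span by metis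
  then have "tensor_cycles ds D (n - 1) e \<subseteq> fun_space.span W" "finite W" unfolding cyc by auto
  ultimately have "kdim (tensor_cycles ds D (n - 1) e) - kdim (tensor_boundaries ds D (n - 1) e) = 0 \<longleftrightarrow>
      tensor_cycles ds D (n - 1) e \<subseteq> tensor_boundaries ds D (n - 1) e"
    using dim_diff_zero_iff sub by blast
  also have "\<dots> \<longleftrightarrow> cycles n n e \<subseteq> boundaries n n e"
  proof
    assume tc: "tensor_cycles ds D (n - 1) e \<subseteq> tensor_boundaries ds D (n - 1) e"
    show "cycles n n e \<subseteq> boundaries n n e"
    proof
      fix z assume "z \<in> cycles n n e"
      then have z: "z \<in> ?G (Suc (Suc q)) e" "?d (Suc q) z \<in> var_vectors n ds n (Suc q) e"
        unfolding top by (auto simp: cycles_def)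
      have "const_part (?d (Suc q) z) = 0" using const_part_zero_iff[OF P_G[OF z(2)]] z(2) by blast
      then have "const_part z \<in> tensor_cycles ds D (n - 1) e"
        unfolding cyc using comp[OF z(1)] by (simp add: tensor_diff_const_part)
      then obtain c where c: "c \<in> tensor_comp ds (Suc (Suc q)) e" "const_part z = tensor_diff ds D (Suc q) c"
        using tc unfolding bnd by blast
      define u where "u = (\<lambda>b. const (c b))"
      have u: "u \<in> ?G (Suc (Suc (Suc q))) e" "const_part u = c" using vec[OF c(1)] by (auto simp: u_def)
      have "z - ?d (Suc (Suc q)) u \<in> ?G (Suc (Suc q)) e" by (rule G_diff[OF z(1) \<delta>_mem[OF u(1)]])
      moreover have "const_part (z - ?d (Suc (Suc q)) u) = 0"
        by (simp add: diff tensor_diff_const_part u(2) c(2))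
      ultimately have "z - ?d (Suc (Suc q)) u \<in> var_vectors n ds n (Suc (Suc q)) e"
        using const_part_zero_iff by blast
      then have "z \<in> boundaries n (Suc (Suc q)) e" using u(1) by (auto simp: boundaries_def)
      then show "z \<in> boundaries n n e" unfolding top .
    qed
  next
    assume cb: "cycles n n e \<subseteq> boundaries n n e"
    show "tensor_cycles ds D (n - 1) e \<subseteq> tensor_boundaries ds D (n - 1) e"
    proof
      fix c assume "c \<in> tensor_cycles ds D (n - 1) e"
      then have c: "c \<in> tensor_comp ds (Suc q) e" "tensor_diff ds D q c = 0" unfolding cyc by auto
      define z where "z = (\<lambda>b. const (c b))"
      have z: "z \<in> ?G (Suc (Suc q)) e" "const_part z = c" using vec[OF c(1)] by (auto simp: z_def)
      have "const_part (?d (Suc q) z) = 0" by (simp add: tensor_diff_const_part z(2) c(2))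
      then have "?d (Suc q) z \<in> var_vectors n ds n (Suc q) e"
        using const_part_zero_iff[OF \<delta>_mem[OF z(1)]] by blast
      then have "z \<in> cycles n (Suc (Suc q)) e" using z(1) by (simp add: cycles_def)
      then have "z \<in> boundaries n (Suc (Suc q)) e" using cb unfolding top by blast
      then obtain u where u: "u \<in> ?G (Suc (Suc (Suc q))) e" "z - ?d (Suc (Suc q)) u \<in> var_vectors n ds n (Suc (Suc q)) e"
        by (auto simp: boundaries_def)
      have "const_part (z - ?d (Suc (Suc q)) u) = 0" using const_part_zero_iff[OF P_G[OF u(2)]] u(2) by blast
      then have "c = tensor_diff ds D (Suc q) (const_part u)"
        by (simp add: diff tensor_diff_const_part z(2))
      then show "c \<in> tensor_boundaries ds D (n - 1) e" unfolding bnd using comp[OF u(1)] by blast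
    qed
  qed
  also have "\<dots> \<longleftrightarrow> (\<forall>a\<in>homog n (e - int n). (\<forall>j\<in>{1..n}. xvar j * a \<in> K) \<longrightarrow> a \<in> K)"
  proof -
    define vect where "vect a = (\<lambda>b :: nat. if b = 0 then a else 0 :: 'k mpoly)" for a
    have G0: "?G 0 c = vect ` homog n c" for c
    proof -
      have "v \<in> vect ` homog n c" if "v \<in> ?G 0 c" for v
      proof -
        have "v 0 \<in> homog n c" "\<And>b. b \<ge> 1 \<Longrightarrow> v b = 0" using that by (auto simp: graded_vectors_def aug_shifts_def)
        moreover from this have "v = vect (v 0)" by (auto simp: vect_def fun_eq_iff)
        ultimately show ?thesis by blast
      qed
      then show ?thesis by (auto simp: vect_def graded_vectors_def aug_shifts_def)
    qed
    have aug: "(\<lambda>v. \<Sum>b<length (ds 0). aug b * v b) ` free_mod n (length (ds 0)) = K"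
      using res unfolding graded_free_resolution_def Let_def by blast
    have im: "vect a \<in> image_deg c \<longleftrightarrow> a \<in> K" if a: "a \<in> homog n c" for a c
    proof
      assume "vect a \<in> image_deg c"
      then obtain u where u: "u \<in> graded_vectors n (ds 0) c" "vect a = ?d 0 u"
        unfolding image_deg_def One_nat_def G by blast
      have "a = (\<Sum>b<length (ds 0). aug b * u b)" using fun_cong[OF u(2), of 0] by (simp add: vect_def aug_map_0)
      then show "a \<in> K" using aug graded_vectors_free[OF u(1)] by blast
    next
      assume "a \<in> K"
      then obtain u where u: "u \<in> free_mod n (length (ds 0))" "a = (\<Sum>b<length (ds 0). aug b * u b)"
        using aug by blast
      have "vect a = ?d 0 u" by (auto simp: vect_def aug_map_0 u(2))
      moreover have "vect a \<in> ?G 0 c" using a unfolding G0 by blast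
      ultimately have "?d 0 (vpart (ds 0) c u) = vect a"
        using apply_mat_vpart[OF resolution_homog_matrix[OF res, of 0], of c u] vpart_self[of "vect a" n "aug_shifts ds 0" c]
        by (simp add: aug_map_def aug_shifts_def)
      moreover have "vpart (ds 0) c u \<in> ?G 1 c" unfolding One_nat_def G by (rule vpart_graded[OF u(1)])
      ultimately show "vect a \<in> image_deg c" unfolding image_deg_def by (metis imageI)
    qed
    have "(\<lambda>b. xvar j * vect a b) = vect (xvar j * a)" for j a by (auto simp: vect_def)
    then have xim: "(\<lambda>b. xvar j * vect a b) \<in> image_deg (e - int n + 1) \<longleftrightarrow> xvar j * a \<in> K"
      if "a \<in> homog n (e - int n)" "j \<in> {1..n}" for j a
      using im[of "xvar j * a" "e - int n + 1"] homog_mult[OF homog_xvar[OF that(2)] that(1)]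
      by (simp add: add.commute)
    show ?thesis
      unfolding cycles_boundaries_iff_socle G0 ball_simps
    proof (rule ball_cong[OF refl])
      fix a :: "'k mpoly" assume a: "a \<in> homog n (e - int n)"
      show "((\<forall>j\<in>{1..n}. (\<lambda>b. xvar j * vect a b) \<in> image_deg (e - int n + 1)) \<longrightarrow> vect a \<in> image_deg (e - int n)) \<longleftrightarrow>
          ((\<forall>j\<in>{1..n}. xvar j * a \<in> K) \<longrightarrow> a \<in> K)"
        using im[OF a] xim[OF a] by blast
    qed
  qed
  finally show ?thesis .
qed

theorem graded_betti_zero_iff_socle:
  fixes K :: "'k::field mpoly set"
  assumes n: "n \<ge> 2" and ex: "\<exists>ds aug D. graded_free_resolution n K ds aug D"
  shows "graded_betti n K (n - 1) e = 0 \<longleftrightarrow>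
    (\<forall>a\<in>homog n (e - int n). (\<forall>j\<in>{1..n}. xvar j * a \<in> K) \<longrightarrow> a \<in> K)"
proof -
  have "\<exists>\<beta>. \<exists>ds aug D. graded_free_resolution n K ds aug D \<and>
     \<beta> = kdim (tensor_cycles ds D (n - 1) e) - kdim (tensor_boundaries ds D (n - 1) e)"
    using ex by blast
  then have "\<exists>ds aug D. graded_free_resolution n K ds aug D \<and>
     graded_betti n K (n - 1) e = kdim (tensor_cycles ds D (n - 1) e) - kdim (tensor_boundaries ds D (n - 1) e)"
    unfolding graded_betti_def by (rule someI_ex)
  then show ?thesis using betti_resolution_zero_iff[OF n] by metis
qed

section \<open>Existence of graded free resolutions\<close>

lemma nat_mono_subseq:
  fixes f :: "nat \<Rightarrow> nat"
  shows "\<exists>r :: nat \<Rightarrow> nat. strict_mono r \<and> (\<forall>i j. i \<le> j \<longrightarrow> f (r i) \<le> f (r j))"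
proof -
  obtain r :: "nat \<Rightarrow> nat" where r: "strict_mono r" "monoseq (\<lambda>k. f (r k))" using seq_monosub by blast
  show ?thesis
  proof (cases "\<forall>m. \<forall>k\<ge>m. f (r m) \<le> f (r k)")
    case True
    then show ?thesis using r(1) by (intro exI[of _ r]) simp
  next
    case False
    then have dec: "\<And>m k. m \<le> k \<Longrightarrow> f (r k) \<le> f (r m)" using r(2) unfolding monoseq_def by blast
    obtain k0 where k0: "\<And>k. f (r k0) \<le> f (r k)" using ex_has_least_nat[of "\<lambda>_. True" 0 "\<lambda>k. f (r k)"] by blast
    have const: "f (r (k0 + k)) = f (r k0)" for k using k0[of "k0 + k"] dec[of k0 "k0 + k"] by simp
    have "strict_mono (\<lambda>k. r (k0 + k))" using r(1) by (simp add: strict_mono_def)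
    then show ?thesis using const by (intro exI[of _ "\<lambda>k. r (k0 + k)"]) simp
  qed
qed

lemma monomial_mono_subseq:
  fixes f :: "nat \<Rightarrow> nat \<Rightarrow>\<^sub>0 nat"
  shows "\<exists>r :: nat \<Rightarrow> nat. strict_mono r \<and> (\<forall>l\<in>{1..n}. \<forall>i j. i \<le> j \<longrightarrow> lookup (f (r i)) l \<le> lookup (f (r j)) l)"
proof (induction n)
  case 0
  have "strict_mono (\<lambda>k :: nat. k)" by (simp add: strict_mono_def)
  then show ?case by (intro exI[of _ "\<lambda>k. k"]) simp
next
  case (Suc n)
  then obtain r :: "nat \<Rightarrow> nat" where r: "strict_mono r" "\<forall>l\<in>{1..n}. \<forall>i j. i \<le> j \<longrightarrow> lookup (f (r i)) l \<le> lookup (f (r j)) l"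
    by (elim exE conjE)
  obtain r' :: "nat \<Rightarrow> nat" where r': "strict_mono r'" "\<forall>i j. i \<le> j \<longrightarrow> lookup (f (r (r' i))) (Suc n) \<le> lookup (f (r (r' j))) (Suc n)"
    using nat_mono_subseq[of "\<lambda>k. lookup (f (r k)) (Suc n)"] by (elim exE conjE)
  have "lookup (f (r (r' i))) l \<le> lookup (f (r (r' j))) l" if "l \<in> {1..Suc n}" "i \<le> j" for l i j
  proof (cases "l = Suc n")
    case True
    then show ?thesis using r'(2) that(2) by blast
  next
    case False
    then have "l \<in> {1..n}" using that(1) by auto
    moreover have "r' i \<le> r' j" using r'(1) that(2) by (simp add: strict_mono_less_eq)
    ultimately show ?thesis using r(2) by blast
  qed
  moreover have "strict_mono (\<lambda>k. r (r' k))" using r(1) r'(1) by (simp add: strict_mono_def)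
  ultimately show ?case by (intro exI[of _ "\<lambda>k. r (r' k)"]) blast
qed

text \<open>Dickson's lemma. The minimal elements of \<open>T\<close> generate it, and infinitely many of them would
  contain a sequence along which every exponent is weakly increasing.\<close>

lemma finite_monomial_basis:
  fixes T :: "(nat \<Rightarrow>\<^sub>0 nat) set"
  assumes T: "\<And>m. m \<in> T \<Longrightarrow> keys m \<subseteq> {1..n}"
  shows "\<exists>B\<subseteq>T. finite B \<and> (\<forall>m\<in>T. \<exists>b\<in>B. \<exists>u. m = u + b)"
proof -
  define B where "B = {b \<in> T. \<forall>m\<in>T. (\<exists>u. b = u + m) \<longrightarrow> m = b}"
  have "finite B"
  proof (rule ccontr)
    assume "infinite B"
    then obtain f :: "nat \<Rightarrow> nat \<Rightarrow>\<^sub>0 nat" where f: "inj f" "range f \<subseteq> B" using infinite_countable_subset by blast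
    obtain r :: "nat \<Rightarrow> nat" where r: "strict_mono r" "\<forall>l\<in>{1..n}. \<forall>i j. i \<le> j \<longrightarrow> lookup (f (r i)) l \<le> lookup (f (r j)) l"
      using monomial_mono_subseq[of n f] by (elim exE conjE)
    have fT: "f k \<in> T" for k using f(2) by (auto simp: B_def)
    have "lookup (f (r 0)) l \<le> lookup (f (r 1)) l" for l
    proof (cases "l \<in> {1..n}")
      case True
      then show ?thesis using r(2) by simp
    next
      case False
      then have "l \<notin> keys (f (r 0))" using T[OF fT[of "r 0"]] by blast
      then show ?thesis by (simp add: in_keys_iff)
    qed
    then have "f (r 1) = (f (r 1) - f (r 0)) + f (r 0)"
      by (intro poly_mapping_eqI) (simp add: lookup_add lookup_minus)
    then have "f (r 0) = f (r 1)" using f(2) fT[of "r 0"] by (auto simp: B_def image_subset_iff)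
    then have "r 0 = r 1" using f(1) by (simp add: inj_def)
    then show False using strict_monoD[OF r(1), of 0 1] by simp
  qed
  moreover have "\<exists>b\<in>B. \<exists>u. m = u + b" if m: "m \<in> T" for m
  proof -
    have "m \<in> {b \<in> T. \<exists>u. m = u + b}" using m by (auto intro: exI[of _ 0])
    then obtain b where b: "b \<in> T" "\<exists>u. m = u + b" "\<And>b'. b' \<in> T \<Longrightarrow> \<exists>u. m = u + b' \<Longrightarrow> mdeg b \<le> mdeg b'"
      using ex_has_least_nat[of "\<lambda>b. b \<in> {b \<in> T. \<exists>u. m = u + b}" m mdeg] by blast
    have "b \<in> B" unfolding B_def
    proof (intro CollectI conjI b(1) ballI impI)
      fix m' assume m': "m' \<in> T" "\<exists>u. b = u + m'"
      then obtain u where u: "b = u + m'" by blast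
      obtain w where "m = w + b" using b(2) by blast
      then have "m = (w + u) + m'" by (simp add: u add.assoc)
      then have "mdeg b \<le> mdeg m'" using b(3) m'(1) by blast
      then have "u = 0" by (simp add: u mdeg_eq_0_iff)
      then show "m' = b" by (simp add: u)
    qed
    then show ?thesis using b(2) by blast
  qed
  ultimately show ?thesis by (intro exI[of _ B]) (auto simp: B_def)
qed

text \<open>The leading monomials are generated by finitely many of them, and every element can be
  reduced by the corresponding polynomials. Generation is expressed by the universal property,
  that every set closed under the ideal operations and containing the generators contains the
  ideal: in this form the induction on the rank below does not have to combine coefficients.\<close>

lemma graded_ideal_finite_basis:
  assumes K: "graded_ideal n K"
  shows "\<exists>S. finite S \<and> S \<subseteq> K \<and> (\<forall>p\<in>S. \<exists>d. p \<in> homog n (int d)) \<and>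
    (\<forall>Q. 0 \<in> Q \<longrightarrow> (\<forall>p\<in>Q. \<forall>q\<in>Q. p + q \<in> Q) \<longrightarrow> (\<forall>r\<in>polys {1..n}. \<forall>p\<in>Q. r * p \<in> Q) \<longrightarrow> S \<subseteq> Q \<longrightarrow> K \<subseteq> Q)"
proof -
  note K' = graded_idealD[OF K]
  obtain B where B: "B \<subseteq> lms K" "finite B" "\<forall>m\<in>lms K. \<exists>b\<in>B. \<exists>u. m = u + b"
    using finite_monomial_basis[of "lms K" n] lms_keys[OF K] by blast
  have "\<forall>b\<in>B. \<exists>p. p \<in> K \<and> p \<in> homog n (int (mdeg b)) \<and> is_leading p b"
  proof
    fix b assume "b \<in> B"
    then have "b \<in> lm_deg n K (mdeg b)" using B(1) lms_graded[OF K] by blast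
    then show "\<exists>p. p \<in> K \<and> p \<in> homog n (int (mdeg b)) \<and> is_leading p b" by (auto simp: lm_deg_def lms_def)
  qed
  from bchoice[OF this] obtain p where p: "\<And>b. b \<in> B \<Longrightarrow> p b \<in> K"
    "\<And>b. b \<in> B \<Longrightarrow> p b \<in> homog n (int (mdeg b))" "\<And>b. b \<in> B \<Longrightarrow> is_leading (p b) b" by blast
  show ?thesis
  proof (intro exI[of _ "p ` B"] conjI allI impI)
    show "finite (p ` B)" "p ` B \<subseteq> K" "\<forall>q\<in>p ` B. \<exists>d. q \<in> homog n (int d)" using B(2) p by auto
    fix Q assume Q: "0 \<in> Q" "\<forall>a\<in>Q. \<forall>b\<in>Q. a + b \<in> Q" "\<forall>r\<in>polys {1..n}. \<forall>a\<in>Q. r * a \<in> Q" "p ` B \<subseteq> Q"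
    have lin: "linear_space Q" unfolding linear_space_def using Q(1-3) polys_const by blast
    have homog_Q: "K \<inter> homog n (int d) \<subseteq> Q" for d
    proof -
      have "K \<inter> homog n (int d) \<subseteq> Q \<inter> (K \<inter> homog n (int d))"
      proof (rule subset_if_lms_subset[OF linear_space_deg[OF K] Int_lower2])
        show "linear_space (Q \<inter> (K \<inter> homog n (int d)))"
          by (intro linear_space_Int lin graded_ideal_linear[OF K] linear_space_homog)
        show "lms (K \<inter> homog n (int d)) \<subseteq> lms (Q \<inter> (K \<inter> homog n (int d)))"
        proof
          fix m assume m: "m \<in> lms (K \<inter> homog n (int d))"
          then have mK: "m \<in> lms K" "m \<in> mons n d" using lms_mono[of "K \<inter> homog n (int d)" K] lm_deg_subset[of n K d]
            by (auto simp: lm_deg_def)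
          obtain b u where b: "b \<in> B" "m = u + b" using B(3) mK(1) by blast
          have km: "keys m \<subseteq> {1..n}" "mdeg m = d" using mK(2) by (simp_all add: mons_def)
          have u: "keys u \<subseteq> {1..n}" using km(1) unfolding b(2) keys_plus_nat by blast
          then have xu: "xmonom u \<in> polys {1..n}" by (simp only: polys_xmonom)
          have "xmonom u * p b \<in> Q" using Q(3,4) xu b(1) by blast
          moreover have "xmonom u * p b \<in> K" by (rule K'(4)[OF xu p(1)[OF b(1)]])
          moreover have "xmonom u * p b \<in> homog n (int (mdeg u) + int (mdeg b))"
            by (rule homog_mult[OF _ p(2)[OF b(1)]]) (use u in \<open>simp only: homog_xmonom simp_thms\<close>)
          moreover have "int (mdeg u) + int (mdeg b) = int d" using km(2) by (simp add: b(2))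
          moreover have "is_leading (xmonom u * p b) m" using p(3)[OF b(1)] b(2) leading_xmonom_mult by blast
          ultimately show "m \<in> lms (Q \<inter> (K \<inter> homog n (int d)))" unfolding lms_def by auto
        qed
      qed auto
      then show ?thesis by blast
    qed
    show "K \<subseteq> Q"
    proof
      fix q assume q: "q \<in> K"
      then have qR: "q \<in> polys {1..n}" using K'(1) by blast
      from polys_hparts[OF this] obtain D where D: "finite D" "q = (\<Sum>d\<in>D. hpart d q)" by (elim exE conjE)
      have "hpart d q \<in> Q" for d using homog_Q[of d] K'(5)[OF q] hpart_homog[OF qR] by blast
      then have "(\<Sum>d\<in>D. hpart d q) \<in> Q" by (rule linear_space_sum[OF lin])
      then show "q \<in> Q" using D(2) by simp
    qed
  qed
qed

definition submodule :: "nat \<Rightarrow> (nat \<Rightarrow> 'k::field mpoly) set \<Rightarrow> bool" where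
  "submodule n N \<longleftrightarrow> 0 \<in> N \<and> (\<forall>v\<in>N. \<forall>w\<in>N. v + w \<in> N) \<and> (\<forall>r\<in>polys {1..n}. \<forall>v\<in>N. (\<lambda>b. r * v b) \<in> N)"

definition graded_submodule :: "nat \<Rightarrow> int list \<Rightarrow> (nat \<Rightarrow> 'k::field mpoly) set \<Rightarrow> bool" where
  "graded_submodule n ds N \<longleftrightarrow> submodule n N \<and> N \<subseteq> free_mod n (length ds) \<and> (\<forall>v\<in>N. \<forall>e. vpart ds e v \<in> N)"

lemma submoduleD:
  assumes "submodule n N"
  shows "0 \<in> N" "v \<in> N \<Longrightarrow> w \<in> N \<Longrightarrow> v + w \<in> N" "r \<in> polys {1..n} \<Longrightarrow> v \<in> N \<Longrightarrow> (\<lambda>b. r * v b) \<in> N"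
    "v \<in> N \<Longrightarrow> w \<in> N \<Longrightarrow> v - w \<in> N"
proof -
  show 1: "v \<in> N \<Longrightarrow> w \<in> N \<Longrightarrow> v + w \<in> N" and 2: "r \<in> polys {1..n} \<Longrightarrow> v \<in> N \<Longrightarrow> (\<lambda>b. r * v b) \<in> N" for v w r
    using assms by (auto simp: submodule_def)
  show "v \<in> N \<Longrightarrow> w \<in> N \<Longrightarrow> v - w \<in> N"
  proof -
    assume vw: "v \<in> N" "w \<in> N"
    have "- 1 \<in> (polys {1..n} :: 'a mpoly set)" by (intro polys_uminus polys_one)
    then have "v + (\<lambda>b. (- 1) * w b) \<in> N" by (intro 1 2 vw)
    moreover have "v + (\<lambda>b. (- 1) * w b) = v - w" by (rule ext) simp
    ultimately show ?thesis by simp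
  qed
  show "0 \<in> N" using assms by (simp add: submodule_def)
qed

lemma ipart_int: "ipart (int d) = hpart d"
  by (rule ext) (simp add: ipart_def hpart_def)

text \<open>Induction on the rank. The last entries of the elements of \<open>N0\<close> form a homogeneous ideal;
  lifts of its generators together with generators of the elements with last entry zero generate
  \<open>N0\<close>.\<close>

lemma graded_submodule_finite_basis:
  fixes N0 :: "(nat \<Rightarrow> 'k::field mpoly) set"
  shows "graded_submodule n ds N0 \<Longrightarrow> \<exists>S. finite S \<and> S \<subseteq> N0 \<and> (\<forall>g\<in>S. \<exists>e. g \<in> graded_vectors n ds e) \<and>
    (\<forall>N. submodule n N \<longrightarrow> S \<subseteq> N \<longrightarrow> N0 \<subseteq> N)"
proof (induction ds arbitrary: N0 rule: rev_induct)
  case Nil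
  then have "N0 \<subseteq> {0}" by (auto simp: graded_submodule_def free_mod_def fun_eq_iff)
  then show ?case by (intro exI[of _ "{}"]) (auto simp: submodule_def)
next
  case (snoc e0 ds)
  let ?r = "length ds"
  have N0: "submodule n N0" "N0 \<subseteq> free_mod n (Suc ?r)" "\<And>v e. v \<in> N0 \<Longrightarrow> vpart (ds @ [e0]) e v \<in> N0"
    using snoc.prems by (auto simp: graded_submodule_def)
  note N0' = submoduleD[OF N0(1)]
  define last where "last = (\<lambda>v. v ?r) ` N0"
  have last: "graded_ideal n last"
    unfolding graded_ideal_def
  proof (intro conjI ballI allI)
    show "last \<subseteq> polys {1..n}" using N0(2) by (auto simp: last_def free_mod_def)
    show "0 \<in> last" unfolding last_def by (rule image_eqI[OF _ N0'(1)]) simp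
    fix p assume "p \<in> last"
    then obtain v where v: "v \<in> N0" "p = v ?r" by (auto simp: last_def)
    show "p + q \<in> last" if "q \<in> last" for q
    proof -
      obtain w where w: "w \<in> N0" "q = w ?r" using \<open>q \<in> last\<close> by (auto simp: last_def)
      show ?thesis unfolding last_def by (rule image_eqI[OF _ N0'(2)[OF v(1) w(1)]]) (simp add: v w)
    qed
    show "r * p \<in> last" if "r \<in> polys {1..n}" for r
      unfolding last_def by (rule image_eqI[OF _ N0'(3)[OF that v(1)]]) (simp add: v)
    show "hpart d p \<in> last" for d
      unfolding last_def by (rule image_eqI[OF _ N0(3)[OF v(1), of "int d + e0"]]) (simp add: v vpart_def ipart_int)
  qed
  obtain S0 where S0: "finite S0" "S0 \<subseteq> last" "\<forall>p\<in>S0. \<exists>d. p \<in> homog n (int d)"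
    "\<And>Q. 0 \<in> Q \<Longrightarrow> (\<forall>p\<in>Q. \<forall>q\<in>Q. p + q \<in> Q) \<Longrightarrow> (\<forall>r\<in>polys {1..n}. \<forall>p\<in>Q. r * p \<in> Q) \<Longrightarrow> S0 \<subseteq> Q \<Longrightarrow> last \<subseteq> Q"
    using graded_ideal_finite_basis[OF last] by blast
  have "\<forall>p\<in>S0. \<exists>g. g \<in> N0 \<and> g ?r = p \<and> (\<exists>e. g \<in> graded_vectors n (ds @ [e0]) e)"
  proof
    fix p assume p: "p \<in> S0"
    then obtain v where v: "v \<in> N0" "p = v ?r" using S0(2) by (auto simp: last_def)
    obtain d where d: "p \<in> homog n (int d)" using S0(3) p by blast
    define g where "g = vpart (ds @ [e0]) (int d + e0) v"
    have "g \<in> N0" unfolding g_def by (rule N0(3)[OF v(1)])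
    moreover have "g ?r = p" using ipart_self[OF d] by (simp add: g_def vpart_def v(2))
    moreover have "g \<in> graded_vectors n (ds @ [e0]) (int d + e0)"
      unfolding g_def by (rule vpart_graded) (use v(1) N0(2) in auto)
    ultimately show "\<exists>g. g \<in> N0 \<and> g ?r = p \<and> (\<exists>e. g \<in> graded_vectors n (ds @ [e0]) e)" by blast
  qed
  from bchoice[OF this] obtain g where g: "\<And>p. p \<in> S0 \<Longrightarrow> g p \<in> N0" "\<And>p. p \<in> S0 \<Longrightarrow> g p ?r = p"
    "\<And>p. p \<in> S0 \<Longrightarrow> \<exists>e. g p \<in> graded_vectors n (ds @ [e0]) e" by blast
  define N1 where "N1 = {v \<in> N0. v ?r = 0}"
  have zero_from: "v b = 0" if "v \<in> N1" "b \<ge> ?r" for v b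
    using that N0(2) by (cases "b = ?r") (auto simp: N1_def free_mod_def)
  have "graded_submodule n ds N1"
    unfolding graded_submodule_def
  proof (intro conjI ballI allI)
    show "submodule n N1" unfolding submodule_def N1_def using N0' by simp
    show "N1 \<subseteq> free_mod n ?r"
    proof
      fix v assume v: "v \<in> N1"
      then have "v \<in> free_mod n (Suc ?r)" using N0(2) by (auto simp: N1_def)
      then show "v \<in> free_mod n ?r" using zero_from[OF v] by (auto simp: free_mod_def)
    qed
    fix v e assume v: "v \<in> N1"
    have ip0: "ipart c 0 = (0 :: 'k mpoly)" for c
      by (rule poly_mapping_eqI) (simp add: ipart_def lookup_pick)
    have "vpart ds e v = vpart (ds @ [e0]) e v"
    proof (rule ext)
      fix b
      show "vpart ds e v b = vpart (ds @ [e0]) e v b"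
        using v by (cases b ?r rule: linorder_cases) (auto simp: vpart_def nth_append N1_def ip0)
    qed
    moreover have "vpart (ds @ [e0]) e v \<in> N0" using v N0(3) by (simp add: N1_def)
    moreover have "vpart ds e v ?r = 0" by (simp add: vpart_def)
    ultimately show "vpart ds e v \<in> N1" by (simp add: N1_def)
  qed
  from snoc.IH[OF this] obtain S1 where S1: "finite S1" "S1 \<subseteq> N1" "\<forall>g\<in>S1. \<exists>e. g \<in> graded_vectors n ds e"
    "\<forall>N. submodule n N \<longrightarrow> S1 \<subseteq> N \<longrightarrow> N1 \<subseteq> N" by (elim exE conjE)
  show ?case
  proof (intro exI[of _ "S1 \<union> g ` S0"] conjI allI impI)
    show "finite (S1 \<union> g ` S0)" using S1(1) S0(1) by simp
    show "S1 \<union> g ` S0 \<subseteq> N0" using S1(2) g(1) by (auto simp: N1_def)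
    show "\<forall>h\<in>S1 \<union> g ` S0. \<exists>e. h \<in> graded_vectors n (ds @ [e0]) e"
    proof
      fix h assume "h \<in> S1 \<union> g ` S0"
      then show "\<exists>e. h \<in> graded_vectors n (ds @ [e0]) e"
      proof
        assume h: "h \<in> S1"
        then obtain e where e: "h \<in> graded_vectors n ds e" using S1(3) by blast
        have "h b = 0" if "b \<ge> ?r" for b using zero_from h S1(2) that by blast
        then have "h \<in> graded_vectors n (ds @ [e0]) e"
          using e by (auto simp: graded_vectors_def nth_append less_Suc_eq)
        then show ?thesis by blast
      qed (use g(3) in blast)
    qed
    fix N assume N: "submodule n N" "S1 \<union> g ` S0 \<subseteq> N"
    note N' = submoduleD[OF N(1)]
    have N1N: "N1 \<subseteq> N" using S1(4)[rule_format, OF N(1)] N(2) by blast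
    define Q where "Q = (\<lambda>w. w ?r) ` (N \<inter> N0)"
    have "last \<subseteq> Q"
    proof (rule S0(4))
      show "0 \<in> Q" unfolding Q_def by (rule image_eqI[of _ _ 0]) (auto simp: N'(1) N0'(1))
      show "\<forall>p\<in>Q. \<forall>q\<in>Q. p + q \<in> Q"
      proof (intro ballI)
        fix p q assume "p \<in> Q" "q \<in> Q"
        then obtain v w where "v \<in> N \<inter> N0" "p = v ?r" "w \<in> N \<inter> N0" "q = w ?r" by (auto simp: Q_def)
        then show "p + q \<in> Q" unfolding Q_def by (intro image_eqI[of _ _ "v + w"]) (auto intro: N'(2) N0'(2))
      qed
      show "\<forall>r\<in>polys {1..n}. \<forall>p\<in>Q. r * p \<in> Q"
      proof (intro ballI)
        fix r p :: "'k mpoly" assume r: "r \<in> polys {1..n}" and "p \<in> Q"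
        then obtain v where "v \<in> N \<inter> N0" "p = v ?r" by (auto simp: Q_def)
        then show "r * p \<in> Q" unfolding Q_def using N'(3)[OF r] N0'(3)[OF r]
          by (intro image_eqI[of _ _ "\<lambda>b. r * v b"]) auto
      qed
      show "S0 \<subseteq> Q"
      proof
        fix p assume p: "p \<in> S0"
        then have "g p \<in> N \<inter> N0" using N(2) g(1) by blast
        then show "p \<in> Q" unfolding Q_def using g(2)[OF p] by (intro image_eqI[of _ _ "g p"]) auto
      qed
    qed
    show "N0 \<subseteq> N"
    proof
      fix v assume v: "v \<in> N0"
      then have "v ?r \<in> Q" using \<open>last \<subseteq> Q\<close> by (auto simp: last_def)
      then obtain w where w: "w \<in> N" "w \<in> N0" "v ?r = w ?r" by (auto simp: Q_def)
      have "v - w \<in> N1" using N0'(4)[OF v w(2)] w(3) by (simp add: N1_def)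
      then have "(v - w) + w \<in> N" using N1N N'(2) w(1) by blast
      then show "v \<in> N" by simp
    qed
  qed
qed

lemma graded_submodule_image:
  fixes N0 :: "(nat \<Rightarrow> 'k::field mpoly) set"
  assumes N0: "graded_submodule n ds N0"
  shows "\<exists>es C. homog_matrix n ds es C \<and> apply_mat (length ds) (length es) C ` free_mod n (length es) = N0"
proof -
  obtain S where S: "finite S" "S \<subseteq> N0" "\<forall>g\<in>S. \<exists>e. g \<in> graded_vectors n ds e"
    "\<And>N. submodule n N \<Longrightarrow> S \<subseteq> N \<Longrightarrow> N0 \<subseteq> N"
    using graded_submodule_finite_basis[OF N0] by blast
  obtain gs where gs: "set gs = S" using finite_list[OF S(1)] by blast
  obtain dg where dg: "\<And>g. g \<in> S \<Longrightarrow> g \<in> graded_vectors n ds (dg g)" using bchoice[OF S(3)] by blast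
  define es where "es = map dg gs"
  define C where "C a b = (gs ! b) a" for a b
  have len: "length es = length gs" by (simp add: es_def)
  have gsS: "gs ! b \<in> S" if "b < length gs" for b using gs that by auto
  have sub: "submodule n N0" "N0 \<subseteq> free_mod n (length ds)" using N0 by (auto simp: graded_submodule_def)
  note N0' = submoduleD[OF sub(1)]
  let ?A = "apply_mat (length ds) (length es) C"
  have hm: "homog_matrix n ds es C"
    unfolding homog_matrix_def C_def using dg[OF gsS] len by (auto simp: graded_vectors_def es_def)
  have "?A ` free_mod n (length es) \<subseteq> N0"
  proof
    fix v assume "v \<in> ?A ` free_mod n (length es)"
    then obtain u where u: "u \<in> free_mod n (length gs)" "v = ?A u" by (auto simp: len)
    have part: "(\<lambda>a. \<Sum>b<k. (gs ! b) a * u b) \<in> N0" if "k \<le> length gs" for k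
      using that
    proof (induction k)
      case 0
      then show ?case using N0'(1) by (simp add: zero_fun_def)
    next
      case (Suc k)
      have "u k \<in> polys {1..n}" using u(1) Suc.prems by (simp add: free_mod_def)
      then have "(\<lambda>a. u k * (gs ! k) a) \<in> N0" using N0'(3) gsS[of k] S(2) Suc.prems by auto
      moreover have "(\<lambda>a. \<Sum>b<k. (gs ! b) a * u b) \<in> N0" using Suc by simp
      ultimately have "(\<lambda>a. \<Sum>b<k. (gs ! b) a * u b) + (\<lambda>a. u k * (gs ! k) a) \<in> N0" using N0'(2) by blast
      moreover have "(\<lambda>a. \<Sum>b<k. (gs ! b) a * u b) + (\<lambda>a. u k * (gs ! k) a) = (\<lambda>a. \<Sum>b<Suc k. (gs ! b) a * u b)"
        by (rule ext) (simp add: mult.commute)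
      ultimately show ?case by simp
    qed
    have "v = (\<lambda>a. \<Sum>b<length gs. (gs ! b) a * u b)"
    proof (rule ext)
      fix a
      have "(gs ! b) a = 0" if "\<not> a < length ds" "b < length gs" for b
        using gsS[OF that(2)] S(2) sub(2) that(1) by (auto simp: free_mod_def)
      then show "v a = (\<Sum>b<length gs. (gs ! b) a * u b)" by (simp add: u(2) apply_mat_def C_def len)
    qed
    then show "v \<in> N0" using part by simp
  qed
  moreover have "N0 \<subseteq> ?A ` free_mod n (length es)"
  proof (rule S(4))
    have add: "?A (v + w) = ?A v + ?A w" for v w
      by (rule ext) (simp add: apply_mat_def distrib_left sum.distrib)
    show "submodule n (?A ` free_mod n (length es))"
      unfolding submodule_def
    proof (intro conjI ballI)
      have "?A 0 = 0" using add[of 0 0] by simp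
      then show "0 \<in> ?A ` free_mod n (length es)" by (intro image_eqI[of _ _ 0]) (auto simp: free_mod_def)
      fix v assume "v \<in> ?A ` free_mod n (length es)"
      then obtain v' where v': "v' \<in> free_mod n (length es)" "v = ?A v'" by blast
      show "v + w \<in> ?A ` free_mod n (length es)" if "w \<in> ?A ` free_mod n (length es)" for w
      proof -
        obtain w' where w': "w' \<in> free_mod n (length es)" "w = ?A w'" using \<open>w \<in> _\<close> by blast
        have "v' + w' \<in> free_mod n (length es)" using v'(1) w'(1) by (auto simp: free_mod_def)
        then show ?thesis unfolding v'(2) w'(2) add[symmetric] by (rule imageI)
      qed
      show "(\<lambda>b. r * v b) \<in> ?A ` free_mod n (length es)" if "r \<in> polys {1..n}" for r
      proof -
        have "(\<lambda>b. r * v' b) \<in> free_mod n (length es)" using v'(1) that by (auto simp: free_mod_def)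
        then show ?thesis unfolding v'(2) apply_mat_scale[symmetric] by (rule imageI)
      qed
    qed
    show "S \<subseteq> ?A ` free_mod n (length es)"
    proof
      fix h assume "h \<in> S"
      then obtain k where k: "k < length gs" "h = gs ! k" using gs by (metis in_set_conv_nth)
      define u where "u = (\<lambda>b. if b = k then 1 else 0 :: 'k mpoly)"
      have "u \<in> free_mod n (length es)" using k(1) by (auto simp: u_def free_mod_def len)
      moreover have "h = ?A u"
      proof (rule ext)
        fix a
        have "(\<Sum>b<length gs. (gs ! b) a * u b) = (\<Sum>b<length gs. if b = k then (gs ! k) a else 0)"
          by (rule sum.cong) (auto simp: u_def)
        then have "(\<Sum>b<length gs. (gs ! b) a * u b) = h a" using k by simp
        moreover have "h a = 0" if "\<not> a < length ds"
          using \<open>h \<in> S\<close> S(2) sub(2) that by (auto simp: free_mod_def)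
        ultimately show "h a = ?A u a" by (simp add: apply_mat_def C_def len)
      qed
      ultimately show "h \<in> ?A ` free_mod n (length es)" by blast
    qed
  qed
  ultimately show ?thesis using hm by blast
qed

lemma kernel_graded_submodule:
  assumes M: "homog_matrix n ds es M"
  shows "graded_submodule n es {v \<in> free_mod n (length es). apply_mat (length ds) (length es) M v = 0}"
proof -
  let ?A = "apply_mat (length ds) (length es) M"
  have add: "?A (v + w) = ?A v + ?A w" for v w
    by (rule ext) (simp add: apply_mat_def distrib_left sum.distrib)
  have zero: "?A 0 = 0" using add[of 0 0] by simp
  have part: "?A (vpart es e v) = 0" if "?A v = 0" for v e
  proof -
    have "ipart c 0 = (0 :: 'a mpoly)" for c
      by (rule poly_mapping_eqI) (simp add: ipart_def lookup_pick)
    then show ?thesis unfolding apply_mat_vpart[OF M] that by (simp add: vpart_def fun_eq_iff)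
  qed
  have free: "vpart es e v \<in> free_mod n (length es)" if "v \<in> free_mod n (length es)" for v e
    by (rule graded_vectors_free[OF vpart_graded[OF that]])
  have scale: "?A (\<lambda>b. r * v b) = 0" if "?A v = 0" for r v
    unfolding apply_mat_scale that by (simp add: fun_eq_iff)
  show ?thesis
    unfolding graded_submodule_def submodule_def
  proof (intro conjI ballI allI)
    show "0 \<in> {v \<in> free_mod n (length es). ?A v = 0}" using zero by (simp add: free_mod_def)
    fix v assume v: "v \<in> {v \<in> free_mod n (length es). ?A v = 0}"
    show "v + w \<in> {v \<in> free_mod n (length es). ?A v = 0}" if "w \<in> {v \<in> free_mod n (length es). ?A v = 0}" for w
      using v that by (auto simp: add free_mod_def)
    show "(\<lambda>b. r * v b) \<in> {v \<in> free_mod n (length es). ?A v = 0}" if "r \<in> polys {1..n}" for r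
      using v that scale by (auto simp: free_mod_def)
    show "vpart es e v \<in> {v \<in> free_mod n (length es). ?A v = 0}" for e
      using v part free by blast
  qed blast
qed

text \<open>The augmentation is the matrix of generators of \<open>K\<close>, viewed as a submodule of the free
  module of rank one, and every further matrix consists of generators of the kernel of the
  previous one.\<close>

theorem graded_free_resolution_exists:
  fixes K :: "'k::field mpoly set"
  assumes K: "graded_ideal n K"
  shows "\<exists>ds aug D. graded_free_resolution n K ds aug D"
proof -
  note K' = graded_idealD[OF K]
  define N0 where "N0 = {v :: nat \<Rightarrow> 'k mpoly. v 0 \<in> K \<and> (\<forall>b\<ge>1. v b = 0)}"
  have "graded_submodule n [0] N0"
    unfolding graded_submodule_def submodule_def
  proof (intro conjI ballI allI)
    show "N0 \<subseteq> free_mod n (length [0 :: int])" using K'(1) by (auto simp: N0_def free_mod_def)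
    fix v e assume v: "v \<in> N0"
    have "ipart e (v 0) \<in> K"
    proof (cases "e < 0")
      case True
      then have "ipart e (v 0) = 0" by (intro poly_mapping_eqI) (auto simp: ipart_def lookup_pick)
      then show ?thesis using K'(2) by simp
    next
      case False
      then have "ipart e (v 0) = hpart (nat e) (v 0)"
        using fun_cong[OF ipart_int[of "nat e"], of "v 0"] by simp
      moreover have "v 0 \<in> K" using v by (simp add: N0_def)
      ultimately show ?thesis using K'(5) by simp
    qed
    then show "vpart [0] e v \<in> N0" by (simp add: N0_def vpart_def)
  qed (use K' in \<open>auto simp: N0_def\<close>)
  then obtain es0 C0 where C0: "homog_matrix n [0] es0 C0" "apply_mat (length [0 :: int]) (length es0) C0 ` free_mod n (length es0) = N0"
    using graded_submodule_image by blast
  define good where "good x \<longleftrightarrow> homog_matrix n (fst x) (fst (snd x)) (snd (snd x))"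
    for x :: "int list \<times> int list \<times> (nat \<Rightarrow> nat \<Rightarrow> 'k mpoly)"
  define nxt where "nxt x y \<longleftrightarrow> fst y = fst (snd x) \<and>
      apply_mat (length (fst y)) (length (fst (snd y))) (snd (snd y)) ` free_mod n (length (fst (snd y))) =
      {v \<in> free_mod n (length (fst (snd x))). apply_mat (length (fst x)) (length (fst (snd x))) (snd (snd x)) v = 0}"
    for x y :: "int list \<times> int list \<times> (nat \<Rightarrow> nat \<Rightarrow> 'k mpoly)"
  have "\<exists>f. \<forall>q. (good (f q) \<and> (q = 0 \<longrightarrow> f q = ([0], es0, C0))) \<and> nxt (f q) (f (Suc q))"
  proof (rule dependent_nat_choice)
    show "\<exists>x. good x \<and> (0 = 0 \<longrightarrow> x = ([0], es0, C0))" using C0(1) by (auto simp: good_def)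
    fix x and q :: nat assume "good x \<and> (q = 0 \<longrightarrow> x = ([0], es0, C0))"
    then have hx: "homog_matrix n (fst x) (fst (snd x)) (snd (snd x))" by (simp add: good_def)
    from graded_submodule_image[OF kernel_graded_submodule[OF hx]] obtain es C where "homog_matrix n (fst (snd x)) es C"
      "apply_mat (length (fst (snd x))) (length es) C ` free_mod n (length es) =
        {v \<in> free_mod n (length (fst (snd x))). apply_mat (length (fst x)) (length (fst (snd x))) (snd (snd x)) v = 0}"
      by (elim exE conjE)
    then show "\<exists>y. (good y \<and> (Suc q = 0 \<longrightarrow> y = ([0], es0, C0))) \<and> nxt x y"
      by (intro exI[of _ "(fst (snd x), es, C)"]) (simp add: good_def nxt_def)
  qed
  then obtain f where f: "\<And>q. good (f q)" "f 0 = ([0], es0, C0)" "\<And>q. nxt (f q) (f (Suc q))" by blast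
  define ds where "ds q = fst (snd (f q))" for q
  define D where "D q = snd (snd (f (Suc q)))" for q
  define aug where "aug b = C0 0 b" for b
  have fS: "fst (f (Suc q)) = ds q" for q using f(3)[of q] by (simp add: nxt_def ds_def)
  have hm: "homog_matrix n (ds q) (ds (Suc q)) (D q)" for q
    using f(1)[of "Suc q"] by (simp add: good_def fS ds_def[symmetric] D_def[symmetric])
  have ds0: "ds 0 = es0" by (simp add: ds_def f(2))
  have ex0: "{v \<in> free_mod n (length es0). apply_mat 1 (length es0) C0 v = 0} =
      apply_mat (length (ds 0)) (length (ds 1)) (D 0) ` free_mod n (length (ds 1))"
    using f(3)[of 0] unfolding nxt_def One_nat_def fS ds_def[symmetric] D_def[symmetric] by (simp add: f(2) ds0)
  have exS: "{v \<in> free_mod n (length (ds (Suc q))). apply_mat (length (ds q)) (length (ds (Suc q))) (D q) v = 0} =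
      apply_mat (length (ds (Suc q))) (length (ds (Suc (Suc q)))) (D (Suc q)) ` free_mod n (length (ds (Suc (Suc q))))" for q
    using f(3)[of "Suc q"] unfolding nxt_def fS ds_def[symmetric] D_def[symmetric] by simp
  have eps: "apply_mat 1 (length es0) C0 v = (\<lambda>a. if a = 0 then \<Sum>b<length es0. aug b * v b else 0)" for v
    by (rule ext) (simp add: apply_mat_def aug_def)
  have "graded_free_resolution n K ds aug D"
    unfolding graded_free_resolution_def Let_def
  proof (intro conjI allI impI)
    show "aug b \<in> homog n (ds 0 ! b)" if "b < length (ds 0)" for b
      using C0(1) that by (simp add: homog_matrix_def aug_def ds0)
    show "D q a b \<in> homog n (ds (Suc q) ! b - ds q ! a)" if "a < length (ds q)" "b < length (ds (Suc q))" for q a b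
      using hm[of q] that by (simp add: homog_matrix_def)
    show "(\<lambda>v. \<Sum>b<length (ds 0). aug b * v b) ` free_mod n (length (ds 0)) = K"
    proof -
      have "(\<lambda>v. \<Sum>b<length es0. aug b * v b) ` free_mod n (length es0) = (\<lambda>w. w 0) ` N0"
        unfolding C0(2)[symmetric] image_image using eps by simp
      also have "\<dots> = K"
      proof (intro equalityI subsetI)
        fix p assume "p \<in> K"
        then show "p \<in> (\<lambda>w. w 0) ` N0"
          by (intro image_eqI[of _ _ "\<lambda>b. if b = 0 then p else 0"]) (auto simp: N0_def)
      qed (auto simp: N0_def)
      finally show ?thesis by (simp add: ds0)
    qed
    have "apply_mat 1 (length es0) C0 v = 0 \<longleftrightarrow> (\<Sum>b<length es0. aug b * v b) = 0" for v
      unfolding eps by (auto simp: fun_eq_iff)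
    then show "{v \<in> free_mod n (length (ds 0)). (\<Sum>b<length (ds 0). aug b * v b) = 0} =
        apply_mat (length (ds 0)) (length (ds (Suc 0))) (D 0) ` free_mod n (length (ds 1))"
      using ex0 by (simp add: ds0)
  qed (rule exS)
  then show ?thesis by blast
qed

section \<open>The equivalence\<close>

lemma monomial_ideal_graded:
  assumes "\<And>m u. m \<in> M \<Longrightarrow> keys u \<subseteq> {1..n} \<Longrightarrow> u + m \<in> M"
  shows "graded_ideal n (monomial_ideal n M)"
proof -
  have id: "ideal (monomial_ideal n M) (poly_ring n)" by (rule monomial_ideal_ideal) (rule assms)
  note J = idealD_poly[OF id]
  have part: "hpart d p \<in> monomial_ideal n M" if "p \<in> monomial_ideal n M" for p d
    using that by (auto simp: monomial_ideal_def hpart_def keys_pick)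
  show ?thesis
    unfolding graded_ideal_def by (intro conjI ballI allI J(1-4) part)
qed

theorem proposition3p4:
  fixes I :: "'k::field_char_0 mpoly set" and n :: nat
  assumes "n \<ge> 2"
    and "ideal I (poly_ring n)"
    and "homogeneous_ideal n I"
    and "I \<noteq> carrier (poly_ring n)"
    and "artinian_ring (poly_ring n Quot I)"
  shows
    "(weak_lefschetz n I \<longleftrightarrow>
        (\<forall>T d. T \<in> min_gens (gin n I) \<and> mdeg T = d \<and> max_var T = n \<longrightarrow>
           d \<ge> reduction_number n I + 1)) \<and>
     ((\<forall>T d. T \<in> min_gens (gin n I) \<and> mdeg T = d \<and> max_var T = n \<longrightarrow>
           d \<ge> reduction_number n I + 1) \<longleftrightarrow>
        (\<forall>\<alpha> \<in> gin_J n I (n - 1). sum_list \<alpha> + gin_f n I \<alpha> \<ge> reduction_number n I + 1)) \<and>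
     (weak_lefschetz n I \<longleftrightarrow>
        (\<forall>j \<le> int (reduction_number n I).
           graded_betti n (gin n I) (n - 1) (int (n - 1) + j) = 0))"
proof -
  have I: "graded_ideal n I" by (rule homogeneous_ideal_graded[OF assms(3,2)])
  obtain D where D: "\<And>d. d \<ge> D \<Longrightarrow> homog n (int d) \<subseteq> I"
    using artinian_contains_high_degrees[OF I assms(5)] by metis
  obtain g where gl: "g \<in> general_linear n" "general_coords n (gl_act n g ` I)"
    "gin n I = monomial_ideal n (lms (gl_act n g ` I))"
    using gin_eq_initial[OF I D] by metis
  have "1 \<notin> I"
  proof
    assume "1 \<in> I"
    then have "r \<in> I" if "r \<in> polys {1..n}" for r using graded_idealD(4)[OF I that, of 1] by simp
    then show False using assms(4) graded_idealD(1)[OF I] by auto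
  qed
  then interpret general_position n I g
    using assms(1) I D gl(1,2) by unfold_locales auto
  have gin: "gin n I = J" using gl(3) by (simp add: M_def K_def)
  have J: "graded_ideal n J" by (rule monomial_ideal_graded) (rule M_add)
  have betti: "graded_betti n J (n - 1) (int (n - 1) + j) = 0 \<longleftrightarrow>
      (\<forall>p\<in>homog n (j - 1). (\<forall>i\<in>{1..n}. xvar i * p \<in> J) \<longrightarrow> p \<in> J)" for j
  proof -
    have "int (n - 1) + j - int n = j - 1" using n by simp
    then show ?thesis
      using graded_betti_zero_iff_socle[OF n graded_free_resolution_exists[OF J],
          of "int (n - 1) + j"] by simp
  qed
  have shift: "(\<forall>j \<le> int s. P (j - 1)) \<longleftrightarrow> (\<forall>e < int s. P e)" for P :: "int \<Rightarrow> bool"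
  proof
    assume *: "\<forall>j \<le> int s. P (j - 1)"
    show "\<forall>e < int s. P e"
    proof (intro allI impI)
      fix e assume "e < int s"
      then show "P e" using *[rule_format, of "e + 1"] by simp
    qed
  qed simp
  have "injective_below \<longleftrightarrow> (\<forall>j \<le> int s. graded_betti n J (n - 1) (int (n - 1) + j) = 0)"
    unfolding injective_below_iff_socle betti
    by (rule shift[of "\<lambda>e. \<forall>p\<in>homog n e. (\<forall>i\<in>{1..n}. xvar i * p \<in> J) \<longrightarrow> p \<in> J", symmetric])
  then show ?thesis
    unfolding reduction_number_eq weak_lefschetz_iff_injective_below injective_below_iff_gin_f[OF gin, symmetric]
    unfolding gin injective_below_iff_generators[symmetric] by blast
qed

end
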